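(* Let $\mathcal{X} = \mathbb{R}^d$, $\mathcal{Y} = \mathbb{R}^k$ and let $\mathcal{G}$ be a compact group with orthogonal representations $\phi$ on $\mathcal{X}$ and $\psi$ on $\mathcal{Y}$. Let $X \sim \mathcal{N}(0, \sigma_X^2 I_d)$ and $Y = h_\Theta(X) + \xi$ where $h_\Theta(x) = \Theta^\top x$ is $\mathcal{G}$-equivariant and $\Theta \in \mathbb{R}^{d \times k}$. Assume $\xi$ is a random element of $\mathbb{R}^k$, independent of $X$, with mean $0$ and $\mathbb{E}[\xi \xi^\top ] = \sigma_\xi^2 I_k$ with $\sigma_\xi^2 < \infty$. Let $W$ be the least squares estimate of $\Theta$ from $n$ i.i.d.~training examples $((X_i, Y_i): i=1, \dots, n)$ distributed independently of and identically to $(X, Y)$ and let $\langle \chi_\psi, \chi_\phi\rangle = \int_{\mathcal{G}} \chi_\psi(g) \chi_\phi(g)\, d \lambda(g)$ denote the scalar product of the characters of the representations of $\mathcal{G}$. \begin{itemize} \item If $n > d + 1$ the generalisation gap is \[ \mathbb{E}\left[R[f_W] - R[ f_{\overline{W}}]\right] = \sigma_\xi^2 \frac{ dk - \langle \chi_\psi, \chi_\phi\rangle}{n - d - 1}. \] \item At the interpolation threshold $n \in [d-1, d+1]$, if $f_W$ is not $\mathcal{G}$-equivariant then the generalisation gap diverges to $\infty$. \item If $n < d- 1$ then the generalisation gap is \begin{align*} \mathbb{E}\left[R[f_W] - R[ f_{\overline{W}}]\right] &= \sigma_X^2 \frac{n(d-n)}{d(d-1)(d+2)} \left( (d+1) \|\Theta\|_F^2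 - \operatorname{tr}( J_\mathcal{G} \Theta^\top \Theta) \right) \\ &\phantom{=}+ \sigma_\xi^2 \frac{n( dk - \langle \chi_\psi, \chi_\phi\rangle)}{d (d - n - 1)} \end{align*} where each term is non-negative and $J_\mathcal{G} \in \mathbb{R}^{k \times k}$ is given by \[ J_\mathcal{G} = \int_\mathcal{G} (\chi_\phi(g) \psi(g) + \psi(g^2))\, d \lambda(g). \] \end{itemize} Each of the three statements in the list above continues to hold with $\ge$ in place of $=$ (respectively, the divergence still holds) when $f_{\overline{W}}$ is replaced by any predictor $f'$ such that $R[f'] \le R[f_{\overline{W}}]$.
   Context: $f_W(x)=W^\top x$ denotes the linear predictor with parameter $W\in\mathbb{R}^{d\times k}$. The risk of a predictor $f$ is $R[f]=\mathbb{E}[\|f(X)-Y\|_2^2]$ (conditional on any randomness in $f$). $\lambda$ is the normalised Haar measure on $\mathcal{G}$, $\chi_\phi(g)=\operatorname{tr}(\phi(g))$ and $\chi_\psi(g)=\operatorname{tr}(\psi(g))$ are the characters, and $\|\cdot\|_F$ is the Frobenius norm. $\overline{W} = \Psi(W)$ where $\Psi(W) = \int_\mathcal{G} \phi(g) W \psi(g^{-1})\, d\lambda(g)$, so that $f_{\overline W}(x)=\int_\mathcal{G}\psi(g^{-1})f_W(\phi(g)x)\,d\lambda(g)$ is the orbit-averaged (equivariant) version of $f_W$. The least squares estimate is the minimum-norm solution $W=(\mathbf{X}^\top\mathbf{X})^+\mathbf{X}^\top\mathbf{Y}$ with $\mathbf{X}\in\mathbb{R}^{n\times d}$, $\mathbf{Y}\in\mathbb{R}^{n\times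 k}$ the row-stacked training inputs/outputs.
   Formalization: The divergence at n in [d-1, d+1] is proved for nonzero noise variance (σ_ξ ≠ 0), since with σ_ξ = 0 and n = d-1 the gap is finite although f_W is generally not equivariant; σ_X > 0 is assumed throughout. *)

theory Defs
  imports "HOL-Probability.Probability" "HOL-Algebra.Group"
begin

text \<open>Matrices: an element of R^(a x b) is a term of type real^'b^'a (rows indexed by 'a).
  A parameter W in R^(d x k) is thus W :: real^'k^'d and f_W x = W^T x = transpose W *v x.\<close>

definition pinv :: "real^'n^'m \<Rightarrow> real^'m^'n" where
  "pinv A = (THE B. A ** B ** A = A \<and> B ** A ** B = B \<and>
                    transpose (A ** B) = A ** B \<and> transpose (B ** A) = B ** A)"

definition frob_norm :: "real^'n^'m \<Rightarrow> real" where
  "frob_norm A = sqrt (\<Sum>i\<in>UNIV. \<Sum>j\<in>UNIV. (A $ i $ j)^2)"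

definition linpred :: "real^'k^'d \<Rightarrow> real^'d \<Rightarrow> real^'k" where
  "linpred W x = transpose W *v x"

definition orth_rep :: "('g, 'b) monoid_scheme \<Rightarrow> 'g measure \<Rightarrow> ('g \<Rightarrow> real^'n^'n) \<Rightarrow> bool" where
  "orth_rep G lam \<rho> \<longleftrightarrow>
     (\<forall>g\<in>carrier G. \<forall>h\<in>carrier G. \<rho> (g \<otimes>\<^bsub>G\<^esub> h) = \<rho> g ** \<rho> h) \<and>
     \<rho> \<one>\<^bsub>G\<^esub> = mat 1 \<and>
     (\<forall>g\<in>carrier G. orthogonal_matrix (\<rho> g)) \<and>
     \<rho> \<in> borel_measurable lam"

definition haar_prob :: "('g, 'b) monoid_scheme \<Rightarrow> 'g measure \<Rightarrow> bool" where
  "haar_prob G lam \<longleftrightarrow> group G \<and> prob_space lam \<and> space lam = carrier G \<and>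
     (\<forall>g\<in>carrier G. (\<lambda>h. g \<otimes>\<^bsub>G\<^esub> h) \<in> lam \<rightarrow>\<^sub>M lam \<and> distr lam lam (\<lambda>h. g \<otimes>\<^bsub>G\<^esub> h) = lam) \<and>
     (\<forall>g\<in>carrier G. (\<lambda>h. h \<otimes>\<^bsub>G\<^esub> g) \<in> lam \<rightarrow>\<^sub>M lam \<and> distr lam lam (\<lambda>h. h \<otimes>\<^bsub>G\<^esub> g) = lam) \<and>
     (\<lambda>h. inv\<^bsub>G\<^esub> h) \<in> lam \<rightarrow>\<^sub>M lam \<and> distr lam lam (\<lambda>h. inv\<^bsub>G\<^esub> h) = lam"

definition lin_equivariant ::
  "('g, 'b) monoid_scheme \<Rightarrow> ('g \<Rightarrow> real^'d^'d) \<Rightarrow> ('g \<Rightarrow> real^'k^'k) \<Rightarrow> real^'k^'d \<Rightarrow> bool" where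
  "lin_equivariant G \<phi> \<psi> W \<longleftrightarrow>
     (\<forall>g\<in>carrier G. \<forall>x. linpred W (\<phi> g *v x) = \<psi> g *v linpred W x)"

definition orbit_avg ::
  "('g, 'b) monoid_scheme \<Rightarrow> 'g measure \<Rightarrow> ('g \<Rightarrow> real^'d^'d) \<Rightarrow> ('g \<Rightarrow> real^'k^'k) \<Rightarrow> real^'k^'d \<Rightarrow> real^'k^'d" where
  "orbit_avg G lam \<phi> \<psi> W = (\<integral>g. \<phi> g ** W ** \<psi> (inv\<^bsub>G\<^esub> g) \<partial>lam)"

definition char_prod ::
  "'g measure \<Rightarrow> ('g \<Rightarrow> real^'d^'d) \<Rightarrow> ('g \<Rightarrow> real^'k^'k) \<Rightarrow> real" where
  "char_prod lam \<phi> \<psi> = (\<integral>g. trace (\<psi> g) * trace (\<phi> g) \<partial>lam)"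

definition J_G ::
  "('g, 'b) monoid_scheme \<Rightarrow> 'g measure \<Rightarrow> ('g \<Rightarrow> real^'d^'d) \<Rightarrow> ('g \<Rightarrow> real^'k^'k) \<Rightarrow> real^'k^'k" where
  "J_G G lam \<phi> \<psi> = (\<integral>g. trace (\<phi> g) *\<^sub>R \<psi> g + \<psi> (g \<otimes>\<^bsub>G\<^esub> g) \<partial>lam)"

definition iso_gauss_density :: "real \<Rightarrow> real^'d \<Rightarrow> ennreal" where
  "iso_gauss_density \<sigma> x = ennreal (\<Prod>j\<in>UNIV. normal_density 0 \<sigma> (x $ j))"

definition risk :: "'m measure \<Rightarrow> ('m \<Rightarrow> real^'d) \<Rightarrow> ('m \<Rightarrow> real^'k) \<Rightarrow> (real^'d \<Rightarrow> real^'k) \<Rightarrow> real" where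
  "risk M X Y f = (\<integral>\<omega>. (norm (f (X \<omega>) - Y \<omega>))^2 \<partial>M)"

definition data_matrix :: "('n \<Rightarrow> real^'a) \<Rightarrow> real^'a^'n" where
  "data_matrix Z = (\<chi> i. Z i)"

text \<open>Minimum-norm least squares estimate W = (X^T X)^+ X^T Y.\<close>
definition lsq :: "real^'d^'n \<Rightarrow> real^'k^'n \<Rightarrow> real^'k^'d" where
  "lsq Xm Ym = pinv (transpose Xm ** Xm) ** transpose Xm ** Ym"

end

theory Submission
  imports Defs "HOL-Real_Asymp.Real_Asymp"
begin

text \<open>
  Since \<open>X\<close> is isotropic, the risk of \<open>f_W\<close> exceeds that of \<open>f_Wbar\<close> by \<open>\<sigma>X\<^sup>2\<close> times the squared Frobenius
  norm of \<open>perp W = W - \<Psi> W\<close>, where \<open>\<Psi>\<close> is an orthogonal projection of trace \<open>\<langle>\<chi>\<^sub>\<psi>, \<chi>\<^sub>\<phi>\<rangle>\<close> fixing \<open>\<Theta>\<close>.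
  Almost surely the design matrix \<open>A\<close> has full rank and \<open>W = P \<Theta> + K N\<close>, with noise \<open>N\<close>, \<open>K\<close> the
  pseudoinverse of \<open>A\<close> and \<open>P = K A\<close> the projection onto its row space. Averaging over \<open>N\<close> removes the cross term.
  The law of \<open>A\<close> is rotation invariant, so the noise term is \<open>dk - \<langle>\<chi>\<^sub>\<psi>, \<chi>\<^sub>\<phi>\<rangle>\<close> times the mean of a diagonal
  entry of \<open>K K\<^sup>T\<close>; its trace is a sum of inverse squared distances of a Gaussian vector to an independent
  subspace, that is, of inverse chi-square variables, whose mean is infinite exactly at the threshold.
  The signal term vanishes for \<open>n \<ge> d\<close>, where \<open>P = I\<close>; for \<open>n < d\<close> it is determined by the second moments
  of the uniformly distributed projection \<open>P\<close>, which follow from rotation invariance and \<open>tr P = n\<close>.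
\<close>

subsection \<open>Gaussian measures and isometries\<close>

text \<open>Expectations that may be infinite are taken as nonnegative integrals, so one noise
  computation serves all three regimes of n and the threshold needs no limit argument. Its location:
  for a Gaussian matrix with m rows in dimension p \<ge> m, the distance of a row to the span of the
  others has p - m + 1 degrees of freedom, and an inverse chi-square mean is finite exactly when
  these exceed 2. Applied to the design or its transpose, this singles out |n - d| \<le> 1. Two
  obstacles shape the rest: independence is assumed for pairs \<open>(X i, \<xi> i)\<close>, so
  independence of the whole design from the whole noise has to be assembled; and \<open>pinv\<close>
  is a definite description, so it is replaced at full rank by a formula in determinants whose
  measurability is evident. The denominator d (d - 1) (d + 2) comes from solving the two linear
  equations that idempotence and trace impose on the second moments of P. These moments pair four
  indices in three ways: one pairing reproduces \<Theta> and is killed by equivariance, the other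
  two yield the summands \<chi>_\<phi>(g) \<psi>(g) and \<psi>(g^2) of \<open>J_G\<close>.\<close>

lemma nn_integral_lborel_translate:
  fixes f :: "'a::euclidean_space \<Rightarrow> ennreal"
  assumes [measurable]: "f \<in> borel_measurable borel"
  shows "(\<integral>\<^sup>+x. f (c + x) \<partial>lborel) = (\<integral>\<^sup>+x. f x \<partial>lborel)"
  by (subst (2) lborel_distr_plus[of c, symmetric]) (simp add: nn_integral_distr)

lemma nn_integral_lborel_reflect:
  fixes f :: "'a::euclidean_space \<Rightarrow> ennreal"
  assumes [measurable]: "f \<in> borel_measurable borel"
  shows "(\<integral>\<^sup>+x. f (c - x) \<partial>lborel) = (\<integral>\<^sup>+x. f x \<partial>lborel)"
  by (subst (2) lborel_affine[of "-1" c]) (simp_all add: nn_integral_distr density_1)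

lemma linear_borel_measurable:
  fixes T :: "'a::euclidean_space \<Rightarrow> 'b::euclidean_space"
  assumes "linear T"
  shows "T \<in> borel_measurable borel"
  using assms by (intro borel_measurable_continuous_onI linear_continuous_on) (simp add: linear_linear)

lemma isometry_DIM_eq:
  fixes T :: "'a::euclidean_space \<Rightarrow> 'b::euclidean_space"
  assumes lin: "linear T" and nrm: "\<And>x. norm (T x) = norm x" and surj: "surj T"
  shows "DIM('a) = DIM('b)"
proof -
  have "inj T"
    unfolding linear_injective_0[OF lin] using nrm by (metis norm_eq_zero)
  then have "dim (T ` UNIV) = dim (UNIV :: 'a set)"
    using lin by (intro dim_image_eq) auto
  then show ?thesis
    using surj by simp
qed

text \<open>Both sides are translation invariant, so by Fubini's theorem they satisfy \<open>\<nu> A * \<lambda> B = \<lambda> A * \<nu> B\<close>;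
  for \<open>B\<close> a ball they agree.\<close>
lemma lborel_distr_isometry:
  fixes T :: "'a::euclidean_space \<Rightarrow> 'b::euclidean_space"
  assumes lin: "linear T" and nrm: "\<And>x. norm (T x) = norm x" and surj: "surj T"
  shows "distr lborel borel T = lborel"
proof -
  have [measurable]: "T \<in> borel_measurable borel"
    using lin by (rule linear_borel_measurable)
  have dim: "DIM('a) = DIM('b)"
    using assms by (rule isometry_DIM_eq)
  have key: "emeasure lborel (T -` A) * emeasure lborel B = emeasure lborel A * emeasure lborel (T -` B)"
    if [measurable]: "A \<in> sets borel" "B \<in> sets borel" for A B :: "'b set"
  proof -
    have TA [measurable]: "T -` A \<in> sets borel" "T -` B \<in> sets borel"
      using measurable_sets[OF \<open>T \<in> borel_measurable borel\<close>] that by (auto simp: vimage_def)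
    have ind: "indicator C (T x) = (indicator (T -` C) x :: ennreal)" for C x
      by (simp add: indicator_def)
    have "emeasure lborel (T -` A) * emeasure lborel B =
        (\<integral>\<^sup>+x. \<integral>\<^sup>+y. indicator A (T x) * indicator B y \<partial>lborel \<partial>lborel)"
      using TA by (simp add: nn_integral_cmult nn_integral_multc ind)
    also have "\<dots> = (\<integral>\<^sup>+x. \<integral>\<^sup>+y. indicator A (T x) * indicator B (T x + y) \<partial>lborel \<partial>lborel)"
      by (subst nn_integral_lborel_translate) auto
    also have "\<dots> = (\<integral>\<^sup>+y. \<integral>\<^sup>+x. indicator A (T x) * indicator B (T x + y) \<partial>lborel \<partial>lborel)"
      by (rule lborel_pair.Fubini'[symmetric]) simp
    also have "\<dots> = (\<integral>\<^sup>+y. \<integral>\<^sup>+x. indicator A (T x - y) * indicator B (T x) \<partial>lborel \<partial>lborel)"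
    proof (rule nn_integral_cong)
      fix y :: 'b
      obtain z where z: "y = T z" using surj by (metis surjD)
      show "(\<integral>\<^sup>+x. indicator A (T x) * indicator B (T x + y) \<partial>lborel) =
            (\<integral>\<^sup>+x. indicator A (T x - y) * indicator B (T x) \<partial>lborel)"
        using nn_integral_lborel_translate[of "\<lambda>x. indicator A (T x - y) * indicator B (T x)" z]
        by (simp add: z linear_add[OF lin] add.commute)
    qed
    also have "\<dots> = (\<integral>\<^sup>+x. \<integral>\<^sup>+y. indicator A (T x - y) * indicator B (T x) \<partial>lborel \<partial>lborel)"
      by (rule lborel_pair.Fubini') simp
    also have "\<dots> = (\<integral>\<^sup>+x. \<integral>\<^sup>+y. indicator A y * indicator B (T x) \<partial>lborel \<partial>lborel)"
      by (subst nn_integral_lborel_reflect) auto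
    also have "\<dots> = emeasure lborel A * emeasure lborel (T -` B)"
      using TA by (simp add: nn_integral_cmult nn_integral_multc ind)
    finally show ?thesis .
  qed
  have ball: "T -` ball 0 1 = ball 0 1"
    by (auto simp: nrm)
  have pos: "emeasure lborel (ball (0::'b) 1) \<noteq> 0" "emeasure lborel (ball (0::'b) 1) \<noteq> \<infinity>"
    using unit_ball_vol_pos[of "real DIM('b)"] by (simp_all add: emeasure_ball del: unit_ball_vol_pos)
  have eqb: "emeasure lborel (ball (0::'a) 1) = emeasure lborel (ball (0::'b) 1)"
    by (simp add: emeasure_ball dim)
  show ?thesis
  proof (rule measure_eqI)
    fix A assume "A \<in> sets (distr lborel borel T)"
    then have A: "A \<in> sets borel" by simp
    have "emeasure lborel (T -` A) = emeasure lborel A"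
      using key[OF A, of "ball 0 1"] pos unfolding ball eqb
      by (simp add: ennreal_mult_cancel_left mult.commute[of _ "emeasure lborel (ball 0 1)"])
    then show "emeasure (distr lborel borel T) A = emeasure lborel A"
      using A by (simp add: emeasure_distr)
  qed simp
qed

text \<open>Stated for an arbitrary Euclidean space: vectors, matrices, transposed matrices and
  pairs are then all covered by a single isometry argument.\<close>

definition gauss :: "real \<Rightarrow> 'a::euclidean_space measure" where
  "gauss \<sigma> = density lborel (\<lambda>x. ennreal (\<Prod>b\<in>Basis. normal_density 0 \<sigma> (x \<bullet> b)))"

lemma space_gauss [simp]: "space (gauss \<sigma>) = UNIV"
  and sets_gauss [simp, measurable_cong]: "sets (gauss \<sigma>) = sets borel"
  by (simp_all add: gauss_def)

text \<open>The radial form of the density gives invariance under isometries; the product form is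
  kept for computing coordinate by coordinate.\<close>

lemma prod_normal_density_eq:
  fixes x :: "'a::euclidean_space"
  shows "(\<Prod>b\<in>Basis. normal_density 0 \<sigma> (x \<bullet> b)) =
    (1 / sqrt (2 * pi * \<sigma>\<^sup>2)) ^ DIM('a) * exp (- (norm x)\<^sup>2 / (2 * \<sigma>\<^sup>2))"
proof -
  have "(norm x)\<^sup>2 = (\<Sum>b\<in>Basis. (x \<bullet> b)\<^sup>2)"
    by (subst power2_norm_eq_inner, subst euclidean_inner) (simp add: power2_eq_square)
  then have "exp (- (norm x)\<^sup>2 / (2 * \<sigma>\<^sup>2)) = (\<Prod>b\<in>Basis. exp (- (x \<bullet> b)\<^sup>2 / (2 * \<sigma>\<^sup>2)))"
    by (simp add: sum_divide_distrib sum_negf flip: exp_sum)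
  then show ?thesis
    by (simp add: normal_density_def prod_dividef power_one_over)
qed

lemma gauss_eq_density_norm:
  "gauss \<sigma> = density (lborel :: 'a::euclidean_space measure) (\<lambda>x.
    ennreal ((1 / sqrt (2 * pi * \<sigma>\<^sup>2)) ^ DIM('a) * exp (- (norm x)\<^sup>2 / (2 * \<sigma>\<^sup>2))))"
  by (simp add: gauss_def prod_normal_density_eq)

lemma nn_integral_gauss_prod:
  fixes f :: "'a::euclidean_space \<Rightarrow> real \<Rightarrow> ennreal"
  assumes [measurable]: "\<And>b. b \<in> Basis \<Longrightarrow> f b \<in> borel_measurable borel"
  shows "(\<integral>\<^sup>+x. (\<Prod>b\<in>Basis. f b (x \<bullet> b)) \<partial>gauss \<sigma>) =
    (\<Prod>b\<in>Basis. \<integral>\<^sup>+t. ennreal (normal_density 0 \<sigma> t) * f b t \<partial>lborel)"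
proof -
  have "(\<integral>\<^sup>+x. (\<Prod>b\<in>Basis. f b (x \<bullet> b)) \<partial>gauss \<sigma>) =
     (\<integral>\<^sup>+x. (\<Prod>b\<in>Basis. ennreal (normal_density 0 \<sigma> (x \<bullet> b)) * f b (x \<bullet> b)) \<partial>lborel)"
    unfolding gauss_def
    by (subst nn_integral_density) (auto simp: prod.distrib prod_ennreal)
  also have "\<dots> = (\<Prod>b\<in>Basis. \<integral>\<^sup>+t. ennreal (normal_density 0 \<sigma> t) * f b t \<partial>lborel)"
    by (rule nn_integral_lborel_prod) auto
  finally show ?thesis .
qed

lemma nn_integral_normal_density:
  "\<sigma> > 0 \<Longrightarrow> (\<integral>\<^sup>+t. ennreal (normal_density 0 \<sigma> t) \<partial>lborel) = 1"
  by (subst nn_integral_eq_integral) auto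

lemma prob_space_gauss: "\<sigma> > 0 \<Longrightarrow> prob_space (gauss \<sigma> :: 'a::euclidean_space measure)"
proof
  assume "\<sigma> > 0"
  then show "emeasure (gauss \<sigma>) (space (gauss \<sigma> :: 'a measure)) = 1"
    using nn_integral_gauss_prod[of "\<lambda>(_::'a) _. 1" \<sigma>]
    by (simp add: nn_integral_normal_density)
qed

text \<open>Source and target may be different types: besides rotations, \<open>T\<close> will be
  the transposition of matrices and the exchange of a vector with a matrix row.\<close>

lemma distr_gauss_isometry:
  fixes T :: "'a::euclidean_space \<Rightarrow> 'b::euclidean_space"
  assumes lin: "linear T" and nrm: "\<And>x. norm (T x) = norm x" and surj: "surj T"
  shows "distr (gauss \<sigma>) borel T = gauss \<sigma>"
proof -
  have [measurable]: "T \<in> borel_measurable borel"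
    using lin by (rule linear_borel_measurable)
  have dim: "DIM('a) = DIM('b)"
    using assms by (rule isometry_DIM_eq)
  show ?thesis
    unfolding gauss_eq_density_norm lborel_distr_isometry[OF assms, symmetric]
    by (simp add: density_distr nrm dim)
qed

lemma nn_integral_gauss_isometry:
  fixes T :: "'a::euclidean_space \<Rightarrow> 'b::euclidean_space"
  assumes "linear T" "\<And>x. norm (T x) = norm x" "surj T"
    and [measurable]: "f \<in> borel_measurable borel"
  shows "(\<integral>\<^sup>+x. f (T x) \<partial>gauss \<sigma>) = (\<integral>\<^sup>+x. f x \<partial>gauss \<sigma>)"
proof -
  have [measurable]: "T \<in> borel_measurable borel"
    using assms(1) by (rule linear_borel_measurable)
  show ?thesis
    by (subst distr_gauss_isometry[OF assms(1-3), symmetric]) (simp add: nn_integral_distr)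
qed

text \<open>Squared norms add on a product space, so the radial density factorises.\<close>

lemma gauss_pair:
  assumes "\<sigma> > 0"
  shows "gauss \<sigma> = (gauss \<sigma> :: 'a::euclidean_space measure) \<Otimes>\<^sub>M (gauss \<sigma> :: 'b::euclidean_space measure)"
proof -
  interpret A: prob_space "gauss \<sigma> :: 'a measure" by (rule prob_space_gauss) fact
  interpret B: prob_space "gauss \<sigma> :: 'b measure" by (rule prob_space_gauss) fact
  have eq: "(1 / sqrt (2 * pi * \<sigma>\<^sup>2)) ^ DIM('a \<times> 'b) * exp (- (norm z)\<^sup>2 / (2 * \<sigma>\<^sup>2)) =
     ((1 / sqrt (2 * pi * \<sigma>\<^sup>2)) ^ DIM('a) * exp (- (norm (fst z))\<^sup>2 / (2 * \<sigma>\<^sup>2))) *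
     ((1 / sqrt (2 * pi * \<sigma>\<^sup>2)) ^ DIM('b) * exp (- (norm (snd z))\<^sup>2 / (2 * \<sigma>\<^sup>2)))" for z :: "'a \<times> 'b"
  proof -
    have "- (norm z)\<^sup>2 / (2 * \<sigma>\<^sup>2) = - (norm (fst z))\<^sup>2 / (2 * \<sigma>\<^sup>2) + - (norm (snd z))\<^sup>2 / (2 * \<sigma>\<^sup>2)"
      by (cases z) (simp add: norm_Pair add_divide_distrib diff_divide_distrib)
    then show ?thesis
      by (simp only: exp_add DIM_prod power_add mult_ac)
  qed
  have eqE: "ennreal ((1 / sqrt (2 * pi * \<sigma>\<^sup>2)) ^ DIM('a \<times> 'b) * exp (- (norm z)\<^sup>2 / (2 * \<sigma>\<^sup>2))) =
     ennreal ((1 / sqrt (2 * pi * \<sigma>\<^sup>2)) ^ DIM('a) * exp (- (norm (fst z))\<^sup>2 / (2 * \<sigma>\<^sup>2))) *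
     ennreal ((1 / sqrt (2 * pi * \<sigma>\<^sup>2)) ^ DIM('b) * exp (- (norm (snd z))\<^sup>2 / (2 * \<sigma>\<^sup>2)))" for z :: "'a \<times> 'b"
    unfolding eq by (rule ennreal_mult) auto
  have sf: "sigma_finite_measure (density (lborel :: 'b measure) (\<lambda>x.
      ennreal ((1 / sqrt (2 * pi * \<sigma>\<^sup>2)) ^ DIM('b) * exp (- (norm x)\<^sup>2 / (2 * \<sigma>\<^sup>2)))))"
    using B.sigma_finite_measure_axioms unfolding gauss_eq_density_norm .
  show ?thesis
    unfolding gauss_eq_density_norm
    by (subst pair_measure_density[OF _ _ lborel.sigma_finite_measure_axioms sf])
       (simp_all only: lborel_prod split_beta' eqE, simp_all)
qed

lemma AE_gauss_lborel:
  "AE x in lborel. P x \<Longrightarrow> AE x in gauss \<sigma>. P x"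
  unfolding gauss_def by (subst AE_density) (auto elim: AE_mp)

section \<open>Inverse moments of sums of squared Gaussian coordinates\<close>

lemma nn_integral_normal_exp_square:
  assumes "\<sigma> > 0" "t \<ge> 0"
  shows "(\<integral>\<^sup>+x. ennreal (normal_density 0 \<sigma> x) * ennreal (exp (- t * x\<^sup>2)) \<partial>lborel) =
    ennreal ((1 + 2 * t * \<sigma>\<^sup>2) powr (- 1/2))"
proof -
  define r where "r = 1 + 2 * t * \<sigma>\<^sup>2"
  have r: "r > 0" using assms by (auto simp: r_def intro!: add_pos_nonneg)
  \<comment> \<open>Combining the exponents turns the integrand into a constant multiple of a normal
    density of variance \<sigma>^2 / (1 + 2 t \<sigma>^2); the constant is the ratio of the two
    normalisations.\<close>
  define \<tau> where "\<tau> = \<sigma> / sqrt r"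
  have \<tau>: "\<tau> > 0" "\<tau>\<^sup>2 = \<sigma>\<^sup>2 / r"
    using assms r by (auto simp: \<tau>_def power_divide)
  have "normal_density 0 \<sigma> x * exp (- t * x\<^sup>2) = r powr (-1/2) * normal_density 0 \<tau> x" for x
  proof -
    have "- x\<^sup>2 / (2 * \<sigma>\<^sup>2) + - t * x\<^sup>2 = - x\<^sup>2 / (2 * \<tau>\<^sup>2)"
      using assms r unfolding \<tau> by (simp add: field_simps r_def)
    moreover have "1 / sqrt (2 * pi * \<sigma>\<^sup>2) = r powr (-1/2) * (1 / sqrt (2 * pi * \<tau>\<^sup>2))"
      using assms r unfolding \<tau>
      by (simp add: real_sqrt_mult real_sqrt_divide powr_minus powr_half_sqrt field_simps)
    ultimately show ?thesis
      unfolding normal_density_def by (simp add: exp_add[symmetric] mult_ac)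
  qed
  then have "(\<integral>\<^sup>+x. ennreal (normal_density 0 \<sigma> x) * ennreal (exp (- t * x\<^sup>2)) \<partial>lborel) =
     (\<integral>\<^sup>+x. ennreal (r powr (-1/2)) * ennreal (normal_density 0 \<tau> x) \<partial>lborel)"
    by (simp flip: ennreal_mult)
  also have "\<dots> = ennreal (r powr (-1/2))"
    using \<tau> by (simp add: nn_integral_cmult nn_integral_normal_density)
  finally show ?thesis by (simp add: r_def)
qed

lemma nn_integral_exp_Ici:
  assumes "s > 0"
  shows "(\<integral>\<^sup>+t. ennreal (exp (- t * s)) * indicator {0..} t \<partial>lborel) = ennreal (1 / s)"
proof -
  have "((\<lambda>t. - exp (- t * s) / s) \<longlongrightarrow> 0) at_top"
    using assms by real_asymp
  then have "(\<integral>\<^sup>+t. ennreal (exp (- t * s)) * indicator {0..} t \<partial>lborel) =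
     ennreal (0 - (- exp (- 0 * s) / s))"
    using assms by (intro nn_integral_FTC_atLeast) (auto intro!: derivative_eq_intros)
  then show ?thesis by simp
qed

text \<open>For \<open>q > 2\<close> there is a primitive that vanishes at infinity. Otherwise the
  exponent is at least -1, so the integrand dominates 1 / (1 + 2 t c), whose integral grows like a
  logarithm. The divergence at the interpolation threshold originates here.\<close>

lemma nn_integral_powr_Ici:
  fixes q :: nat
  assumes "c > 0" "q \<ge> 1"
  shows "(\<integral>\<^sup>+t. ennreal ((1 + 2 * t * c) powr (- real q / 2)) * indicator {0..} t \<partial>lborel) =
     (if q > 2 then ennreal (1 / (c * (real q - 2))) else \<infinity>)"
proof (cases "q > 2")
  case True
  define F where "F t = - ((1 + 2 * t * c) powr (1 - real q / 2)) / (c * (real q - 2))" for t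
  have "(F \<longlongrightarrow> 0) at_top"
    unfolding F_def using assms True by real_asymp
  moreover have "DERIV F t :> (1 + 2 * t * c) powr (- real q / 2)" if "0 \<le> t" for t
  proof -
    have pos: "1 + 2 * t * c > 0" using that assms by (auto intro!: add_pos_nonneg)
    then have "DERIV F t :> - ((1 - real q / 2) * (1 + 2 * t * c) powr (1 - real q / 2 - 1) * (2 * c)) / (c * (real q - 2))"
      unfolding F_def using assms True
      by (auto intro!: derivative_eq_intros simp: divide_simps)
    moreover have "- ((1 - real q / 2) * z * (2 * c)) / (c * (real q - 2)) = z" for z
      using assms True by (simp add: field_simps)
    ultimately show ?thesis by simp
  qed
  ultimately have "(\<integral>\<^sup>+t. ennreal ((1 + 2 * t * c) powr (- real q / 2)) * indicator {0..} t \<partial>lborel) =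
     ennreal (0 - F 0)"
    by (intro nn_integral_FTC_atLeast) auto
  then show ?thesis using True by (simp add: F_def)
next
  case False
  have lower: "ennreal (ln (1 + 2 * real N * c) / (2 * c)) \<le>
     (\<integral>\<^sup>+t. ennreal ((1 + 2 * t * c) powr (- real q / 2)) * indicator {0..} t \<partial>lborel)" for N :: nat
  proof -
    have pos: "1 + 2 * t * c \<ge> 1" if "0 \<le> t" for t using that assms by auto
    have "(\<integral>\<^sup>+t. ennreal (1 / (1 + 2 * t * c)) * indicator {0..real N} t \<partial>lborel) =
        ennreal (ln (1 + 2 * real N * c) / (2 * c) - ln (1 + 2 * 0 * c) / (2 * c))"
    proof (rule nn_integral_FTC_Icc)
      fix t assume "t \<in> {0..real N}"
      then have "1 + 2 * t * c > 0" using pos[of t] by (simp add: less_le_trans[OF zero_less_one])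
      then show "DERIV (\<lambda>t. ln (1 + 2 * t * c) / (2 * c)) t :> 1 / (1 + 2 * t * c)"
        using assms by (auto intro!: derivative_eq_intros)
    qed (use assms in auto)
    moreover have "(\<integral>\<^sup>+t. ennreal (1 / (1 + 2 * t * c)) * indicator {0..real N} t \<partial>lborel) \<le>
       (\<integral>\<^sup>+t. ennreal ((1 + 2 * t * c) powr (- real q / 2)) * indicator {0..} t \<partial>lborel)"
    proof (intro nn_integral_mono)
      fix t :: real
      show "ennreal (1 / (1 + 2 * t * c)) * indicator {0..real N} t \<le>
            ennreal ((1 + 2 * t * c) powr (- real q / 2)) * indicator {0..} t"
      proof (cases "t \<in> {0..real N}")
        case True
        have "(1 + 2 * t * c) powr (- 1) \<le> (1 + 2 * t * c) powr (- real q / 2)"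
          using pos[of t] True False by (intro powr_mono) auto
        then show ?thesis using True pos[of t]
          by (auto simp: powr_minus_divide indicator_def intro!: ennreal_leI)
      qed auto
    qed
    ultimately show ?thesis by simp
  qed
  have "(\<lambda>N. ennreal (ln (1 + 2 * real N * c) / (2 * c))) \<longlonglongrightarrow> \<infinity>"
    unfolding infinity_ennreal_def ennreal_tendsto_top_eq_at_top using assms by real_asymp
  from LIMSEQ_le_const2[OF this] lower show ?thesis
    using False by (auto simp: top_unique)
qed

text \<open>\<open>U\<close> is completed by an orthonormal basis \<open>V\<close> of its orthogonal
  complement, and \<open>T\<close> maps the resulting basis to the standard one. Sums of squared
  projections onto \<open>U\<close> thus become sums over coordinates, where the Gaussian density is
  a product.\<close>

lemma orthonormal_set_isometry_Basis:
  fixes U :: "'a::euclidean_space set"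
  assumes orth: "pairwise orthogonal U" and nrm: "\<And>u. u \<in> U \<Longrightarrow> norm u = 1"
  obtains T :: "'a \<Rightarrow> 'a" and B where "linear T" "\<And>x. norm (T x) = norm x" "surj T"
    "B \<subseteq> Basis" "card B = card U" "\<And>x. (\<Sum>u\<in>U. (x \<bullet> u)\<^sup>2) = (\<Sum>b\<in>B. (T x \<bullet> b)\<^sup>2)"
proof -
  have U0: "0 \<notin> U" using nrm by force
  have indU: "independent U" using orth U0 by (rule pairwise_orthogonal_independent)
  define C where "C = {y \<in> UNIV. \<forall>x\<in>span U. orthogonal x y}"
  have "subspace C"
    unfolding C_def by (auto simp: subspace_def orthogonal_clauses)
  then obtain V where V: "V \<subseteq> C" "pairwise orthogonal V" "\<And>x. x \<in> V \<Longrightarrow> norm x = 1"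
      "independent V" "card V = dim C" "span V = C"
    by (metis orthonormal_basis_subspace)
  define S where "S = U \<union> V"
  have orthUV: "orthogonal u v" if "u \<in> U" "v \<in> V" for u v
    using that V(1) span_base by (auto simp: C_def)
  have S: "pairwise orthogonal S" "\<And>x. x \<in> S \<Longrightarrow> norm x = 1"
    using orth V(2,3) nrm orthUV by (auto simp: S_def pairwise_def) (metis orthogonal_commute)
  have "U \<inter> V = {}"
  proof (rule ccontr)
    assume "U \<inter> V \<noteq> {}"
    then obtain u where "u \<in> U" "u \<in> V" by auto
    then show False using orthUV[of u u] nrm[of u] by (auto simp: orthogonal_self)
  qed
  moreover have "dim C + dim (span U) = DIM('a)"
    using dim_subspace_orthogonal_to_vectors[of "span U" UNIV] by (simp add: C_def)
  ultimately have cardS: "card S = DIM('a)"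
    using indU V(4,5) by (simp add: S_def card_Un_disjoint independent_imp_finite dim_eq_card_independent)
  have finS: "finite S" using indU V(4) by (simp add: S_def independent_imp_finite)
  have "0 \<notin> S" using S(2) by force
  then have indS: "independent S" using S(1) by (simp add: pairwise_orthogonal_independent)
  have spanS: "span S = UNIV"
    using indS cardS by (metis card_eq_dim dim_UNIV top.extremum finS span_UNIV subset_UNIV top_le)
  obtain e where e: "bij_betw e (Basis :: 'a set) S"
    using finite_same_card_bij[OF finite_Basis finS] cardS by auto
  define T :: "'a \<Rightarrow> 'a" where "T x = (\<Sum>b\<in>Basis. (x \<bullet> e b) *\<^sub>R b)" for x
  have T_inner: "T x \<bullet> b = x \<bullet> e b" if "b \<in> Basis" for x b
    using that by (simp add: T_def inner_sum_left inner_Basis if_distrib sum.delta cong: if_cong)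
  have lin: "linear T"
    unfolding T_def by (intro linearI) (simp_all add: inner_add_left scaleR_add_left sum.distrib scaleR_sum_right)
  have norm_T: "norm (T x) = norm x" for x
  proof -
    have "x = (\<Sum>w\<in>S. (x \<bullet> w) *\<^sub>R w)"
      using orthonormal_basis_expand[OF S _ finS] spanS by simp
    then have "x \<bullet> x = x \<bullet> (\<Sum>w\<in>S. (x \<bullet> w) *\<^sub>R w)" by simp
    also have "\<dots> = (\<Sum>w\<in>S. (x \<bullet> w)\<^sup>2)"
      by (simp add: inner_sum_right power2_eq_square)
    also have "\<dots> = (\<Sum>b\<in>Basis. (x \<bullet> e b)\<^sup>2)"
      by (rule sum.reindex_bij_betw[OF e, symmetric])
    also have "\<dots> = T x \<bullet> T x"
      by (subst euclidean_inner) (simp add: T_inner power2_eq_square)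
    finally show ?thesis by (simp add: norm_eq_sqrt_inner)
  qed
  have "inj T"
    unfolding linear_injective_0[OF lin] using norm_T by (metis norm_eq_zero)
  then have "surj T" using lin by (simp add: linear_injective_imp_surjective)
  define B where "B = {b \<in> Basis. e b \<in> U}"
  have eB: "bij_betw e B U"
    using e by (auto simp: bij_betw_def inj_on_def B_def S_def image_iff)
  have sum: "(\<Sum>u\<in>U. (x \<bullet> u)\<^sup>2) = (\<Sum>b\<in>B. (T x \<bullet> b)\<^sup>2)" for x
    using sum.reindex_bij_betw[OF eB, of "\<lambda>u. (x \<bullet> u)\<^sup>2"] by (simp add: T_inner B_def)
  show ?thesis
    by (rule that[OF lin norm_T \<open>surj T\<close> _ _ sum]) (use eB in \<open>auto simp: B_def dest: bij_betw_same_card\<close>)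
qed

text \<open>An inverse chi-square mean: \<open>1/s\<close> is the integral of \<open>exp (-ts)\<close> over \<open>t \<ge> 0\<close>,
  and the mean of the exponential factorises over the coordinates.\<close>
lemma nn_integral_gauss_inverse_sum_squares:
  fixes U :: "'a::euclidean_space set"
  assumes \<sigma>: "\<sigma> > 0" and orth: "pairwise orthogonal U" and nrm: "\<And>u. u \<in> U \<Longrightarrow> norm u = 1"
    and ne: "U \<noteq> {}"
  shows "(\<integral>\<^sup>+x. ennreal (1 / (\<Sum>u\<in>U. (x \<bullet> u)\<^sup>2)) \<partial>gauss \<sigma>) =
     (if card U > 2 then ennreal (1 / (\<sigma>\<^sup>2 * (real (card U) - 2))) else \<infinity>)"
proof -
  interpret prob_space "gauss \<sigma> :: 'a measure" by (rule prob_space_gauss) fact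
  interpret P: pair_sigma_finite "lborel :: real measure" "gauss \<sigma> :: 'a measure" ..
  have "0 \<notin> U" using nrm by force
  then have "finite U" using orth by (simp add: pairwise_orthogonal_independent independent_imp_finite)
  with ne have q: "card U \<ge> 1" by (simp add: Suc_leI card_gt_0_iff)
  obtain T :: "'a \<Rightarrow> 'a" and B where T: "linear T" "\<And>x. norm (T x) = norm x" "surj T"
    and B: "B \<subseteq> Basis" "card B = card U" "\<And>x. (\<Sum>u\<in>U. (x \<bullet> u)\<^sup>2) = (\<Sum>b\<in>B. (T x \<bullet> b)\<^sup>2)"
    using orthonormal_set_isometry_Basis[OF orth nrm] by metis
  have finB: "finite B" using B(1) by (rule finite_subset) simp
  obtain b0 where b0: "b0 \<in> B" using B(2) q by (cases "B = {}") auto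
  have "(\<integral>\<^sup>+x. ennreal (1 / (\<Sum>u\<in>U. (x \<bullet> u)\<^sup>2)) \<partial>gauss \<sigma>) =
     (\<integral>\<^sup>+x. ennreal (1 / (\<Sum>b\<in>B. (x \<bullet> b)\<^sup>2)) \<partial>gauss \<sigma>)"
    unfolding B(3) by (rule nn_integral_gauss_isometry[OF T]) auto
  also have "\<dots> = (\<integral>\<^sup>+x. \<integral>\<^sup>+t. ennreal (exp (- t * (\<Sum>b\<in>B. (x \<bullet> b)\<^sup>2))) * indicator {0..} t \<partial>lborel \<partial>gauss \<sigma>)"
  proof (rule nn_integral_cong_AE)
    \<comment> \<open>Where the sum of squares is zero the two sides differ: 1 / 0 is 0, while the
      integral of the constant 1 is infinite. One nonzero coordinate excludes this almost
      surely.\<close>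
    have "AE x in gauss \<sigma>. x \<bullet> b0 \<noteq> 0"
      using b0 B(1) by (intro AE_gauss_lborel AE_lborel_inner_neq) auto
    then show "AE x in gauss \<sigma>. ennreal (1 / (\<Sum>b\<in>B. (x \<bullet> b)\<^sup>2)) =
        (\<integral>\<^sup>+t. ennreal (exp (- t * (\<Sum>b\<in>B. (x \<bullet> b)\<^sup>2))) * indicator {0..} t \<partial>lborel)"
    proof eventually_elim
      case (elim x)
      have "0 < (\<Sum>b\<in>B. (x \<bullet> b)\<^sup>2)"
        using elim b0 finB by (intro sum_pos2[of _ b0]) auto
      then show ?case by (rule nn_integral_exp_Ici[symmetric])
    qed
  qed
  also have "\<dots> = (\<integral>\<^sup>+t. \<integral>\<^sup>+x. ennreal (exp (- t * (\<Sum>b\<in>B. (x \<bullet> b)\<^sup>2))) * indicator {0..} t \<partial>gauss \<sigma> \<partial>lborel)"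
    by (rule P.Fubini') simp
  also have "\<dots> = (\<integral>\<^sup>+t. ennreal ((1 + 2 * t * \<sigma>\<^sup>2) powr (- real (card U) / 2)) * indicator {0..} t \<partial>lborel)"
  proof (rule nn_integral_cong)
    fix t :: real
    show "(\<integral>\<^sup>+x. ennreal (exp (- t * (\<Sum>b\<in>B. (x \<bullet> b)\<^sup>2))) * indicator {0..} t \<partial>gauss \<sigma>) =
        ennreal ((1 + 2 * t * \<sigma>\<^sup>2) powr (- real (card U) / 2)) * indicator {0..} t"
    proof (cases "t \<ge> 0")
      case True
      have pos: "1 + 2 * t * \<sigma>\<^sup>2 > 0" using True by (auto intro!: add_pos_nonneg)
      have "ennreal (exp (- t * (\<Sum>b\<in>B. (x \<bullet> b)\<^sup>2))) =
         (\<Prod>b\<in>Basis. if b \<in> B then ennreal (exp (- t * (x \<bullet> b)\<^sup>2)) else 1)" for x :: 'a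
        using B(1) finB
        by (simp add: sum_distrib_left exp_sum prod_ennreal prod.If_cases Int_absorb1 flip: sum_negf)
      then have "(\<integral>\<^sup>+x. ennreal (exp (- t * (\<Sum>b\<in>B. (x \<bullet> b)\<^sup>2))) \<partial>gauss \<sigma>) =
         (\<integral>\<^sup>+x. (\<Prod>b\<in>Basis. (\<lambda>b s. if b \<in> B then ennreal (exp (- t * s\<^sup>2)) else 1) b (x \<bullet> b)) \<partial>gauss \<sigma>)"
        by simp
      also have "\<dots> = (\<Prod>b\<in>(Basis::'a set). \<integral>\<^sup>+s. ennreal (normal_density 0 \<sigma> s) *
          (if b \<in> B then ennreal (exp (- t * s\<^sup>2)) else 1) \<partial>lborel)"
        by (rule nn_integral_gauss_prod) auto
      also have "\<dots> = (\<Prod>b\<in>(Basis::'a set). if b \<in> B then ennreal ((1 + 2 * t * \<sigma>\<^sup>2) powr (- 1/2)) else 1)"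
        using nn_integral_normal_exp_square[OF \<sigma> True] \<sigma>
        by (intro prod.cong) (auto simp: nn_integral_normal_density)
      also have "\<dots> = ennreal ((1 + 2 * t * \<sigma>\<^sup>2) powr (- 1/2)) ^ card U"
        using B(1,2) by (simp add: prod.If_cases Int_absorb1)
      also have "\<dots> = ennreal ((1 + 2 * t * \<sigma>\<^sup>2) powr (- real (card U) / 2))"
        using pos by (simp add: ennreal_power powr_powr mult.commute flip: powr_realpow)
      finally show ?thesis using True by simp
    qed simp
  qed
  also have "\<dots> = (if card U > 2 then ennreal (1 / (\<sigma>\<^sup>2 * (real (card U) - 2))) else \<infinity>)"
    using \<sigma> q by (intro nn_integral_powr_Ici) auto
  finally show ?thesis .
qed

subsection \<open>Gram matrices of Gaussian matrices\<close>

lemma borel_measurable_vec_nth [measurable (raw)]: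
  fixes f :: "'a \<Rightarrow> ('b::euclidean_space)^'n"
  assumes "f \<in> borel_measurable M"
  shows "(\<lambda>x. f x $ i) \<in> borel_measurable M"
  using assms by (rule measurable_compose) (intro borel_measurable_continuous_onI continuous_on_component continuous_on_id)

lemma borel_measurable_vecI:
  fixes f :: "'a \<Rightarrow> ('b::euclidean_space)^'n"
  assumes "\<And>i. (\<lambda>x. f x $ i) \<in> borel_measurable M"
  shows "f \<in> borel_measurable M"
proof (rule borel_measurable_euclidean_space[THEN iffD2], rule ballI)
  fix b :: "'b^'n" assume "b \<in> Basis"
  then obtain i u where "b = axis i u" by (auto simp: Basis_vec_def)
  then show "(\<lambda>x. f x \<bullet> b) \<in> borel_measurable M"
    using borel_measurable_inner[OF assms[of i] borel_measurable_const[of u]] by (simp only: inner_axis)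
qed

lemma borel_measurable_vec_lambda:
  fixes f :: "'a \<Rightarrow> 'n::finite \<Rightarrow> 'b::euclidean_space"
  assumes "\<And>i. (\<lambda>x. f x i) \<in> borel_measurable M"
  shows "(\<lambda>x. \<chi> i. f x i) \<in> borel_measurable M"
  by (rule borel_measurable_vecI) (simp only: vec_lambda_beta, rule assms)

lemma borel_measurable_transpose [measurable (raw)]:
  fixes f :: "'a \<Rightarrow> real^'n^'m"
  assumes [measurable]: "f \<in> borel_measurable M"
  shows "(\<lambda>x. transpose (f x)) \<in> borel_measurable M"
  unfolding transpose_def by (intro borel_measurable_vec_lambda borel_measurable_vec_nth assms)

lemma borel_measurable_matrix_mult [measurable (raw)]:
  fixes f :: "'a \<Rightarrow> real^'n^'m" and g :: "'a \<Rightarrow> real^'k^'n"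
  assumes [measurable]: "f \<in> borel_measurable M" "g \<in> borel_measurable M"
  shows "(\<lambda>x. f x ** g x) \<in> borel_measurable M"
  unfolding matrix_matrix_mult_def
  by (intro borel_measurable_vec_lambda borel_measurable_sum borel_measurable_times borel_measurable_vec_nth assms)

lemma borel_measurable_matrix_vector_mult [measurable (raw)]:
  fixes f :: "'a \<Rightarrow> real^'n^'m" and g :: "'a \<Rightarrow> real^'n"
  assumes [measurable]: "f \<in> borel_measurable M" "g \<in> borel_measurable M"
  shows "(\<lambda>x. f x *v g x) \<in> borel_measurable M"
  unfolding matrix_vector_mult_def
  by (intro borel_measurable_vec_lambda borel_measurable_sum borel_measurable_times borel_measurable_vec_nth assms)

lemma borel_measurable_det [measurable (raw)]:
  fixes f :: "'a \<Rightarrow> real^'n^'n"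
  assumes [measurable]: "f \<in> borel_measurable M"
  shows "(\<lambda>x. det (f x)) \<in> borel_measurable M"
  unfolding det_def
  by (intro borel_measurable_sum borel_measurable_times borel_measurable_prod borel_measurable_const
      borel_measurable_vec_nth assms)

text \<open>The inverse given by Cramer's rule: unlike \<^const>\<open>matrix_inv\<close> it is visibly measurable.\<close>
definition minv :: "real^'m^'m \<Rightarrow> real^'m^'m" where
  "minv A = (\<chi> k l. det (\<chi> i j. if j = k then axis l 1 $ i else A $ i $ j) / det A)"

lemma borel_measurable_minv [measurable (raw)]:
  fixes f :: "'a \<Rightarrow> real^'n^'n"
  assumes [measurable]: "f \<in> borel_measurable M"
  shows "(\<lambda>x. minv (f x)) \<in> borel_measurable M"
  unfolding minv_def
proof (intro borel_measurable_vec_lambda borel_measurable_divide borel_measurable_det assms)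
  fix k l i j
  show "(\<lambda>x. if j = k then axis l 1 $ i else f x $ i $ j) \<in> borel_measurable M"
    by (cases "j = k") auto
qed

lemma matrix_mul_minv:
  assumes "det A \<noteq> 0"
  shows "A ** minv A = mat 1"
proof -
  have "(A ** minv A) $ i $ l = mat 1 $ i $ l" for i l
  proof -
    have "A *v (\<chi> k. minv A $ k $ l) = axis l 1"
      unfolding cramer[OF assms] by (simp add: minv_def vec_eq_iff)
    then have "(A *v (\<chi> k. minv A $ k $ l)) $ i = axis l 1 $ i" by simp
    then show ?thesis
      by (simp add: matrix_vector_mult_def matrix_matrix_mult_def mat_def axis_def)
  qed
  then show ?thesis by (simp add: vec_eq_iff)
qed

lemma minv_matrix_mul:
  assumes "det A \<noteq> 0"
  shows "minv A ** A = mat 1"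
  using matrix_mul_minv[OF assms] by (rule matrix_left_right_inverse1)

lemma minv_unique:
  assumes "A ** B = mat 1"
  shows "minv A = B"
proof -
  have "det A \<noteq> 0" using assms by (metis det_I det_mul mult_zero_left zero_neq_one)
  then have "minv A = minv A ** (A ** B)" by (simp add: assms)
  also have "\<dots> = B" using minv_matrix_mul[OF \<open>det A \<noteq> 0\<close>] by (simp add: matrix_mul_assoc)
  finally show ?thesis .
qed

lemma transpose_minv:
  assumes "det A \<noteq> 0"
  shows "transpose (minv A) = minv (transpose A)"
  using minv_matrix_mul[OF assms]
  by (intro minv_unique[symmetric]) (simp add: transpose_mat flip: matrix_transpose_mul)

section \<open>Resampling one row of a Gaussian matrix\<close>

definition upd_row :: "'m::finite \<Rightarrow> 'a \<Rightarrow> 'a^'m \<Rightarrow> 'a^'m" where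
  "upd_row i x B = (\<chi> j. if j = i then x else B $ j)"

lemma upd_row_nth [simp]: "upd_row i x B $ j = (if j = i then x else B $ j)"
  by (simp add: upd_row_def)

lemma borel_measurable_upd_row [measurable (raw)]:
  fixes f :: "'a \<Rightarrow> 'b::euclidean_space"
  assumes [measurable]: "f \<in> borel_measurable M" "g \<in> borel_measurable M"
  shows "(\<lambda>x. upd_row i (f x) (g x)) \<in> borel_measurable M"
  unfolding upd_row_def
proof (rule borel_measurable_vec_lambda)
  fix j show "(\<lambda>x. if j = i then f x else g x $ j) \<in> borel_measurable M"
    by (cases "j = i") auto
qed

text \<open>Exchanging the new row with the old one is an isometry.\<close>
lemma nn_integral_gauss_upd_row:
  fixes f :: "('a::euclidean_space)^'m \<Rightarrow> ennreal"
  assumes \<sigma>: "\<sigma> > 0" and [measurable]: "f \<in> borel_measurable borel"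
  shows "(\<integral>\<^sup>+B. f B \<partial>gauss \<sigma>) = (\<integral>\<^sup>+B. \<integral>\<^sup>+x. f (upd_row i x B) \<partial>gauss \<sigma> \<partial>gauss \<sigma>)"
proof -
  interpret A: prob_space "gauss \<sigma> :: 'a measure" by (rule prob_space_gauss) fact
  interpret B: prob_space "gauss \<sigma> :: ('a^'m) measure" by (rule prob_space_gauss) fact
  interpret P: pair_sigma_finite "gauss \<sigma> :: 'a measure" "gauss \<sigma> :: ('a^'m) measure" ..
  define T :: "'a \<times> ('a^'m) \<Rightarrow> 'a \<times> ('a^'m)" where "T z = (snd z $ i, upd_row i (fst z) (snd z))" for z
  have lin: "linear T"
    by (intro linearI) (auto simp: T_def vec_eq_iff)
  have nrm: "norm (T z) = norm z" for z
  proof -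
    have *: "(norm B)\<^sup>2 = (norm (B $ i))\<^sup>2 + (\<Sum>j\<in>UNIV - {i}. (norm (B $ j))\<^sup>2)" for B :: "'a^'m"
      by (simp add: norm_vec_def L2_set_def sum_nonneg sum.remove[of UNIV i])
    have "(norm (T z))\<^sup>2 = (norm z)\<^sup>2"
      unfolding T_def by (cases z) (simp add: norm_Pair * add.left_commute)
    then show ?thesis by (simp add: power2_eq_iff_nonneg)
  qed
  have "T (T z) = z" for z
    by (cases z) (auto simp: T_def vec_eq_iff)
  then have surj: "surj T" by (metis surjI)
  have "(\<integral>\<^sup>+B. f B \<partial>gauss \<sigma>) = (\<integral>\<^sup>+z. f (snd z) \<partial>(gauss \<sigma> :: ('a \<times> ('a^'m)) measure))"
    unfolding gauss_pair[OF \<sigma>]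
    by (subst B.nn_integral_fst[symmetric]) (auto simp: A.emeasure_space_1[simplified])
  also have "\<dots> = (\<integral>\<^sup>+z. f (snd (T z)) \<partial>gauss \<sigma>)"
    by (rule nn_integral_gauss_isometry[OF lin nrm surj, symmetric], rule measurable_compose[OF _ assms(2)])
       (intro borel_measurable_continuous_onI continuous_intros)
  also have "\<dots> = (\<integral>\<^sup>+B. \<integral>\<^sup>+x. f (upd_row i x B) \<partial>gauss \<sigma> \<partial>gauss \<sigma>)"
    unfolding gauss_pair[OF \<sigma>] by (subst P.nn_integral_snd[symmetric]) (auto simp: T_def)
  finally show ?thesis .
qed

text \<open>The resampling formula applied to the indicator of the exceptional set. It keeps the
  Gram matrix invertible after one row has been replaced by a fresh one.\<close>

lemma AE_gauss_upd_row:
  fixes P :: "('a::euclidean_space)^'m \<Rightarrow> bool"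
  assumes \<sigma>: "\<sigma> > 0" and [measurable]: "Measurable.pred borel P" and AE: "AE B in gauss \<sigma>. P B"
  shows "AE B in gauss \<sigma>. AE x in gauss \<sigma>. P (upd_row i x B)"
proof -
  interpret A: prob_space "gauss \<sigma> :: 'a measure" by (rule prob_space_gauss) fact
  let ?f = "\<lambda>B. indicator {B. \<not> P B} B :: ennreal"
  have "(\<integral>\<^sup>+B. ?f B \<partial>gauss \<sigma>) = 0"
    using AE by (subst nn_integral_0_iff_AE) (auto simp: indicator_def)
  then have "(\<integral>\<^sup>+B. \<integral>\<^sup>+x. ?f (upd_row i x B) \<partial>gauss \<sigma> \<partial>gauss \<sigma>) = 0"
    by (subst nn_integral_gauss_upd_row[OF \<sigma>, symmetric]) auto
  then have "AE B in gauss \<sigma>. (\<integral>\<^sup>+x. ?f (upd_row i x B) \<partial>gauss \<sigma>) = 0"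
    by (subst (asm) nn_integral_0_iff_AE) auto
  then show ?thesis
    by eventually_elim (subst (asm) nn_integral_0_iff_AE, auto simp: indicator_def)
qed

lemma mat_mult_eq_scaleR: "mat c ** A = c *\<^sub>R (A :: real^'n^'m)"
  by (simp add: matrix_matrix_mult_def mat_def vec_eq_iff if_distrib[of "\<lambda>x. x * _"] cong: if_cong)

lemma poly_det:
  fixes A :: "real poly^'m^'m"
  shows "poly (det A) s = det (\<chi> i j. poly (A $ i $ j) s)"
  by (simp add: det_def poly_sum poly_prod)

text \<open>Along every line in the direction of a fixed matrix \<open>E\<close> with orthonormal rows,
  the Gram determinant is a nonzero polynomial, so it vanishes at finitely many points.\<close>
lemma AE_lborel_gram_det:
  assumes card: "CARD('m) \<le> CARD('p)"
  shows "AE B in (lborel :: (real^'p^'m) measure). det (B ** transpose B) \<noteq> 0"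
proof -
  obtain e :: "'m \<Rightarrow> 'p" where e: "inj e"
    using card_le_inj[of "UNIV :: 'm set" "UNIV :: 'p set"] card by auto
  define E :: "real^'p^'m" where "E = (\<chi> i. axis (e i) 1)"
  have EE: "E ** transpose E = mat 1"
    using e by (auto simp: E_def matrix_matrix_mult_def transpose_def mat_def axis_def vec_eq_iff inj_eq
        if_distrib[of "\<lambda>x. x * _"] cong: if_cong)
  define Z where "Z = {B :: real^'p^'m. det (B ** transpose B) = 0}"
  have [measurable]: "Z \<in> sets borel" unfolding Z_def by measurable
  have fin: "finite {t. t *\<^sub>R E + B \<in> Z}" for B
  proof -
    \<comment> \<open>For t \<noteq> 0 the matrix t E + B is t times E + s B with s = 1 / t. The
      Gram determinant is therefore studied as a polynomial in s: its value at s = 0 is det (E E^T)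
      = 1, so it is not the zero polynomial. Only t = 0 has to be added to the inverted
      roots.\<close>
    define p where "p = det (\<chi> i j. \<Sum>k\<in>UNIV. [:E $ i $ k, B $ i $ k:] * [:E $ j $ k, B $ j $ k:])"
    have p: "poly p s = det ((E + s *\<^sub>R B) ** transpose (E + s *\<^sub>R B))" for s
    proof -
      have "poly ([:a, b:] * [:c, d:]) s = (a + s * b) * (c + s * d)" for a b c d :: real
        by (simp add: algebra_simps)
      then show ?thesis
        unfolding p_def poly_det
        by (simp add: matrix_matrix_mult_def transpose_def poly_sum del: mult_pCons_left mult_pCons_right)
    qed
    have "poly p 0 = 1" by (simp add: p EE)
    then have "p \<noteq> 0" by auto
    then have "finite {s. poly p s = 0}" by (rule poly_roots_finite)
    moreover have "t = 0 \<or> inverse t \<in> {s. poly p s = 0}" if "t *\<^sub>R E + B \<in> Z" for t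
    proof (cases "t = 0")
      case False
      have "(t *\<^sub>R E + B) ** transpose (t *\<^sub>R E + B) =
         mat (t\<^sup>2) ** ((E + inverse t *\<^sub>R B) ** transpose (E + inverse t *\<^sub>R B))"
        using False unfolding mat_mult_eq_scaleR
        by (simp add: matrix_matrix_mult_def transpose_def vec_eq_iff sum_distrib_left)
           (auto intro!: sum.cong simp: field_simps power2_eq_square)
      moreover have "det (mat (t\<^sup>2) :: real^'m^'m) \<noteq> 0"
        using False by (subst det_diagonal) (auto simp: mat_def)
      ultimately show ?thesis
        using that by (simp add: Z_def det_mul p)
    qed simp
    then have "{t. t *\<^sub>R E + B \<in> Z} \<subseteq> {0} \<union> inverse ` {s. poly p s = 0}"
      by (force simp: image_iff intro: inverse_inverse_eq[symmetric])
    ultimately show ?thesis by (meson finite.emptyI finite.insertI finite_UnI finite_imageI finite_subset)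
  qed
  \<comment> \<open>The volume of \<open>Z\<close> is integrated over the whole real line, which has
    infinite mass. Translating by t E and exchanging the integrals gives 0, which forces the volume
    to be 0.\<close>
  have "(\<integral>\<^sup>+t. emeasure lborel Z \<partial>(lborel :: real measure)) =
     (\<integral>\<^sup>+t. \<integral>\<^sup>+B. indicator Z (t *\<^sub>R E + B) \<partial>lborel \<partial>lborel)"
    by (subst nn_integral_lborel_translate) auto
  also have "\<dots> = (\<integral>\<^sup>+B. \<integral>\<^sup>+t. indicator Z (t *\<^sub>R E + B) \<partial>lborel \<partial>lborel)"
    by (rule lborel_pair.Fubini') measurable
  also have "\<dots> = 0"
  proof -
    have "(\<integral>\<^sup>+t. indicator Z (t *\<^sub>R E + B) \<partial>lborel) = 0" for B
    proof -
      have "AE t in lborel. t \<notin> {t. t *\<^sub>R E + B \<in> Z}"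
        using fin[of B] by (intro AE_not_in finite_imp_null_set_lborel)
      then show ?thesis
        by (subst nn_integral_0_iff_AE) (auto simp: indicator_def)
    qed
    then show ?thesis by simp
  qed
  finally have "emeasure lborel Z = 0" by (simp add: ennreal_mult_eq_top_iff)
  then have "AE B in lborel. B \<notin> Z" by (intro AE_not_in) (auto simp: null_sets_def)
  then show ?thesis by (simp add: Z_def)
qed

text \<open>The diagonal entries of the inverse Gram matrix are the inverse squared distances of the
  rows to the span of the other rows.\<close>
lemma minv_gram_diag:
  fixes B :: "real^'p^'m"
  assumes det: "det (B ** transpose B) \<noteq> 0"
    and U: "finite U" "pairwise orthogonal U" "\<And>u. u \<in> U \<Longrightarrow> norm u = 1"
      "span U = {y. \<forall>j. j \<noteq> i \<longrightarrow> B $ j \<bullet> y = 0}"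
  shows "minv (B ** transpose B) $ i $ i = 1 / (\<Sum>u\<in>U. (B $ i \<bullet> u)\<^sup>2)"
proof -
  define N where "N = minv (B ** transpose B)"
  \<comment> \<open>The dual vector of row \<open>i\<close>: it is orthogonal to all other rows and
    has inner product 1 with row \<open>i\<close>. Hence it lies in the span of \<open>U\<close>,
    and its coordinates there are \<open>N $ i $ i\<close> times those of row
    \<open>i\<close>.\<close>
  define c where "c = (N ** B) $ i"
  have "N ** B ** transpose B = mat 1"
    using minv_matrix_mul[OF det] by (simp add: N_def matrix_mul_assoc)
  then have "(N ** B ** transpose B) $ i $ j = (if i = j then 1 else 0)" for j
    by (simp add: mat_def)
  then have cB: "c \<bullet> B $ j = (if i = j then 1 else 0)" for j
    by (simp add: c_def inner_vec_def matrix_matrix_mult_def transpose_def)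
  then have "c \<in> span U" by (auto simp: U(4) inner_commute)
  then have c: "c = (\<Sum>u\<in>U. (c \<bullet> u) *\<^sub>R u)"
    using orthonormal_basis_expand[OF U(2,3) _ U(1)] by simp
  have cu: "c \<bullet> u = N $ i $ i * (B $ i \<bullet> u)" if "u \<in> U" for u
  proof -
    have z: "B $ j \<bullet> u = 0" if "j \<noteq> i" for j
      using span_base[OF \<open>u \<in> U\<close>] that by (simp add: U(4))
    have "c = (\<Sum>j\<in>UNIV. N $ i $ j *\<^sub>R B $ j)"
      by (simp add: c_def matrix_matrix_mult_def vec_eq_iff)
    then have "c \<bullet> u = (\<Sum>j\<in>UNIV. N $ i $ j * (B $ j \<bullet> u))"
      by (simp add: inner_sum_left)
    also have "\<dots> = (\<Sum>j\<in>{i}. N $ i $ j * (B $ j \<bullet> u))"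
      using z by (intro sum.mono_neutral_right) auto
    finally show ?thesis by simp
  qed
  have "1 = c \<bullet> B $ i" by (simp add: cB)
  also have "\<dots> = (\<Sum>u\<in>U. (c \<bullet> u) * (u \<bullet> B $ i))"
    by (subst c) (simp add: inner_sum_left)
  also have "\<dots> = N $ i $ i * (\<Sum>u\<in>U. (B $ i \<bullet> u)\<^sup>2)"
    unfolding sum_distrib_left
    by (intro sum.cong refl) (simp add: cu power2_eq_square inner_commute[of _ "B $ i"])
  finally show ?thesis unfolding N_def[symmetric] by (metis nonzero_eq_divide_eq mult_zero_right zero_neq_one)
qed

text \<open>The span of the other rows is the image of the hyperplane of coefficient vectors
  vanishing at \<open>i\<close>. Combining rows is injective because the Gram matrix is invertible,
  so this span has dimension CARD('m) - 1.\<close>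

lemma dim_orthogonal_other_rows:
  fixes B :: "real^'p^'m"
  assumes det: "det (B ** transpose B) \<noteq> 0"
  shows "dim {y. \<forall>j. j \<noteq> i \<longrightarrow> B $ j \<bullet> y = 0} + CARD('m) = CARD('p) + 1"
proof -
  let ?H = "{c :: real^'m. axis i 1 \<bullet> c = 0}"
  let ?A = "(\<lambda>c. c v* B) ` ?H"
  have lin: "linear (\<lambda>c. c v* B)"
    using matrix_vector_mul_linear[of "transpose B"] by simp
  have "inj (\<lambda>c. c v* B)"
  proof (subst linear_injective_0[OF lin], safe)
    fix c assume "c v* B = 0"
    then have "(B ** transpose B) *v c = 0"
      by (simp add: matrix_vector_mul_assoc[symmetric])
    then have "minv (B ** transpose B) *v ((B ** transpose B) *v c) = 0" by simp
    then show "c = 0"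
      by (simp add: matrix_vector_mul_assoc minv_matrix_mul[OF det] del: transpose_matrix_vector)
  qed
  then have dimA: "dim ?A = CARD('m) - 1"
    using lin dim_hyperplane[of "axis i 1 :: real^'m"]
    by (subst dim_image_eq) (auto simp: inj_on_def axis_eq_0_iff)
  have "{y. \<forall>j. j \<noteq> i \<longrightarrow> B $ j \<bullet> y = 0} = {y \<in> UNIV. \<forall>x\<in>?A. orthogonal x y}"
  proof -
    have "(\<forall>c. c $ i = 0 \<longrightarrow> c \<bullet> (B *v y) = 0) \<longleftrightarrow> (\<forall>j. j \<noteq> i \<longrightarrow> B $ j \<bullet> y = 0)" for y
    proof safe
      fix j assume "\<forall>c. c $ i = 0 \<longrightarrow> c \<bullet> (B *v y) = 0" "j \<noteq> i"
      then have "axis j 1 \<bullet> (B *v y) = 0" by (simp add: axis_def)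
      then show "B $ j \<bullet> y = 0" by (simp add: inner_axis' matrix_vector_mul_component)
    next
      fix c :: "real^'m" assume "\<forall>j. j \<noteq> i \<longrightarrow> B $ j \<bullet> y = 0" "c $ i = 0"
      then have "c $ j * (B $ j \<bullet> y) = 0" for j by (cases "j = i") auto
      then show "c \<bullet> (B *v y) = 0"
        unfolding inner_vec_def[of c] by (intro sum.neutral) (simp add: matrix_vector_mul_component)
    qed
    then show ?thesis by (auto simp: orthogonal_def dot_lmul_matrix inner_axis')
  qed
  moreover have "subspace ?A"
    using lin by (intro linear_subspace_image subspace_hyperplane)
  ultimately have "dim {y. \<forall>j. j \<noteq> i \<longrightarrow> B $ j \<bullet> y = 0} + dim ?A = CARD('p)"
    using dim_subspace_orthogonal_to_vectors[of ?A UNIV] by simp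
  then show ?thesis
    unfolding dimA using zero_less_card_finite[where 'a='m] by linarith
qed

text \<open>Given the other rows, the resampled row \<open>i\<close> is a fresh Gaussian vector, and
  the entry is the inverse of its squared projection onto a space of dimension CARD('p) - CARD('m) +
  1. The inner integral is the same for almost every choice of the other rows, so the outer one is
  trivial.\<close>

lemma nn_integral_gauss_minv_gram_diag:
  assumes \<sigma>: "\<sigma> > 0" and card: "CARD('m) \<le> CARD('p)"
  shows "(\<integral>\<^sup>+B. ennreal (minv (B ** transpose B) $ i $ i) \<partial>(gauss \<sigma> :: (real^'p^'m) measure)) =
    (if CARD('p) > CARD('m) + 1 then ennreal (1 / (\<sigma>\<^sup>2 * (real CARD('p) - real CARD('m) - 1))) else \<infinity>)"
    (is "_ = ?r")
proof -
  interpret prob_space "gauss \<sigma> :: (real^'p^'m) measure" by (rule prob_space_gauss) fact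
  let ?P = "\<lambda>B :: real^'p^'m. det (B ** transpose B) \<noteq> 0"
  have AE: "AE B in gauss \<sigma>. ?P B"
    using card by (intro AE_gauss_lborel AE_lborel_gram_det)
  have "AE B in gauss \<sigma>. AE x in gauss \<sigma>. ?P (upd_row i x B)"
    by (rule AE_gauss_upd_row[OF \<sigma> _ AE]) measurable
  with AE have *: "AE B in (gauss \<sigma> :: (real^'p^'m) measure).
     (\<integral>\<^sup>+x. ennreal (minv (upd_row i x B ** transpose (upd_row i x B)) $ i $ i) \<partial>gauss \<sigma>) = ?r"
  proof eventually_elim
    case (elim B)
    let ?V = "{y. \<forall>j. j \<noteq> i \<longrightarrow> B $ j \<bullet> y = 0}"
    have "subspace ?V" by (auto simp: subspace_def inner_add_right)
    then obtain U where U: "U \<subseteq> ?V" "pairwise orthogonal U" "\<And>x. x \<in> U \<Longrightarrow> norm x = 1"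
        "independent U" "card U = dim ?V" "span U = ?V"
      by (rule orthonormal_basis_subspace) blast
    have finU: "finite U" using U(4) by (rule independent_imp_finite)
    have cardU: "card U + CARD('m) = CARD('p) + 1"
      using dim_orthogonal_other_rows[OF elim(1), of i] U(5) by simp
    with card have ne: "U \<noteq> {}" by auto
    have "(\<integral>\<^sup>+x. ennreal (minv (upd_row i x B ** transpose (upd_row i x B)) $ i $ i) \<partial>gauss \<sigma>) =
       (\<integral>\<^sup>+x. ennreal (1 / (\<Sum>u\<in>U. (x \<bullet> u)\<^sup>2)) \<partial>gauss \<sigma>)"
      using elim(2)
    proof (intro nn_integral_cong_AE, eventually_elim)
      case (elim x)
      have "span U = {y. \<forall>j. j \<noteq> i \<longrightarrow> upd_row i x B $ j \<bullet> y = 0}" by (auto simp: U(6))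
      from minv_gram_diag[OF elim(2) finU U(2,3) this] show ?case by simp
    qed
    also have "\<dots> = (if card U > 2 then ennreal (1 / (\<sigma>\<^sup>2 * (real (card U) - 2))) else \<infinity>)"
      by (rule nn_integral_gauss_inverse_sum_squares[OF \<sigma> U(2,3) ne])
    also have "\<dots> = ?r"
    proof -
      have "real (card U) - 2 = real CARD('p) - real CARD('m) - 1" using cardU by linarith
      then show ?thesis using cardU by auto
    qed
    finally show ?case .
  qed
  have "(\<integral>\<^sup>+B. ennreal (minv (B ** transpose B) $ i $ i) \<partial>(gauss \<sigma> :: (real^'p^'m) measure)) =
    (\<integral>\<^sup>+B. \<integral>\<^sup>+x. ennreal (minv (upd_row i x B ** transpose (upd_row i x B)) $ i $ i) \<partial>gauss \<sigma> \<partial>(gauss \<sigma> :: (real^'p^'m) measure))"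
    by (rule nn_integral_gauss_upd_row[OF \<sigma>]) measurable
  also have "\<dots> = (\<integral>\<^sup>+B. ?r \<partial>(gauss \<sigma> :: (real^'p^'m) measure))"
    by (rule nn_integral_cong_AE[OF *])
  also have "\<dots> = ?r" by (simp add: emeasure_space_1[simplified])
  finally show ?thesis .
qed

subsection \<open>The least squares map\<close>

text \<open>Uniqueness of the Moore-Penrose inverse, which reduces the definite description to
  checking four equations.\<close>

lemma pinv_eqI:
  assumes B: "A ** B ** A = A" "B ** A ** B = B"
    "transpose (A ** B) = A ** B" "transpose (B ** A) = B ** A"
  shows "pinv A = B"
  unfolding pinv_def
proof (rule the_equality)
  fix C assume C: "A ** C ** A = A \<and> C ** A ** C = C \<and>
    transpose (A ** C) = A ** C \<and> transpose (C ** A) = C ** A"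
  have "A ** B = transpose ((A ** C ** A) ** B)" using B(3) C by simp
  also have "\<dots> = transpose (A ** B) ** transpose (A ** C)"
    by (simp only: matrix_transpose_mul[symmetric] matrix_mul_assoc)
  also have "\<dots> = A ** B ** A ** C" using B(3) C by (simp add: matrix_mul_assoc)
  also have "\<dots> = A ** C" using B(1) by simp
  finally have AB: "A ** B = A ** C" .
  have "B ** A = transpose (B ** (A ** C ** A))" using B(4) C by simp
  also have "\<dots> = transpose (C ** A) ** transpose (B ** A)"
    by (simp only: matrix_transpose_mul[symmetric] matrix_mul_assoc)
  also have "\<dots> = C ** (A ** B ** A)" using B(4) C by (simp add: matrix_mul_assoc)
  also have "\<dots> = C ** A" using B(1) by simp
  finally have BA: "B ** A = C ** A" .
  have "C = C ** (A ** C)" using C by (simp add: matrix_mul_assoc)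
  also have "\<dots> = C ** (A ** B)" by (simp only: AB)
  also have "\<dots> = (B ** A) ** B" by (simp only: BA matrix_mul_assoc)
  also have "\<dots> = B" using B(2) by simp
  finally show "C = B" .
qed (use assms in auto)

text \<open>Invertibility is asked of the smaller Gram matrix, the square case counting as tall. As
  a condition on a determinant the event is measurable.\<close>

definition full_rank :: "real^'d^'n \<Rightarrow> bool" where
  "full_rank A \<longleftrightarrow>
    (if CARD('d) \<le> CARD('n) then det (transpose A ** A) \<noteq> 0 else det (A ** transpose A) \<noteq> 0)"

text \<open>The closed form of the pseudoinverse of \<open>A\<close> at full rank. Being built from
  \<open>minv\<close> it is measurable on all matrices, including the null set where the formula has
  no meaning.\<close>

definition lsq_map :: "real^'d^'n \<Rightarrow> real^'n^'d" where
  "lsq_map A = (if CARD('d) \<le> CARD('n) then minv (transpose A ** A) ** transpose A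
    else transpose A ** minv (A ** transpose A))"

lemma borel_measurable_lsq_map [measurable (raw)]:
  fixes f :: "'a \<Rightarrow> real^'d^'n"
  assumes [measurable]: "f \<in> borel_measurable M"
  shows "(\<lambda>x. lsq_map (f x)) \<in> borel_measurable M"
  unfolding lsq_map_def by (cases "CARD('d) \<le> CARD('n)") simp_all

lemma transpose_minv_gram:
  fixes A :: "real^'d^'n"
  assumes "det (A ** transpose A) \<noteq> 0"
  shows "transpose (minv (A ** transpose A)) = minv (A ** transpose A)"
  by (simp add: transpose_minv[OF assms] matrix_transpose_mul)

lemma transpose_minv_gram':
  fixes A :: "real^'d^'n"
  assumes "det (transpose A ** A) \<noteq> 0"
  shows "transpose (minv (transpose A ** A)) = minv (transpose A ** A)"
  by (simp add: transpose_minv[OF assms] matrix_transpose_mul)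

text \<open>For a wide matrix \<open>transpose A ** A\<close> is singular. Its pseudoinverse is
  \<open>transpose A ** N ** N ** A\<close> with \<open>N\<close> the inverse of the other Gram
  matrix, and the subsequent factor \<open>transpose A\<close> cancels one \<open>N\<close>.\<close>

lemma lsq_eq_lsq_map:
  fixes A :: "real^'d^'n"
  assumes "full_rank A"
  shows "lsq A Y = lsq_map A ** Y"
proof (cases "CARD('d) \<le> CARD('n)")
  case True
  then have det: "det (transpose A ** A) \<noteq> 0" using assms by (simp add: full_rank_def)
  have "pinv (transpose A ** A) = minv (transpose A ** A)"
    by (rule pinv_eqI) (simp_all add: matrix_mul_minv[OF det] minv_matrix_mul[OF det] transpose_mat)
  then show ?thesis using True by (simp add: lsq_def lsq_map_def)
next
  case False
  then have det: "det (A ** transpose A) \<noteq> 0" using assms by (simp add: full_rank_def)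
  define N where "N = minv (A ** transpose A)"
  have N: "N ** A ** transpose A = mat 1" "A ** transpose A ** N = mat 1" "transpose N = N"
    using matrix_mul_minv[OF det] minv_matrix_mul[OF det] transpose_minv_gram[OF det]
    by (simp_all add: N_def matrix_mul_assoc)
  \<comment> \<open>The free left factor lets the cancellation fire inside left-associated
    products.\<close>
  have N1: "Z ** N ** A ** transpose A = Z" for Z :: "real^'n^'x"
    using N(1) by (metis matrix_mul_assoc matrix_mul_rid)
  have N2: "Z ** A ** transpose A ** N = Z" for Z :: "real^'n^'x"
    using N(2) by (metis matrix_mul_assoc matrix_mul_rid)
  have "pinv (transpose A ** A) = transpose A ** N ** N ** A"
    by (rule pinv_eqI) (simp_all add: matrix_mul_assoc N1 N2 N(3) matrix_transpose_mul)
  then show ?thesis using False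
    by (simp add: lsq_def lsq_map_def matrix_mul_assoc N1 N_def[symmetric])
qed

lemma lsq_map_tall:
  fixes A :: "real^'d^'n"
  assumes "full_rank A" "CARD('d) \<le> CARD('n)"
  shows "lsq_map A ** A = mat 1" "lsq_map A ** transpose (lsq_map A) = minv (transpose A ** A)"
proof -
  have det: "det (transpose A ** A) \<noteq> 0" using assms by (simp add: full_rank_def)
  show "lsq_map A ** A = mat 1"
    using assms minv_matrix_mul[OF det] by (simp add: lsq_map_def matrix_mul_assoc)
  have "lsq_map A ** transpose (lsq_map A) =
     minv (transpose A ** A) ** (transpose A ** A) ** minv (transpose A ** A)"
    using assms by (simp add: lsq_map_def matrix_transpose_mul transpose_minv_gram'[OF det] matrix_mul_assoc)
  then show "lsq_map A ** transpose (lsq_map A) = minv (transpose A ** A)"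
    by (simp add: minv_matrix_mul[OF det])
qed

lemma lsq_map_wide:
  fixes A :: "real^'d^'n"
  assumes "full_rank A" "CARD('n) < CARD('d)"
  shows "A ** lsq_map A = mat 1" "transpose (lsq_map A) ** lsq_map A = minv (A ** transpose A)"
    "transpose (lsq_map A ** A) = lsq_map A ** A"
proof -
  have det: "det (A ** transpose A) \<noteq> 0" using assms by (simp add: full_rank_def)
  show "A ** lsq_map A = mat 1"
    using assms matrix_mul_minv[OF det] by (simp add: lsq_map_def matrix_mul_assoc)
  have "transpose (lsq_map A) ** lsq_map A =
     minv (A ** transpose A) ** (A ** transpose A) ** minv (A ** transpose A)"
    using assms by (simp add: lsq_map_def matrix_transpose_mul transpose_minv_gram[OF det] matrix_mul_assoc)
  then show "transpose (lsq_map A) ** lsq_map A = minv (A ** transpose A)"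
    by (simp add: minv_matrix_mul[OF det])
  show "transpose (lsq_map A ** A) = lsq_map A ** A"
    using assms by (simp add: lsq_map_def matrix_transpose_mul transpose_minv_gram[OF det] matrix_mul_assoc)
qed

lemma norm_matrix_power2: "(norm (A :: real^'d^'n))\<^sup>2 = (\<Sum>i\<in>UNIV. \<Sum>j\<in>UNIV. (A $ i $ j)\<^sup>2)"
  by (simp add: norm_vec_def L2_set_def sum_nonneg)

lemma transpose_isometry:
  shows "linear (transpose :: real^'d^'n \<Rightarrow> real^'n^'d)"
    and "norm (transpose A) = norm (A :: real^'d^'n)"
    and "surj (transpose :: real^'d^'n \<Rightarrow> real^'n^'d)"
proof -
  show "linear (transpose :: real^'d^'n \<Rightarrow> real^'n^'d)"
    by (intro linearI) (simp_all add: transpose_def vec_eq_iff)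
  have "(norm (transpose A))\<^sup>2 = (norm A)\<^sup>2"
    unfolding norm_matrix_power2 transpose_def by (simp add: sum.swap[of _ "UNIV :: 'd set"])
  then show "norm (transpose A) = norm A" by (simp add: power2_eq_iff_nonneg)
  show "surj (transpose :: real^'d^'n \<Rightarrow> real^'n^'d)"
    by (metis surjI transpose_transpose)
qed

lemma AE_gauss_full_rank: "AE A in (gauss \<sigma> :: (real^'d^'n) measure). full_rank A"
proof (cases "CARD('d) \<le> CARD('n)")
  case True
  have "AE B in distr (gauss \<sigma>) borel (transpose :: real^'d^'n \<Rightarrow> real^'n^'d). det (B ** transpose B) \<noteq> 0"
    unfolding distr_gauss_isometry[OF transpose_isometry]
    using AE_lborel_gram_det[OF True] by (rule AE_gauss_lborel)
  then have "AE A in (gauss \<sigma> :: (real^'d^'n) measure). det (transpose A ** transpose (transpose A)) \<noteq> 0"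
    by (subst (asm) AE_distr_iff) measurable
  then show ?thesis using True by (simp add: full_rank_def)
next
  case False
  then have "AE A in (gauss \<sigma> :: (real^'d^'n) measure). det (A ** transpose A) \<noteq> 0"
    by (intro AE_gauss_lborel AE_lborel_gram_det) simp
  then show ?thesis using False by (simp add: full_rank_def)
qed

section \<open>Rotation invariance and the mean size of the least squares map\<close>

lemma norm_orthogonal_matrix_mult:
  assumes "orthogonal_matrix Q"
  shows "norm (Q *v x) = norm (x :: real^'d)"
proof -
  have "(Q *v x) \<bullet> (Q *v x) = (transpose Q *v (Q *v x)) \<bullet> x"
    by (simp add: dot_lmul_matrix)
  also have "\<dots> = x \<bullet> x"
    using assms by (simp add: matrix_vector_mul_assoc orthogonal_matrix del: transpose_matrix_vector)
  finally show ?thesis by (simp add: norm_eq_sqrt_inner)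
qed

lemma rotate_rows_isometry:
  fixes Q :: "real^'d^'d"
  assumes "orthogonal_matrix Q"
  defines "T \<equiv> \<lambda>A :: real^'d^'n. A ** transpose Q"
  shows "linear T" "norm (T A) = norm A" "surj T"
proof -
  show "linear T"
    unfolding T_def
    by (intro linearI) (simp_all add: vec_eq_iff matrix_matrix_mult_def sum.distrib distrib_right
        sum_distrib_left mult.assoc)
  have row: "T A $ i = Q *v (A $ i)" for A i
    by (simp add: T_def vec_eq_iff matrix_matrix_mult_def matrix_vector_mult_def transpose_def mult.commute)
  show "norm (T A) = norm A"
    by (simp add: norm_vec_def[of "T A"] norm_vec_def[of A] row norm_orthogonal_matrix_mult[OF assms(1)])
  have "T (A ** Q) = A" for A
    using assms(1) unfolding T_def by (simp add: orthogonal_matrix_def flip: matrix_mul_assoc)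
  then show "surj T" by (rule surjI)
qed

text \<open>Replacing \<open>A\<close> by \<open>A ** transpose Q\<close> conjugates
  \<open>transpose A ** A\<close> by \<open>Q\<close> and leaves \<open>A ** transpose A\<close> as
  it is; the inverses follow suit.\<close>

lemma lsq_map_rotate:
  fixes A :: "real^'d^'n"
  assumes Q: "orthogonal_matrix Q" and "full_rank A"
  shows "lsq_map (A ** transpose Q) = Q ** lsq_map A"
proof (cases "CARD('d) \<le> CARD('n)")
  case True
  then have det: "det (transpose A ** A) \<noteq> 0" using assms by (simp add: full_rank_def)
  have QQ: "transpose Q ** Q = mat 1" "Q ** transpose Q = mat 1"
    using Q by (simp_all add: orthogonal_matrix_def)
  have Q1: "Z ** transpose Q ** Q = Z" for Z :: "real^'d^'x"
    using QQ by (metis matrix_mul_assoc matrix_mul_rid)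
  define N where "N = minv (transpose A ** A)"
  have N1: "Z ** transpose A ** A ** N = Z" for Z :: "real^'d^'x"
    using matrix_mul_minv[OF det] unfolding N_def by (metis matrix_mul_assoc matrix_mul_rid)
  have "minv (Q ** transpose A ** A ** transpose Q) = Q ** N ** transpose Q"
    by (rule minv_unique) (simp add: matrix_mul_assoc Q1 N1 QQ)
  then show ?thesis
    using True by (simp add: lsq_map_def matrix_transpose_mul matrix_mul_assoc Q1 N_def[symmetric])
next
  case False
  have Q1: "Z ** transpose Q ** Q = Z" for Z :: "real^'d^'x"
    using Q by (metis matrix_mul_assoc matrix_mul_rid orthogonal_matrix_def)
  show ?thesis
    using False by (simp add: lsq_map_def matrix_transpose_mul matrix_mul_assoc Q1)
qed

lemma orthogonal_matrix_exists_axis: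
  fixes l :: "real^'d"
  obtains Q where "orthogonal_matrix Q" "transpose Q *v l = norm l *\<^sub>R axis r 1"
proof -
  have "norm l = norm (norm l *\<^sub>R axis r (1::real))" by simp
  then show thesis
  proof (rule orthogonal_transformation_exists)
    fix f :: "real^'d \<Rightarrow> real^'d"
    assume f: "orthogonal_transformation f" "f l = norm l *\<^sub>R axis r 1"
    then have "orthogonal_matrix (matrix f)" "linear f"
      by (simp_all add: orthogonal_transformation_matrix)
    with f(2) show thesis
      by (intro that[of "transpose (matrix f)"]) (simp_all add: matrix_works del: transpose_matrix_vector)
  qed
qed

text \<open>In other words, the mean of K K^T is a multiple of the identity: a rotation of the input
  space takes \<open>l\<close> to a multiple of any chosen axis, and the law of the design does not
  notice. As a nonnegative integral the statement also covers an infinite mean.\<close>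

lemma nn_integral_gauss_lsq_map_axis:
  fixes l :: "real^'d" and r :: 'd
  shows "(\<integral>\<^sup>+A. ennreal ((norm (transpose (lsq_map A) *v l))\<^sup>2) \<partial>(gauss \<sigma> :: (real^'d^'n) measure)) =
     ennreal ((norm l)\<^sup>2) *
     (\<integral>\<^sup>+A. ennreal ((norm (transpose (lsq_map A) *v axis r 1))\<^sup>2) \<partial>(gauss \<sigma> :: (real^'d^'n) measure))"
proof -
  obtain Q where Q: "orthogonal_matrix Q" "transpose Q *v l = norm l *\<^sub>R axis r 1"
    by (rule orthogonal_matrix_exists_axis)
  have "(\<integral>\<^sup>+A. ennreal ((norm (transpose (lsq_map A) *v l))\<^sup>2) \<partial>(gauss \<sigma> :: (real^'d^'n) measure)) =
    (\<integral>\<^sup>+A. ennreal ((norm (transpose (lsq_map (A ** transpose Q)) *v l))\<^sup>2) \<partial>(gauss \<sigma> :: (real^'d^'n) measure))"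
    by (rule nn_integral_gauss_isometry[OF rotate_rows_isometry[OF Q(1)], symmetric]) measurable
  also have "\<dots> = (\<integral>\<^sup>+A. ennreal ((norm l)\<^sup>2) *
      ennreal ((norm (transpose (lsq_map A) *v axis r 1))\<^sup>2) \<partial>(gauss \<sigma> :: (real^'d^'n) measure))"
  proof (rule nn_integral_cong_AE)
    show "AE A in (gauss \<sigma> :: (real^'d^'n) measure).
      ennreal ((norm (transpose (lsq_map (A ** transpose Q)) *v l))\<^sup>2) =
      ennreal ((norm l)\<^sup>2) * ennreal ((norm (transpose (lsq_map A) *v axis r 1))\<^sup>2)"
      using AE_gauss_full_rank
    proof eventually_elim
      case (elim A)
      have "transpose (lsq_map (A ** transpose Q)) *v l = transpose (lsq_map A) *v (transpose Q *v l)"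
        unfolding lsq_map_rotate[OF Q(1) elim]
        by (simp only: matrix_transpose_mul matrix_vector_mul_assoc)
      also have "\<dots> = norm l *\<^sub>R (transpose (lsq_map A) *v axis r 1)"
        unfolding Q(2) by (rule matrix_vector_mult_scaleR)
      finally show ?case
        by (simp add: power_mult_distrib ennreal_mult del: transpose_matrix_vector)
    qed
  qed
  also have "\<dots> = ennreal ((norm l)\<^sup>2) *
     (\<integral>\<^sup>+A. ennreal ((norm (transpose (lsq_map A) *v axis r 1))\<^sup>2) \<partial>(gauss \<sigma> :: (real^'d^'n) measure))"
    by (rule nn_integral_cmult) measurable
  finally show ?thesis .
qed

lemma norm_transpose_axis:
  "(norm (transpose K *v axis r 1))\<^sup>2 = (K ** transpose K) $ r $ r" for K :: "real^'n^'d"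
proof -
  have "transpose K *v axis r 1 = K $ r"
    by (simp add: vec_eq_iff matrix_vector_mult_def transpose_def axis_def if_distrib cong: if_cong)
  then show ?thesis
    by (simp add: power2_norm_eq_inner inner_vec_def matrix_matrix_mult_def transpose_def)
qed

text \<open>If \<open>A\<close> is tall, K K^T is the inverse Gram matrix of
  \<open>transpose A\<close>, and its diagonal is known. If \<open>A\<close> is wide, only K^T K is
  an inverse Gram matrix; it is n by n with the same trace as K K^T. Spreading this trace evenly
  over d axes produces the factor n / d.\<close>

lemma nn_integral_gauss_lsq_map:
  fixes l :: "real^'d"
  assumes \<sigma>: "\<sigma> > 0"
  shows "(\<integral>\<^sup>+A. ennreal ((norm (transpose (lsq_map A) *v l))\<^sup>2) \<partial>(gauss \<sigma> :: (real^'d^'n) measure)) =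
     ennreal ((norm l)\<^sup>2) *
     (if CARD('n) > CARD('d) + 1 then ennreal (1 / (\<sigma>\<^sup>2 * (real CARD('n) - real CARD('d) - 1)))
      else if CARD('d) > CARD('n) + 1 then
        ennreal (real CARD('n) / (real CARD('d) * (\<sigma>\<^sup>2 * (real CARD('d) - real CARD('n) - 1))))
      else \<infinity>)"
proof -
  let ?G = "gauss \<sigma> :: (real^'d^'n) measure"
  define S where "S r = (\<integral>\<^sup>+A. ennreal ((norm (transpose (lsq_map A) *v axis r 1))\<^sup>2) \<partial>?G)" for r
  obtain r :: 'd where True by blast
  show ?thesis
  proof (cases "CARD('d) \<le> CARD('n)")
    case True
    have "S r = (\<integral>\<^sup>+A. ennreal (minv (transpose A ** transpose (transpose A)) $ r $ r) \<partial>?G)"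
      unfolding S_def
    proof (rule nn_integral_cong_AE)
      show "AE A in ?G. ennreal ((norm (transpose (lsq_map A) *v axis r 1))\<^sup>2) =
          ennreal (minv (transpose A ** transpose (transpose A)) $ r $ r)"
        using AE_gauss_full_rank
        by eventually_elim (simp add: norm_transpose_axis lsq_map_tall[OF _ True] del: transpose_matrix_vector)
    qed
    also have "\<dots> = (\<integral>\<^sup>+B. ennreal (minv (B ** transpose B) $ r $ r) \<partial>(gauss \<sigma> :: (real^'n^'d) measure))"
      by (rule nn_integral_gauss_isometry[OF transpose_isometry]) measurable
    also note nn_integral_gauss_minv_gram_diag[OF \<sigma> True]
    finally show ?thesis
      using True by (subst nn_integral_gauss_lsq_map_axis[of _ _ r]) (simp add: S_def)
  next
    case False
    \<comment> \<open>All axes contribute equally, so a single one can be recovered from the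
      trace.\<close>
    have S_eq: "S r' = S r" for r'
      unfolding S_def by (subst nn_integral_gauss_lsq_map_axis[of _ _ r]) simp
    have "ennreal (real CARD('d)) * S r = (\<Sum>r'\<in>(UNIV :: 'd set). S r)"
      by (simp add: ennreal_of_nat_eq_real_of_nat)
    also have "\<dots> = (\<Sum>r'\<in>UNIV. S r')"
      by (rule sum.cong[OF refl S_eq[symmetric]])
    also have "\<dots> = (\<integral>\<^sup>+A. (\<Sum>r\<in>UNIV. ennreal ((norm (transpose (lsq_map A) *v axis r 1))\<^sup>2)) \<partial>?G)"
      unfolding S_def by (rule nn_integral_sum[symmetric]) measurable
    also have "\<dots> = (\<integral>\<^sup>+A. (\<Sum>i\<in>UNIV. ennreal (minv (A ** transpose A) $ i $ i)) \<partial>?G)"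
    proof (rule nn_integral_cong_AE)
      show "AE A in ?G. (\<Sum>r\<in>UNIV. ennreal ((norm (transpose (lsq_map A) *v axis r 1))\<^sup>2)) =
          (\<Sum>i\<in>UNIV. ennreal (minv (A ** transpose A) $ i $ i))"
        using AE_gauss_full_rank
      proof eventually_elim
        case (elim A)
        have gram: "minv (A ** transpose A) = transpose (lsq_map A) ** lsq_map A"
          using lsq_map_wide[OF elim] False by simp
        have nonneg: "0 \<le> minv (A ** transpose A) $ i $ i" for i
          unfolding gram by (simp add: matrix_matrix_mult_def transpose_def sum_nonneg)
        have "(\<Sum>r\<in>UNIV. (norm (transpose (lsq_map A) *v axis r 1))\<^sup>2) =
            trace (lsq_map A ** transpose (lsq_map A))"
          by (simp add: norm_transpose_axis trace_def del: transpose_matrix_vector)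
        also have "\<dots> = (\<Sum>i\<in>UNIV. minv (A ** transpose A) $ i $ i)"
          unfolding gram by (subst trace_mul_sym) (simp add: trace_def)
        finally show ?case
          using nonneg by (simp add: sum_ennreal del: transpose_matrix_vector)
      qed
    qed
    also have "\<dots> = (\<Sum>i\<in>UNIV. \<integral>\<^sup>+A. ennreal (minv (A ** transpose A) $ i $ i) \<partial>?G)"
      by (rule nn_integral_sum) measurable
    also have "\<dots> = ennreal (real CARD('n)) * (if CARD('d) > CARD('n) + 1
        then ennreal (1 / (\<sigma>\<^sup>2 * (real CARD('d) - real CARD('n) - 1))) else \<infinity>)"
      using False by (simp add: nn_integral_gauss_minv_gram_diag[OF \<sigma>] ennreal_of_nat_eq_real_of_nat)
    finally have *: "ennreal (real CARD('d)) * S r = ennreal (real CARD('n)) * (if CARD('d) > CARD('n) + 1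
        then ennreal (1 / (\<sigma>\<^sup>2 * (real CARD('d) - real CARD('n) - 1))) else \<infinity>)" .
    have "S r = (if CARD('d) > CARD('n) + 1 then
        ennreal (real CARD('n) / (real CARD('d) * (\<sigma>\<^sup>2 * (real CARD('d) - real CARD('n) - 1)))) else \<infinity>)"
    proof (cases "CARD('d) > CARD('n) + 1")
      case True
      then have pos: "\<sigma>\<^sup>2 * (real CARD('d) - real CARD('n) - 1) > 0" using \<sigma> by simp
      have "ennreal (real CARD('d)) * S r = ennreal (real CARD('d)) *
          ennreal (real CARD('n) / (real CARD('d) * (\<sigma>\<^sup>2 * (real CARD('d) - real CARD('n) - 1))))"
      proof -
        have "ennreal (real CARD('n)) * ennreal (1 / q) =
            ennreal (real CARD('d)) * ennreal (real CARD('n) / (real CARD('d) * q))" if "q > 0" for q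
          using that by (simp flip: ennreal_mult)
        from this[OF pos] show ?thesis using * True by simp
      qed
      then show ?thesis using True by (simp add: ennreal_mult_cancel_left)
    next
      case 2: False
      then show ?thesis using * by (simp add: ennreal_mult_eq_top_iff ennreal_mult_top)
    qed
    then show ?thesis
      using False by (subst nn_integral_gauss_lsq_map_axis[of _ _ r]) (simp add: S_def)
  qed
qed

subsection \<open>Second moments of the row space projection\<close>

definition row_proj :: "real^'d^'n \<Rightarrow> real^'d^'d" where
  "row_proj A = transpose A ** minv (A ** transpose A) ** A"

lemma borel_measurable_row_proj [measurable (raw)]:
  fixes f :: "'a \<Rightarrow> real^'d^'n"
  assumes [measurable]: "f \<in> borel_measurable M"
  shows "(\<lambda>x. row_proj (f x)) \<in> borel_measurable M"
  unfolding row_proj_def by measurable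

text \<open>The Gram matrix \<open>A ** transpose A\<close> does not change when all rows are
  rotated; only the two outer factors do.\<close>

lemma row_proj_rotate:
  fixes A :: "real^'d^'n"
  assumes Q: "orthogonal_matrix Q"
  shows "row_proj (A ** transpose Q) = Q ** row_proj A ** transpose Q"
proof -
  have Q1: "Z ** transpose Q ** Q = Z" for Z :: "real^'d^'x"
    using Q by (metis matrix_mul_assoc matrix_mul_rid orthogonal_matrix_def)
  show ?thesis
    by (simp add: row_proj_def matrix_transpose_mul matrix_mul_assoc Q1)
qed

lemma row_proj_eq_lsq_map:
  fixes A :: "real^'d^'n"
  assumes "CARD('n) < CARD('d)"
  shows "lsq_map A ** A = row_proj A"
  using assms by (simp add: row_proj_def lsq_map_def)

text \<open>These facts are all that the moment computation uses besides rotation invariance: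
  symmetry, idempotence in the form of row sums of squares, the trace, and a bound that makes every
  moment integrable.\<close>

lemma row_proj_props:
  fixes A :: "real^'d^'n"
  assumes "full_rank A" "CARD('n) < CARD('d)"
  shows "row_proj A $ i $ j = row_proj A $ j $ i"
    and "(\<Sum>j\<in>UNIV. (row_proj A $ i $ j)\<^sup>2) = row_proj A $ i $ i"
    and "(\<Sum>j\<in>UNIV. row_proj A $ j $ j) = real CARD('n)"
    and "\<bar>row_proj A $ i $ j\<bar> \<le> 1"
proof -
  have P: "row_proj A = lsq_map A ** A" using assms by (simp add: row_proj_eq_lsq_map)
  have sym: "transpose (row_proj A) = row_proj A"
    unfolding P by (rule lsq_map_wide(3)[OF assms])
  show symc: "row_proj A $ i $ j = row_proj A $ j $ i" for i j
    using arg_cong[OF sym, of "\<lambda>P. P $ j $ i"] by (simp add: transpose_def)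
  have "row_proj A ** row_proj A = lsq_map A ** (A ** lsq_map A) ** A"
    unfolding P by (simp add: matrix_mul_assoc)
  then have idem: "row_proj A ** row_proj A = row_proj A"
    using lsq_map_wide(1)[OF assms] by (simp add: P)
  show sq: "(\<Sum>j\<in>UNIV. (row_proj A $ i $ j)\<^sup>2) = row_proj A $ i $ i" for i
  proof -
    have "(row_proj A ** row_proj A) $ i $ i = (\<Sum>j\<in>UNIV. row_proj A $ i $ j * row_proj A $ j $ i)"
      by (simp add: matrix_matrix_mult_def)
    also have "\<dots> = (\<Sum>j\<in>UNIV. (row_proj A $ i $ j)\<^sup>2)"
      by (intro sum.cong refl) (simp add: symc[of _ i] power2_eq_square)
    finally show ?thesis by (simp add: idem)
  qed
  have "trace (row_proj A) = trace (A ** lsq_map A)"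
    unfolding P by (rule trace_mul_sym)
  then show "(\<Sum>j\<in>UNIV. row_proj A $ j $ j) = real CARD('n)"
    using lsq_map_wide(1)[OF assms] by (simp add: trace_I) (simp add: trace_def)
  have le: "(row_proj A $ i $ j)\<^sup>2 \<le> row_proj A $ i $ i" for i j
    unfolding sq[symmetric] by (rule member_le_sum) auto
  have "row_proj A $ i $ i \<le> 1"
  proof (rule ccontr)
    assume "\<not> ?thesis"
    then have "row_proj A $ i $ i < (row_proj A $ i $ i)\<^sup>2" by (simp add: power2_eq_square)
    with le[of i i] show False by simp
  qed
  with le[of i j] have "(row_proj A $ i $ j)\<^sup>2 \<le> 1\<^sup>2" by simp
  then show "\<bar>row_proj A $ i $ j\<bar> \<le> 1" by (metis abs_1 abs_le_square_iff)
qed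

lemma integral_gauss_row_proj_rotate:
  fixes f :: "real^'d^'d \<Rightarrow> real" and Q :: "real^'d^'d"
  assumes Q: "orthogonal_matrix Q" and [measurable]: "f \<in> borel_measurable borel"
  shows "(\<integral>A. f (row_proj A) \<partial>(gauss \<sigma> :: (real^'d^'n) measure)) =
    (\<integral>A. f (Q ** row_proj A ** transpose Q) \<partial>(gauss \<sigma> :: (real^'d^'n) measure))"
proof -
  have "(\<integral>A. f (row_proj A) \<partial>distr (gauss \<sigma>) borel (\<lambda>A :: real^'d^'n. A ** transpose Q)) =
    (\<integral>A. f (row_proj (A ** transpose Q)) \<partial>(gauss \<sigma> :: (real^'d^'n) measure))"
    by (rule integral_distr) measurable
  then show ?thesis
    unfolding distr_gauss_isometry[OF rotate_rows_isometry[OF Q]] row_proj_rotate[OF Q] .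
qed

lemma quadratic_form_rotate:
  fixes P :: "real^'d^'d"
  shows "(Q ** P ** transpose Q) $ i $ j = (transpose Q *v axis i 1) \<bullet> (P *v (transpose Q *v axis j 1))"
proof -
  have "(Q ** P ** transpose Q) $ i $ j = axis i 1 \<bullet> ((Q ** P ** transpose Q) *v axis j 1)"
    by (simp add: inner_axis' matrix_vector_mult_basis column_def)
  also have "\<dots> = axis i 1 \<bullet> (Q *v (P *v (transpose Q *v axis j 1)))"
    by (simp only: matrix_vector_mul_assoc matrix_mul_assoc)
  also have "\<dots> = (transpose Q *v axis i 1) \<bullet> (P *v (transpose Q *v axis j 1))"
    by (simp add: dot_lmul_matrix)
  finally show ?thesis .
qed

text \<open>Rotation by 45 degrees in a coordinate plane, reflection in a coordinate and transposition of
  two coordinates, together with the trace identities, determine the second moments.\<close>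
lemma integral_row_proj_mult:
  fixes i j k l :: "'d::finite" and \<sigma> :: real
  assumes \<sigma>: "\<sigma> > 0" and card: "CARD('n) < CARD('d)"
  defines "n \<equiv> real CARD('n)" and "d \<equiv> real CARD('d)"
  defines "\<beta> \<equiv> n * (d - n) / (d * (d - 1) * (d + 2))"
  defines "\<alpha> \<equiv> n / d - (d + 1) * \<beta>"
  shows "integrable (gauss \<sigma> :: (real^'d^'n) measure) (\<lambda>A. row_proj A $ i $ j * row_proj A $ k $ l)"
    and "(\<integral>A. row_proj A $ i $ j * row_proj A $ k $ l \<partial>(gauss \<sigma> :: (real^'d^'n) measure)) =
      \<alpha> * (if i = j \<and> k = l then 1 else 0) +
      \<beta> * ((if i = k \<and> j = l then 1 else 0) + (if i = l \<and> j = k then 1 else 0))"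
proof -
  let ?G = "gauss \<sigma> :: (real^'d^'n) measure"
  interpret prob_space ?G by (rule prob_space_gauss) fact
  have full: "AE A in ?G. full_rank A" by (rule AE_gauss_full_rank)
  note props = row_proj_props[OF _ card]
  have int1: "integrable ?G (\<lambda>A. row_proj A $ i $ j)" for i j
  proof (rule integrable_const_bound[where B=1])
    show "AE A in ?G. norm (row_proj A $ i $ j) \<le> 1"
      using full by eventually_elim (simp add: props(4))
  qed measurable
  have int2: "integrable ?G (\<lambda>A. row_proj A $ i $ j * row_proj A $ k $ l)" for i j k l
  proof (rule integrable_const_bound[where B=1])
    show "AE A in ?G. norm (row_proj A $ i $ j * row_proj A $ k $ l) \<le> 1"
      using full by eventually_elim (simp add: abs_mult props(4) mult_le_one)
  qed measurable
  then show "integrable ?G (\<lambda>A. row_proj A $ i $ j * row_proj A $ k $ l)" .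
  define m where "m i j k l = (\<integral>A. row_proj A $ i $ j * row_proj A $ k $ l \<partial>?G)" for i j k l
  define e where "e i = (\<integral>A. row_proj A $ i $ i \<partial>?G)" for i
  have d2: "d \<ge> 2"
  proof -
    have "0 < CARD('n)" by simp
    then have "2 \<le> CARD('d)" using card by linarith
    then show ?thesis by (simp add: d_def)
  qed
  have m_sym: "m i j k l = m j i k l" "m i j k l = m i j l k" "m i j k l = m k l i j" for i j k l
  proof -
    show "m i j k l = m j i k l"
      unfolding m_def by (rule integral_cong_AE) (use full in \<open>measurable, eventually_elim, simp add: props(1)[of _ j i]\<close>)
    show "m i j k l = m i j l k"
      unfolding m_def by (rule integral_cong_AE) (use full in \<open>measurable, eventually_elim, simp add: props(1)[of _ k l]\<close>)
    show "m i j k l = m k l i j"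
      unfolding m_def by (simp add: mult.commute)
  qed
  \<comment> \<open>The law of the quadratic form of P is the same for every unit vector, by a
    rotation taking \<open>u\<close> to a coordinate axis.\<close>
  have unit: "(\<integral>A. f (u \<bullet> (row_proj A *v u)) \<partial>?G) = (\<integral>A. f (row_proj A $ i $ i) \<partial>?G)"
    if "norm u = 1" and [measurable]: "f \<in> borel_measurable borel" for u i and f :: "real \<Rightarrow> real"
  proof -
    obtain Q where Q: "orthogonal_matrix Q" "transpose Q *v u = norm u *\<^sub>R axis i 1"
      by (rule orthogonal_matrix_exists_axis)
    then have "Q *v (transpose Q *v u) = Q *v axis i 1" using that by simp
    then have u: "u = Q *v axis i 1"
      using Q(1) by (simp add: matrix_vector_mul_assoc orthogonal_matrix_def del: transpose_matrix_vector)
    have "orthogonal_matrix (transpose Q)" using Q(1) by simp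
    from integral_gauss_row_proj_rotate[OF this, where f="\<lambda>P. f (P $ i $ i)" and \<sigma>=\<sigma> and 'n='n]
    show ?thesis
      unfolding quadratic_form_rotate by (simp add: u)
  qed
  define c where "c = m i i i i"
  have axis_form: "axis a 1 \<bullet> (P *v axis b 1) = P $ a $ b" for P :: "real^'d^'d" and a b
    by (simp add: inner_axis' matrix_vector_mult_basis column_def)
  have c: "m a a a a = c" for a
    using unit[of "axis a 1" "\<lambda>x. x * x" i] by (simp add: axis_form m_def c_def)
  have e_const: "e a = e i" for a
    using unit[of "axis a 1" "\<lambda>x. x" i] by (simp add: axis_form e_def)
  have e: "e a = n / d" for a
  proof -
    have "n = (\<integral>A. (\<Sum>a\<in>UNIV. row_proj A $ a $ a) \<partial>?G)"
    proof -
      have "(\<integral>A. (\<Sum>a\<in>UNIV. row_proj A $ a $ a) \<partial>?G) = (\<integral>A. n \<partial>?G)"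
        by (rule integral_cong_AE) (use full in \<open>measurable, eventually_elim, simp add: props(3) n_def\<close>)
      then show ?thesis by (simp add: prob_space[simplified])
    qed
    also have "\<dots> = (\<Sum>a\<in>UNIV. e a)" unfolding e_def by (rule Bochner_Integration.integral_sum) (rule int1)
    also have "\<dots> = (\<Sum>a\<in>(UNIV :: 'd set). e i)" by (rule sum.cong[OF refl e_const])
    also have "\<dots> = d * e i" by (simp add: d_def)
    finally show ?thesis using d2 e_const[of a] by (simp add: field_simps)
  qed
  \<comment> \<open>Reflecting coordinate \<open>a\<close> changes the sign once for every
    occurrence of \<open>a\<close> among the four indices. Moments in which some index occurs an odd
    number of times therefore vanish.\<close>
  have flip: "m i j k l = (if i = a then -1 else 1) * (if j = a then -1 else 1) *
      (if k = a then -1 else 1) * (if l = a then -1 else 1) * m i j k l" for a i j k l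
  proof -
    define s where "s b = (if b = a then -1 else 1 :: real)" for b
    define Q :: "real^'d^'d" where "Q = (\<chi> i j. if i = j then s i else 0)"
    have tQ: "transpose Q = Q" by (simp add: Q_def transpose_def vec_eq_iff)
    have "(Q ** Q) $ x $ y = (if x = y then s x * s y else 0)" for x y
      by (simp add: Q_def matrix_matrix_mult_def if_distrib[of "\<lambda>z. z * _"] cong: if_cong)
    then have "orthogonal_matrix Q"
      by (simp add: orthogonal_matrix tQ vec_eq_iff mat_def s_def)
    moreover have ax: "Q *v axis b 1 = s b *\<^sub>R axis b 1" for b
      by (simp add: matrix_vector_mult_basis column_def) (simp add: Q_def vec_eq_iff axis_def)
    ultimately have Q: "orthogonal_matrix Q" "\<And>b. Q *v axis b 1 = s b *\<^sub>R axis b 1" by blast+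
    have ent: "(Q ** P ** transpose Q) $ x $ y = s x * s y * P $ x $ y" for P :: "real^'d^'d" and x y
      unfolding quadratic_form_rotate by (simp only: tQ Q(2)) (simp add: matrix_vector_mult_scaleR axis_form)
    have "m i j k l = (\<integral>A. (s i * s j * row_proj A $ i $ j) * (s k * s l * row_proj A $ k $ l) \<partial>?G)"
      using integral_gauss_row_proj_rotate[OF Q(1), where f="\<lambda>P. P $ i $ j * P $ k $ l" and \<sigma>=\<sigma> and 'n='n]
      unfolding ent m_def by simp
    also have "\<dots> = (\<integral>A. (s i * s j * s k * s l) * (row_proj A $ i $ j * row_proj A $ k $ l) \<partial>?G)"
      by (simp add: mult_ac)
    also have "\<dots> = s i * s j * s k * s l * m i j k l"
      unfolding m_def by (rule Bochner_Integration.integral_mult_right_zero)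
    finally show ?thesis unfolding s_def .
  qed
  have swap: "m i a i a = m i b i b" if "a \<noteq> i" "b \<noteq> i" for a b i
  proof -
    define t where "t = Transposition.transpose a b"
    have t: "t (t x) = x" for x by (simp add: t_def)
    then have t_iff: "x = t y \<longleftrightarrow> t x = y" for x y by metis
    define Q :: "real^'d^'d" where "Q = (\<chi> i j. if t i = j then 1 else 0)"
    have tQ: "transpose Q = Q" by (auto simp: Q_def transpose_def vec_eq_iff t)
    have ax: "Q *v axis x 1 = axis (t x) 1" for x
      by (simp add: matrix_vector_mult_basis column_def) (auto simp: Q_def vec_eq_iff axis_def t_iff t)
    have "(Q ** Q) $ x $ y = (if t (t x) = y then 1 else 0)" for x y
      by (simp add: Q_def matrix_matrix_mult_def if_distrib[of "\<lambda>z. z * _"] cong: if_cong)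
    then have "Q ** Q = mat 1" by (simp add: vec_eq_iff mat_def t)
    then have "orthogonal_matrix Q" by (simp add: orthogonal_matrix tQ)
    moreover have "t a = b" "t i = i" using that by (auto simp: t_def)
    ultimately have Q: "orthogonal_matrix Q" "t a = b" "t i = i" by blast+
    have ent: "(Q ** P ** transpose Q) $ x $ y = P $ t x $ t y" for P :: "real^'d^'d" and x y
      unfolding quadratic_form_rotate by (simp only: tQ ax axis_form)
    show ?thesis
      using integral_gauss_row_proj_rotate[OF Q(1), where f="\<lambda>P. P $ i $ a * P $ i $ a" and \<sigma>=\<sigma> and 'n='n]
      unfolding ent m_def Q(2,3) by simp
  qed
  \<comment> \<open>The quadratic form at (e_a + e_b) / sqrt 2 has second moment \<open>c\<close>
    too. Of the 16 terms of its expansion the odd ones vanish, leaving 4 c = 2 c + 2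
    \<open>m a a b b\<close> + 4 \<open>m a b a b\<close>.\<close>
  have diag: "m a a b b = c - 2 * m a b a b" if ab: "a \<noteq> b" for a b
  proof -
    define u :: "real^'d" where "u = (1 / sqrt 2) *\<^sub>R (axis a 1 + axis b 1)"
    have "u \<bullet> u = 1"
      using ab by (simp add: u_def inner_add_left inner_add_right inner_axis_axis)
    then have "norm u = 1" by (simp add: norm_eq_sqrt_inner)
    from unit[OF this, of "\<lambda>x. x * x" a]
    have 1: "(\<integral>A. (u \<bullet> (row_proj A *v u)) * (u \<bullet> (row_proj A *v u)) \<partial>?G) = c"
      using c[of a] by (simp add: m_def)
    have form: "u \<bullet> (P *v u) = (P $ a $ a + P $ a $ b + P $ b $ a + P $ b $ b) / 2" for P
      by (simp add: u_def matrix_vector_mult_scaleR matrix_vector_right_distrib inner_add_left inner_add_right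
          axis_form field_simps)
    have "c = (\<integral>A. (\<Sum>x\<in>{a,b}. \<Sum>y\<in>{a,b}. \<Sum>z\<in>{a,b}. \<Sum>w\<in>{a,b}. row_proj A $ x $ y * row_proj A $ z $ w) / 4 \<partial>?G)"
      unfolding 1[symmetric] form using ab by (simp add: algebra_simps)
    also have "\<dots> = (\<Sum>x\<in>{a,b}. \<Sum>y\<in>{a,b}. \<Sum>z\<in>{a,b}. \<Sum>w\<in>{a,b}. m x y z w) / 4"
      by (simp add: m_def int2 Bochner_Integration.integral_sum)
    finally have "4 * c = (\<Sum>x\<in>{a,b}. \<Sum>y\<in>{a,b}. \<Sum>z\<in>{a,b}. \<Sum>w\<in>{a,b}. m x y z w)" by simp
    moreover have "m a a a b = 0" "m a a b a = 0" "m a b a a = 0" "m b a a a = 0"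
        "m b b b a = 0" "m b b a b = 0" "m b a b b = 0" "m a b b b = 0"
      using flip[of a a a b b] flip[of a a b a b] flip[of a b a a b] flip[of b a a a b]
        flip[of b b b a b] flip[of b b a b b] flip[of b a b b b] flip[of a b b b b] ab by auto
    moreover have "m b a b a = m a b a b" "m a b b a = m a b a b" "m b a a b = m a b a b" "m b b a a = m a a b b"
      using trans[OF m_sym(1)[of b a b a] m_sym(2)[of a b b a]] m_sym(2)[of a b b a] m_sym(1)[of b a a b]
        m_sym(3)[of b b a a] by (simp_all only:)
    ultimately show ?thesis using ab c[of a] c[of b] by (simp add: algebra_simps)
  qed
  \<comment> \<open>First equation, from idempotence: the squares in row \<open>a\<close> of P sum
    to its diagonal entry, whose mean is n / d.\<close>
  have row: "m a b a b = (n / d - c) / (d - 1)" if ab: "a \<noteq> b" for a b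
  proof -
    have "e a = (\<integral>A. (\<Sum>b\<in>UNIV. row_proj A $ a $ b * row_proj A $ a $ b) \<partial>?G)"
      unfolding e_def
      by (rule integral_cong_AE)
         (use full in \<open>measurable, eventually_elim, simp add: props(2)[symmetric] power2_eq_square\<close>)
    also have "\<dots> = (\<Sum>b\<in>UNIV. m a b a b)"
      unfolding m_def by (rule Bochner_Integration.integral_sum) (rule int2)
    also have "\<dots> = m a a a a + (\<Sum>b\<in>UNIV - {a}. m a b a b)" by (simp add: sum.remove)
    also have "(\<Sum>b\<in>UNIV - {a}. m a b a b) = (\<Sum>_\<in>UNIV - {a}. m a b a b)"
      using ab by (intro sum.cong refl swap) auto
    also have "\<dots> = (d - 1) * m a b a b" by (simp add: d_def card_Diff_singleton of_nat_diff Suc_leI)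
    finally have "n / d = c + (d - 1) * m a b a b" unfolding e c .
    then show ?thesis using d2 by (simp add: field_simps)
  qed
  \<comment> \<open>Second equation, from the trace: multiplying a diagonal entry of P by tr P = n
    and taking means.\<close>
  have "n * (n / d) = c + (d - 1) * (c - 2 * ((n / d - c) / (d - 1)))"
  proof -
    have "n * e i = (\<integral>A. n * row_proj A $ i $ i \<partial>?G)" unfolding e_def by simp
    also have "\<dots> = (\<integral>A. (\<Sum>b\<in>UNIV. row_proj A $ i $ i * row_proj A $ b $ b) \<partial>?G)"
      by (rule integral_cong_AE)
         (use full in \<open>measurable, eventually_elim, simp add: props(3) n_def flip: sum_distrib_left\<close>)
    also have "\<dots> = (\<Sum>b\<in>UNIV. m i i b b)"
      unfolding m_def by (rule Bochner_Integration.integral_sum) (rule int2)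
    also have "\<dots> = m i i i i + (\<Sum>b\<in>UNIV - {i}. m i i b b)" by (simp add: sum.remove)
    also have "(\<Sum>b\<in>UNIV - {i}. m i i b b) = (\<Sum>_\<in>UNIV - {i}. c - 2 * ((n / d - c) / (d - 1)))"
      by (intro sum.cong refl) (auto simp: diag row)
    also have "\<dots> = (d - 1) * (c - 2 * ((n / d - c) / (d - 1)))"
      by (simp add: d_def card_Diff_singleton of_nat_diff Suc_leI)
    finally show ?thesis unfolding e c .
  qed
  \<comment> \<open>Eliminating \<open>c\<close> from the two equations leaves \<beta> as the mean
    of a squared off-diagonal entry.\<close>
  then have c_val: "(n / d - c) / (d - 1) = \<beta>"
    using d2 unfolding \<beta>_def by (simp add: divide_simps) algebra
  then have c_eq: "c - 2 * \<beta> = \<alpha>"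
    using d2 unfolding \<alpha>_def by (simp add: divide_simps) (simp add: algebra_simps)
  have "m i j k l = \<alpha> * (if i = j \<and> k = l then 1 else 0) +
      \<beta> * ((if i = k \<and> j = l then 1 else 0) + (if i = l \<and> j = k then 1 else 0))"
  proof -
    consider "i = j" "k = l" "i = k" | "i = j" "k = l" "i \<noteq> k" | "i = k" "j = l" "i \<noteq> j"
      | "i = l" "j = k" "i \<noteq> j"
      | "\<not> (i = j \<and> k = l)" "\<not> (i = k \<and> j = l)" "\<not> (i = l \<and> j = k)" by blast
    then show ?thesis
    proof cases
      case 1 then show ?thesis using c[of i] c_eq by simp
    next
      case 2 then show ?thesis using diag[of i k] row[of i k] c_eq c_val by auto
    next
      case 3 then show ?thesis using row[of i j] c_val by auto
    next
      case 4 then show ?thesis using row[of i j] c_val m_sym(2)[of i j j i] by auto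
    next
      case 5
      define p where "p a = (if i = a then -1 else 1) * (if j = a then -1 else 1) *
        (if k = a then -1 else 1) * (if l = a then -1 else (1::real))" for a
      \<comment> \<open>Since the multiplicities add up to 4, the number of values with odd
        multiplicity is even. If the indices do not pair up there are at least two such values, so
        at least one differs from \<open>l\<close>.\<close>
      have "p i = - 1 \<or> p j = - 1 \<or> p k = - 1"
        using 5 unfolding p_def
        by (cases "i = j"; cases "k = l"; cases "i = k"; cases "i = l"; cases "j = k"; cases "j = l") simp_all
      then obtain a where "p a = - 1" by blast
      then have "m i j k l = - m i j k l"
        using flip[of i j k l a] unfolding p_def by simp
      then have "m i j k l = 0" by linarith
      then show ?thesis by (simp only: 5 if_False mult_zero_right add_0_right)
    qed
  qed
  then show "(\<integral>A. row_proj A $ i $ j * row_proj A $ k $ l \<partial>?G) =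
      \<alpha> * (if i = j \<and> k = l then 1 else 0) +
      \<beta> * ((if i = k \<and> j = l then 1 else 0) + (if i = l \<and> j = k then 1 else 0))"
    by (simp add: m_def)
qed

subsection \<open>Orbit averaging\<close>

lemma integrable_vecI:
  fixes f :: "'a \<Rightarrow> ('b::euclidean_space)^'n"
  assumes "\<And>i. integrable M (\<lambda>x. f x $ i)"
  shows "integrable M f"
proof -
  have f: "f = (\<lambda>x. \<Sum>i\<in>UNIV. axis i (f x $ i))"
    by (auto simp: fun_eq_iff vec_eq_iff axis_def if_distrib cong: if_cong)
  have "bounded_linear (\<lambda>y :: 'b. axis i y :: 'b^'n)" for i
    unfolding linear_conv_bounded_linear[symmetric] by (intro linearI) (auto simp: vec_eq_iff axis_def)
  then show ?thesis
    by (subst f) (intro Bochner_Integration.integrable_sum integrable_bounded_linear[where T="axis _"] assms)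
qed

lemma integral_vec_nth:
  fixes f :: "'a \<Rightarrow> ('b::euclidean_space)^'n"
  assumes "\<And>i. integrable M (\<lambda>x. f x $ i)"
  shows "(\<integral>x. f x \<partial>M) $ i = (\<integral>x. f x $ i \<partial>M)"
  by (rule integral_bounded_linear[OF bounded_linear_vec_nth integrable_vecI[OF assms], symmetric])

lemma integral_matrix_nth:
  fixes f :: "'a \<Rightarrow> real^'m^'n"
  assumes "\<And>i j. integrable M (\<lambda>x. f x $ i $ j)"
  shows "(\<integral>x. f x \<partial>M) $ i $ j = (\<integral>x. f x $ i $ j \<partial>M)"
  using assms by (subst integral_vec_nth; (subst integral_vec_nth)?) (auto intro: integrable_vecI)

lemma orthogonal_matrix_entry_le:
  assumes "orthogonal_matrix (Q :: real^'n^'n)"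
  shows "\<bar>Q $ i $ j\<bar> \<le> 1"
proof -
  have "(Q ** transpose Q) $ i $ i = 1"
    using assms by (simp add: orthogonal_matrix_def mat_def)
  then have "(\<Sum>k\<in>UNIV. (Q $ i $ k)\<^sup>2) = 1"
    by (simp add: matrix_matrix_mult_def transpose_def power2_eq_square)
  moreover have "(Q $ i $ j)\<^sup>2 \<le> (\<Sum>k\<in>UNIV. (Q $ i $ k)\<^sup>2)"
    by (rule member_le_sum) auto
  ultimately have "(Q $ i $ j)\<^sup>2 \<le> 1\<^sup>2" by simp
  then show ?thesis by (metis abs_1 abs_le_square_iff)
qed

lemma orth_rep_inv:
  assumes "orth_rep G lam \<rho>" "group G" "g \<in> carrier G"
  shows "\<rho> (inv\<^bsub>G\<^esub> g) = transpose (\<rho> g)"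
proof -
  interpret group G by fact
  have "\<rho> (inv\<^bsub>G\<^esub> g) ** \<rho> g = mat 1"
    using assms unfolding orth_rep_def by (metis inv_closed l_inv)
  moreover have "\<rho> g ** transpose (\<rho> g) = mat 1"
    using assms by (auto simp: orth_rep_def orthogonal_matrix_def)
  ultimately show ?thesis by (metis matrix_mul_assoc matrix_mul_lid matrix_mul_rid)
qed

lemma sum_pair_UNIV: "(\<Sum>p\<in>UNIV. f p) = (\<Sum>r\<in>UNIV. \<Sum>s\<in>UNIV. f (r, s))"
  for f :: "('x::finite) \<times> ('y::finite) \<Rightarrow> real"
  by (simp add: sum.cartesian_product flip: UNIV_Times_UNIV)

lemma trace_mult_eq: "trace (A ** B) = (\<Sum>s\<in>UNIV. \<Sum>v\<in>UNIV. A $ s $ v * B $ v $ s)" for A B :: "real^'x^'x"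
  by (simp add: trace_def matrix_matrix_mult_def)

locale rep_pair =
  fixes G :: "('g, 'b) monoid_scheme" and lam :: "'g measure"
    and \<phi> :: "'g \<Rightarrow> real^'d^'d" and \<psi> :: "'g \<Rightarrow> real^'k^'k"
  assumes haar: "haar_prob G lam" and rep_phi: "orth_rep G lam \<phi>" and rep_psi: "orth_rep G lam \<psi>"
begin

lemma grp: "group G" and prob: "prob_space lam" and space_lam [simp]: "space lam = carrier G"
  using haar by (auto simp: haar_prob_def)

sublocale group G by (rule grp)
sublocale prob_space lam by (rule prob)

lemma measurable_rep [measurable]: "\<phi> \<in> borel_measurable lam" "\<psi> \<in> borel_measurable lam"
  using rep_phi rep_psi by (auto simp: orth_rep_def)

lemma orth [simp]: "g \<in> carrier G \<Longrightarrow> orthogonal_matrix (\<phi> g)" "g \<in> carrier G \<Longrightarrow> orthogonal_matrix (\<psi> g)"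
  using rep_phi rep_psi by (auto simp: orth_rep_def)

lemma rep_mult:
  "g \<in> carrier G \<Longrightarrow> h \<in> carrier G \<Longrightarrow> \<phi> (g \<otimes>\<^bsub>G\<^esub> h) = \<phi> g ** \<phi> h"
  "g \<in> carrier G \<Longrightarrow> h \<in> carrier G \<Longrightarrow> \<psi> (g \<otimes>\<^bsub>G\<^esub> h) = \<psi> g ** \<psi> h"
  using rep_phi rep_psi by (auto simp: orth_rep_def)

lemma rep_inv:
  "g \<in> carrier G \<Longrightarrow> \<phi> (inv\<^bsub>G\<^esub> g) = transpose (\<phi> g)"
  "g \<in> carrier G \<Longrightarrow> \<psi> (inv\<^bsub>G\<^esub> g) = transpose (\<psi> g)"
  using orth_rep_inv[OF rep_phi grp] orth_rep_inv[OF rep_psi grp] by auto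

lemma integrable_rep:
  "integrable lam (\<lambda>g. \<phi> g $ r $ u)" "integrable lam (\<lambda>g. \<psi> g $ s $ v)"
  "integrable lam (\<lambda>g. \<phi> g $ r $ u * \<psi> g $ s $ v)"
  "integrable lam (\<lambda>g. \<psi> g $ s $ v * \<psi> g $ s' $ v')"
  by (rule integrable_const_bound[where B=1];
      auto intro!: AE_I2 mult_le_one orthogonal_matrix_entry_le simp: abs_mult)+

text \<open>The matrix of \<Psi> in the basis of matrix units, indexed by positions in a d by k
  matrix: the Haar average of the tensor product of \<phi>(g) and \<psi>(g). The inverse in \<Psi>
  has become a transpose by orthogonality.\<close>

definition avg_coeff :: "'d \<times> 'k \<Rightarrow> 'd \<times> 'k \<Rightarrow> real" where
  "avg_coeff p q = (\<integral>g. \<phi> g $ fst p $ fst q * \<psi> g $ snd p $ snd q \<partial>lam)"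

text \<open>Inversion preserves Haar measure and transposes orthogonal matrices; this makes \<Psi>
  self-adjoint.\<close>

lemma avg_coeff_sym: "avg_coeff p q = avg_coeff q p"
proof -
  have inv_meas [measurable]: "(\<lambda>h. inv\<^bsub>G\<^esub> h) \<in> lam \<rightarrow>\<^sub>M lam"
    and inv_distr: "distr lam lam (\<lambda>h. inv\<^bsub>G\<^esub> h) = lam"
    using haar by (auto simp: haar_prob_def)
  have "avg_coeff p q = (\<integral>g. \<phi> (inv\<^bsub>G\<^esub> g) $ fst p $ fst q * \<psi> (inv\<^bsub>G\<^esub> g) $ snd p $ snd q \<partial>lam)"
    unfolding avg_coeff_def by (subst inv_distr[symmetric], subst integral_distr) auto
  also have "\<dots> = avg_coeff q p"
    unfolding avg_coeff_def
    by (rule Bochner_Integration.integral_cong) (auto simp: rep_inv transpose_def)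
  finally show ?thesis .
qed

text \<open>Left invariance of Haar measure: the image of \<Psi> is fixed by the group action.
  Averaging over \<open>h\<close> then gives idempotence.\<close>

lemma avg_coeff_translate:
  assumes h: "h \<in> carrier G"
  shows "(\<Sum>q\<in>UNIV. \<phi> h $ fst p $ fst q * \<psi> h $ snd p $ snd q * avg_coeff q t) = avg_coeff p t"
proof -
  have left_meas [measurable]: "(\<lambda>g. h \<otimes>\<^bsub>G\<^esub> g) \<in> lam \<rightarrow>\<^sub>M lam"
    and left_distr: "distr lam lam (\<lambda>g. h \<otimes>\<^bsub>G\<^esub> g) = lam"
    using haar h by (auto simp: haar_prob_def)
  have "avg_coeff p t = (\<integral>g. \<phi> (h \<otimes>\<^bsub>G\<^esub> g) $ fst p $ fst t * \<psi> (h \<otimes>\<^bsub>G\<^esub> g) $ snd p $ snd t \<partial>lam)"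
    unfolding avg_coeff_def by (subst left_distr[symmetric], subst integral_distr) auto
  also have "\<dots> = (\<integral>g. (\<Sum>q\<in>UNIV. \<phi> h $ fst p $ fst q * \<psi> h $ snd p $ snd q *
      (\<phi> g $ fst q $ fst t * \<psi> g $ snd q $ snd t)) \<partial>lam)"
    by (rule Bochner_Integration.integral_cong)
       (auto simp: rep_mult h matrix_matrix_mult_def sum_pair_UNIV sum_product mult_ac)
  also have "\<dots> = (\<Sum>q\<in>UNIV. \<phi> h $ fst p $ fst q * \<psi> h $ snd p $ snd q * avg_coeff q t)"
    unfolding avg_coeff_def
    by (subst Bochner_Integration.integral_sum) (auto intro!: integrable_rep)
  finally show ?thesis by simp
qed

lemma avg_coeff_idem: "(\<Sum>q\<in>UNIV. avg_coeff p q * avg_coeff q t) = avg_coeff p t"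
proof -
  have "(\<Sum>q\<in>UNIV. avg_coeff p q * avg_coeff q t) =
     (\<integral>h. (\<Sum>q\<in>UNIV. \<phi> h $ fst p $ fst q * \<psi> h $ snd p $ snd q * avg_coeff q t) \<partial>lam)"
    unfolding avg_coeff_def[of p]
    by (subst Bochner_Integration.integral_sum) (auto intro!: integrable_rep)
  also have "\<dots> = (\<integral>h. avg_coeff p t \<partial>lam)"
    by (rule Bochner_Integration.integral_cong) (auto simp: avg_coeff_translate)
  also have "\<dots> = avg_coeff p t" using prob_space by simp
  finally show ?thesis .
qed

lemma conj_nth: "(\<phi> g ** W ** transpose (\<psi> g)) $ r $ s =
    (\<Sum>q\<in>UNIV. \<phi> g $ r $ fst q * \<psi> g $ s $ snd q * W $ fst q $ snd q)"
proof -
  have "(\<phi> g ** W ** transpose (\<psi> g)) $ r $ s = (\<Sum>v\<in>UNIV. \<Sum>u\<in>UNIV. \<phi> g $ r $ u * W $ u $ v * \<psi> g $ s $ v)"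
    by (simp add: matrix_matrix_mult_def transpose_def sum_distrib_right)
  also have "\<dots> = (\<Sum>u\<in>UNIV. \<Sum>v\<in>UNIV. \<phi> g $ r $ u * W $ u $ v * \<psi> g $ s $ v)"
    by (rule sum.swap)
  finally show ?thesis by (simp add: sum_pair_UNIV mult_ac)
qed

lemma orbit_avg_nth:
  "orbit_avg G lam \<phi> \<psi> W $ r $ s = (\<Sum>q\<in>UNIV. avg_coeff (r, s) q * W $ fst q $ snd q)"
proof -
  let ?f = "\<lambda>g. \<phi> g ** W ** transpose (\<psi> g)"
  have int: "integrable lam (\<lambda>g. ?f g $ r $ s)" for r s
    unfolding conj_nth by (auto intro!: integrable_rep)
  have "orbit_avg G lam \<phi> \<psi> W = (\<integral>g. ?f g \<partial>lam)"
    unfolding orbit_avg_def by (rule Bochner_Integration.integral_cong) (auto simp: rep_inv)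
  also have "\<dots> $ r $ s = (\<integral>g. ?f g $ r $ s \<partial>lam)"
    by (rule integral_matrix_nth) (rule int)
  also have "\<dots> = (\<Sum>q\<in>UNIV. avg_coeff (r, s) q * W $ fst q $ snd q)"
    unfolding conj_nth avg_coeff_def
    by (subst Bochner_Integration.integral_sum) (auto intro!: integrable_rep)
  finally show ?thesis .
qed

lemma lin_equivariant_iff:
  "lin_equivariant G \<phi> \<psi> W \<longleftrightarrow> (\<forall>g\<in>carrier G. transpose W ** \<phi> g = \<psi> g ** transpose W)"
  unfolding lin_equivariant_def linpred_def matrix_vector_mul_assoc
  by (metis matrix_eq)

lemma lin_equivariant_iff_conj:
  "lin_equivariant G \<phi> \<psi> W \<longleftrightarrow> (\<forall>g\<in>carrier G. \<phi> g ** W ** transpose (\<psi> g) = W)"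
proof -
  have "transpose W ** \<phi> g = \<psi> g ** transpose W \<longleftrightarrow> \<phi> g ** W ** transpose (\<psi> g) = W"
    if g: "g \<in> carrier G" for g
  proof -
    have Q: "transpose (\<phi> g) ** \<phi> g = mat 1" "\<phi> g ** transpose (\<phi> g) = mat 1"
        "transpose (\<psi> g) ** \<psi> g = mat 1" "\<psi> g ** transpose (\<psi> g) = mat 1"
      using orth[OF g] by (simp_all add: orthogonal_matrix_def)
    have "transpose W ** \<phi> g = \<psi> g ** transpose W \<longleftrightarrow> transpose (\<phi> g) ** W = W ** transpose (\<psi> g)"
      by (metis matrix_transpose_mul transpose_transpose)
    also have "\<dots> \<longleftrightarrow> \<phi> g ** W ** transpose (\<psi> g) = W"
    proof
      assume "transpose (\<phi> g) ** W = W ** transpose (\<psi> g)"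
      then have "\<phi> g ** (transpose (\<phi> g) ** W) = \<phi> g ** (W ** transpose (\<psi> g))" by simp
      then show "\<phi> g ** W ** transpose (\<psi> g) = W" by (simp add: matrix_mul_assoc Q)
    next
      assume "\<phi> g ** W ** transpose (\<psi> g) = W"
      then have "transpose (\<phi> g) ** W = transpose (\<phi> g) ** (\<phi> g ** W ** transpose (\<psi> g))" by simp
      then show "transpose (\<phi> g) ** W = W ** transpose (\<psi> g)" by (simp add: matrix_mul_assoc Q)
    qed
    finally show ?thesis .
  qed
  then show ?thesis by (simp add: lin_equivariant_iff)
qed

lemma orbit_avg_fixed:
  assumes "lin_equivariant G \<phi> \<psi> \<Theta>"
  shows "orbit_avg G lam \<phi> \<psi> \<Theta> = \<Theta>"
proof -
  have "orbit_avg G lam \<phi> \<psi> \<Theta> = (\<integral>g. \<Theta> \<partial>lam)"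
    unfolding orbit_avg_def using assms
    by (intro Bochner_Integration.integral_cong) (auto simp: rep_inv lin_equivariant_iff_conj)
  then show ?thesis using prob_space by simp
qed

lemma lin_equivariant_orbit_avg: "lin_equivariant G \<phi> \<psi> (orbit_avg G lam \<phi> \<psi> W)"
  unfolding lin_equivariant_iff_conj
proof
  fix h assume h: "h \<in> carrier G"
  have "(\<phi> h ** orbit_avg G lam \<phi> \<psi> W ** transpose (\<psi> h)) $ r $ s = orbit_avg G lam \<phi> \<psi> W $ r $ s" for r s
  proof -
    have "(\<phi> h ** orbit_avg G lam \<phi> \<psi> W ** transpose (\<psi> h)) $ r $ s =
      (\<Sum>q\<in>UNIV. \<Sum>t\<in>UNIV. \<phi> h $ r $ fst q * \<psi> h $ s $ snd q * avg_coeff q t * W $ fst t $ snd t)"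
      by (simp add: conj_nth orbit_avg_nth sum_distrib_left mult.assoc)
    also have "\<dots> = (\<Sum>t\<in>UNIV. \<Sum>q\<in>UNIV. \<phi> h $ r $ fst q * \<psi> h $ s $ snd q * avg_coeff q t * W $ fst t $ snd t)"
      by (rule sum.swap)
    also have "\<dots> = orbit_avg G lam \<phi> \<psi> W $ r $ s"
      using avg_coeff_translate[OF h, of "(r, s)"] by (simp add: orbit_avg_nth flip: sum_distrib_right)
    finally show ?thesis .
  qed
  then show "\<phi> h ** orbit_avg G lam \<phi> \<psi> W ** transpose (\<psi> h) = orbit_avg G lam \<phi> \<psi> W"
    by (simp add: vec_eq_iff)
qed

section \<open>The complementary projection and the character product\<close>

definition perp_coeff :: "'d \<times> 'k \<Rightarrow> 'd \<times> 'k \<Rightarrow> real" where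
  "perp_coeff p q = (if p = q then 1 else 0) - avg_coeff p q"

lemma perp_coeff_sym: "perp_coeff p q = perp_coeff q p"
  by (simp add: perp_coeff_def avg_coeff_sym[of p q])

lemma perp_coeff_idem: "(\<Sum>q\<in>UNIV. perp_coeff p q * perp_coeff q t) = perp_coeff p t"
  by (simp add: perp_coeff_def left_diff_distrib right_diff_distrib sum_subtractf avg_coeff_idem
      if_distrib[of "\<lambda>x. x * _"] if_distrib[of "\<lambda>x. _ * x"] cong: if_cong)

definition perp :: "real^'k^'d \<Rightarrow> real^'k^'d" where
  "perp W = (\<chi> r s. \<Sum>q\<in>UNIV. perp_coeff (r, s) q * W $ fst q $ snd q)"

lemma perp_eq: "perp W = W - orbit_avg G lam \<phi> \<psi> W"
  by (simp add: perp_def vec_eq_iff perp_coeff_def left_diff_distrib sum_subtractf orbit_avg_nth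
      if_distrib[of "\<lambda>x. x * _"] cong: if_cong)

lemma norm_matrix_power2_pair: "(norm (W :: real^'k^'d))\<^sup>2 = (\<Sum>p\<in>UNIV. (W $ fst p $ snd p)\<^sup>2)"
  by (simp add: norm_matrix_power2 sum_pair_UNIV)

lemma norm_perp_power2:
  "(norm (perp W))\<^sup>2 = (\<Sum>p\<in>UNIV. \<Sum>q\<in>UNIV. perp_coeff p q * W $ fst p $ snd p * W $ fst q $ snd q)"
proof -
  let ?w = "\<lambda>p. W $ fst p $ snd p"
  have "(norm (perp W))\<^sup>2 = (\<Sum>t\<in>UNIV. \<Sum>p\<in>UNIV. \<Sum>q\<in>UNIV. perp_coeff t p * ?w p * (perp_coeff t q * ?w q))"
    unfolding norm_matrix_power2_pair by (simp add: perp_def power2_eq_square sum_product)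
  also have "\<dots> = (\<Sum>p\<in>UNIV. \<Sum>t\<in>UNIV. \<Sum>q\<in>UNIV. perp_coeff t p * ?w p * (perp_coeff t q * ?w q))"
    by (rule sum.swap)
  also have "\<dots> = (\<Sum>p\<in>UNIV. \<Sum>q\<in>UNIV. \<Sum>t\<in>UNIV. perp_coeff t p * ?w p * (perp_coeff t q * ?w q))"
    by (intro sum.cong refl sum.swap)
  also have "\<dots> = (\<Sum>p\<in>UNIV. \<Sum>q\<in>UNIV. (\<Sum>t\<in>UNIV. perp_coeff p t * perp_coeff t q) * ?w p * ?w q)"
    unfolding sum_distrib_right by (intro sum.cong refl) (simp add: perp_coeff_sym mult_ac)
  finally show ?thesis by (simp add: perp_coeff_idem)
qed

text \<open>Pythagoras: \<open>perp\<close> is an orthogonal projection that annihilates \<Theta>,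
  so it sees only the component of W - \<Theta> that averaging removes.\<close>

lemma norm_diff_orbit_avg:
  assumes "lin_equivariant G \<phi> \<psi> \<Theta>"
  shows "(norm (W - \<Theta>))\<^sup>2 - (norm (orbit_avg G lam \<phi> \<psi> W - \<Theta>))\<^sup>2 = (norm (perp W))\<^sup>2"
proof -
  have "perp \<Theta> = 0" using orbit_avg_fixed[OF assms] by (simp add: perp_eq)
  moreover have "perp (W - \<Theta>) = perp W - perp \<Theta>"
    by (simp add: perp_def vec_eq_iff right_diff_distrib sum_subtractf)
  ultimately have V: "perp (W - \<Theta>) = perp W" by simp
  have "(W - \<Theta>) \<bullet> perp (W - \<Theta>) = (norm (perp (W - \<Theta>)))\<^sup>2"
    unfolding norm_perp_power2
    by (simp add: inner_vec_def perp_def sum_pair_UNIV[of "\<lambda>p. \<Sum>q\<in>UNIV. _ p q"] sum_distrib_left mult_ac)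
  then have a: "(W - \<Theta>) \<bullet> perp W = (norm (perp W))\<^sup>2" by (simp add: V)
  have b: "orbit_avg G lam \<phi> \<psi> W - \<Theta> = (W - \<Theta>) - perp W" by (simp add: perp_eq)
  have c: "(norm ((W - \<Theta>) - perp W))\<^sup>2 = (norm (W - \<Theta>))\<^sup>2 - 2 * ((W - \<Theta>) \<bullet> perp W) + (norm (perp W))\<^sup>2"
    by (simp add: power2_norm_eq_inner inner_diff_left inner_diff_right inner_commute algebra_simps)
  show ?thesis unfolding b c a by simp
qed

text \<open>For a symmetric idempotent matrix the sum of squared entries is the trace. The trace of
  a tensor product is the product of the traces, whence the characters.\<close>

lemma sum_perp_coeff_sq: "(\<Sum>p\<in>UNIV. \<Sum>q\<in>UNIV. (perp_coeff p q)\<^sup>2) = real (CARD('d) * CARD('k)) - char_prod lam \<phi> \<psi>"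
proof -
  have "(\<Sum>p\<in>UNIV. \<Sum>q\<in>UNIV. (perp_coeff p q)\<^sup>2) = (\<Sum>p\<in>UNIV. \<Sum>q\<in>UNIV. perp_coeff p q * perp_coeff q p)"
    by (intro sum.cong refl) (simp add: perp_coeff_sym power2_eq_square)
  also have "\<dots> = (\<Sum>p\<in>(UNIV :: ('d \<times> 'k) set). 1) - (\<Sum>p\<in>UNIV. avg_coeff p p)"
    unfolding perp_coeff_idem by (simp add: perp_coeff_def sum_subtractf)
  also have "(\<Sum>p\<in>UNIV. avg_coeff p p) = (\<integral>g. (\<Sum>p\<in>UNIV. \<phi> g $ fst p $ fst p * \<psi> g $ snd p $ snd p) \<partial>lam)"
    unfolding avg_coeff_def by (rule Bochner_Integration.integral_sum[symmetric]) (rule integrable_rep)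
  also have "\<dots> = char_prod lam \<phi> \<psi>"
    unfolding char_prod_def mult.commute[of "trace (\<psi> _)"] by (simp add: sum_pair_UNIV trace_def sum_product)
  finally show ?thesis by simp
qed

lemma char_prod_le: "char_prod lam \<phi> \<psi> \<le> real (CARD('d) * CARD('k))"
proof -
  have "0 \<le> (\<Sum>p\<in>UNIV. \<Sum>q\<in>UNIV. (perp_coeff p q)\<^sup>2)" by (intro sum_nonneg) simp
  then show ?thesis unfolding sum_perp_coeff_sq by simp
qed

text \<open>If the complementary projection has trace 0 it is 0. Used in contrapositive form: one
  estimate that fails to be equivariant makes the noise coefficient strictly positive.\<close>

lemma all_equivariant_if_char_prod:
  assumes "char_prod lam \<phi> \<psi> = real (CARD('d) * CARD('k))"
  shows "lin_equivariant G \<phi> \<psi> W"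
proof -
  have "(\<Sum>p\<in>UNIV. \<Sum>q\<in>UNIV. (perp_coeff p q)\<^sup>2) = 0" using sum_perp_coeff_sq assms by simp
  then have "perp_coeff p q = 0" for p q
    by (cases p; cases q) (simp add: sum_nonneg_eq_0_iff sum_nonneg)
  then have "perp W = 0" by (simp add: perp_def vec_eq_iff)
  then have "orbit_avg G lam \<phi> \<psi> W = W" by (simp add: perp_eq)
  then show ?thesis using lin_equivariant_orbit_avg[of W] by simp
qed

section \<open>Origin of \<open>J_G\<close>: contraction with the second moments of P\<close>

lemma trace_J_G:
  "trace (J_G G lam \<phi> \<psi> ** B) = (\<integral>g. trace ((trace (\<phi> g) *\<^sub>R \<psi> g + \<psi> g ** \<psi> g) ** B) \<partial>lam)"
proof -
  let ?f = "\<lambda>g. trace (\<phi> g) *\<^sub>R \<psi> g + \<psi> g ** \<psi> g"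
  have int: "integrable lam (\<lambda>g. ?f g $ s $ v)" for s v
    by (simp add: trace_def matrix_matrix_mult_def sum_distrib_right integrable_rep)
  have "J_G G lam \<phi> \<psi> = (\<integral>g. ?f g \<partial>lam)"
    unfolding J_G_def by (rule Bochner_Integration.integral_cong) (auto simp: rep_mult)
  then have "J_G G lam \<phi> \<psi> $ s $ v = (\<integral>g. ?f g $ s $ v \<partial>lam)" for s v
    using integral_matrix_nth[OF int] by simp
  then show "trace (J_G G lam \<phi> \<psi> ** B) = (\<integral>g. trace (?f g ** B) \<partial>lam)"
    unfolding trace_mult_eq using int
    by (simp only: integral_mult_left_zero[symmetric] Bochner_Integration.integral_sum
        Bochner_Integration.integrable_sum integrable_mult_left)
qed

text \<open>Only the coefficients \<open>D p q\<close> survive the contraction of \<^term>\<open>perp_coeff\<close> with the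
  fourth-order moment tensor of \<^term>\<open>row_proj\<close>.\<close>
lemma sum_perp_coeff_D:
  fixes \<Theta> :: "real^'k^'d"
  assumes equiv: "lin_equivariant G \<phi> \<psi> \<Theta>"
  defines "B \<equiv> transpose \<Theta> ** \<Theta>"
  defines "D \<equiv> \<lambda>p q. (if fst p = fst q then B $ snd p $ snd q else 0) +
     \<Theta> $ fst q $ snd p * \<Theta> $ fst p $ snd q"
  shows "(\<Sum>p\<in>UNIV. \<Sum>q\<in>UNIV. perp_coeff p q * D p q) =
     (real CARD('d) + 1) * (norm \<Theta>)\<^sup>2 - trace (J_G G lam \<phi> \<psi> ** B)"
proof -
  have Bsym: "B $ s $ v = B $ v $ s" for s v
    by (simp add: B_def matrix_matrix_mult_def transpose_def mult.commute)
  have Bdiag: "(\<Sum>s\<in>UNIV. B $ s $ s) = (norm \<Theta>)\<^sup>2"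
    unfolding B_def norm_matrix_power2
    by (simp add: matrix_matrix_mult_def transpose_def power2_eq_square sum.swap[of _ "UNIV :: 'k set"])
  have diag: "(\<Sum>p\<in>UNIV. D p p) = (real CARD('d) + 1) * (norm \<Theta>)\<^sup>2"
  proof -
    have "(\<Sum>r\<in>UNIV. \<Sum>s\<in>UNIV. \<Theta> $ r $ s * \<Theta> $ r $ s) = (norm \<Theta>)\<^sup>2"
      unfolding norm_matrix_power2 by (simp add: power2_eq_square)
    then show ?thesis
      by (simp add: D_def sum.distrib sum_pair_UNIV Bdiag algebra_simps)
  qed
  have "(\<Sum>p\<in>UNIV. \<Sum>q\<in>UNIV. avg_coeff p q * D p q) =
     (\<integral>g. (\<Sum>p\<in>UNIV. \<Sum>q\<in>UNIV. \<phi> g $ fst p $ fst q * \<psi> g $ snd p $ snd q * D p q) \<partial>lam)"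
    unfolding avg_coeff_def
    by (subst Bochner_Integration.integral_sum, intro Bochner_Integration.integrable_sum integrable_mult_left integrable_rep,
        subst Bochner_Integration.integral_sum, intro integrable_mult_left integrable_rep, simp)
  also have "\<dots> = (\<integral>g. trace ((trace (\<phi> g) *\<^sub>R \<psi> g + \<psi> g ** \<psi> g) ** B) \<partial>lam)"
  proof (rule Bochner_Integration.integral_cong[OF refl])
    fix g assume "g \<in> space lam"
    then have g: "g \<in> carrier G" by simp
    \<comment> \<open>The pairing of row indices with each other frees \<phi>(g) to contribute only
      its trace.\<close>
    have 1: "(\<Sum>p\<in>UNIV. \<Sum>q\<in>UNIV. \<phi> g $ fst p $ fst q * \<psi> g $ snd p $ snd q *
        (if fst p = fst q then B $ snd p $ snd q else 0)) = trace ((trace (\<phi> g) *\<^sub>R \<psi> g) ** B)"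
    proof -
      have "(\<Sum>p\<in>UNIV. \<Sum>q\<in>UNIV. \<phi> g $ fst p $ fst q * \<psi> g $ snd p $ snd q *
          (if fst p = fst q then B $ snd p $ snd q else 0)) =
        (\<Sum>r\<in>UNIV. \<Sum>s\<in>UNIV. \<Sum>u\<in>UNIV. if r = u then (\<Sum>v\<in>UNIV. \<phi> g $ r $ u * \<psi> g $ s $ v * B $ s $ v) else 0)"
        unfolding sum_pair_UNIV by (intro sum.cong refl) auto
      also have "\<dots> = (\<Sum>r\<in>UNIV. \<Sum>s\<in>UNIV. \<Sum>v\<in>UNIV. \<phi> g $ r $ r * \<psi> g $ s $ v * B $ s $ v)"
        by simp
      also have "\<dots> = trace (\<phi> g) * (\<Sum>s\<in>UNIV. \<Sum>v\<in>UNIV. \<psi> g $ s $ v * B $ s $ v)"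
        unfolding trace_def sum_distrib_right by (simp only: sum_distrib_left mult.assoc)
      also have "\<dots> = trace ((trace (\<phi> g) *\<^sub>R \<psi> g) ** B)"
        unfolding trace_mult_eq sum_distrib_left
        by (intro sum.cong refl) (simp add: Bsym mult.assoc)
      finally show ?thesis .
    qed
    \<comment> \<open>In the crossed pairing \<phi>(g) ends up between two copies of
      \<Theta>.\<close>
    have 2: "(\<Sum>p\<in>UNIV. \<Sum>q\<in>UNIV. \<phi> g $ fst p $ fst q * \<psi> g $ snd p $ snd q *
        (\<Theta> $ fst q $ snd p * \<Theta> $ fst p $ snd q)) = trace (\<psi> g ** \<psi> g ** B)"
    proof -
      have "(\<Sum>p\<in>UNIV. \<Sum>q\<in>UNIV. \<phi> g $ fst p $ fst q * \<psi> g $ snd p $ snd q *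
          (\<Theta> $ fst q $ snd p * \<Theta> $ fst p $ snd q)) =
        (\<Sum>r\<in>UNIV. \<Sum>s\<in>UNIV. \<Sum>u\<in>UNIV. \<Sum>v\<in>UNIV. \<psi> g $ s $ v * (\<Theta> $ r $ v * (\<phi> g $ r $ u * \<Theta> $ u $ s)))"
        unfolding sum_pair_UNIV by (intro sum.cong refl) (simp add: mult_ac)
      also have "\<dots> = (\<Sum>r\<in>UNIV. \<Sum>s\<in>UNIV. \<Sum>v\<in>UNIV. \<Sum>u\<in>UNIV. \<psi> g $ s $ v * (\<Theta> $ r $ v * (\<phi> g $ r $ u * \<Theta> $ u $ s)))"
        by (intro sum.cong refl sum.swap)
      also have "\<dots> = (\<Sum>s\<in>UNIV. \<Sum>r\<in>UNIV. \<Sum>v\<in>UNIV. \<Sum>u\<in>UNIV. \<psi> g $ s $ v * (\<Theta> $ r $ v * (\<phi> g $ r $ u * \<Theta> $ u $ s)))"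
        by (rule sum.swap)
      also have "\<dots> = (\<Sum>s\<in>UNIV. \<Sum>v\<in>UNIV. \<Sum>r\<in>UNIV. \<Sum>u\<in>UNIV. \<psi> g $ s $ v * (\<Theta> $ r $ v * (\<phi> g $ r $ u * \<Theta> $ u $ s)))"
        by (intro sum.cong refl sum.swap)
      also have "\<dots> = trace (\<psi> g ** (transpose \<Theta> ** (\<phi> g ** \<Theta>)))"
        unfolding trace_mult_eq
        by (simp add: matrix_matrix_mult_def transpose_def sum_distrib_left)
      \<comment> \<open>Equivariance moves \<phi>(g) through \<Theta> as a second factor \<psi>(g),
        which is how \<psi>(g^2) enters \<open>J_G\<close>.\<close>
      also have "transpose \<Theta> ** (\<phi> g ** \<Theta>) = \<psi> g ** B"
        using equiv g by (simp add: lin_equivariant_iff B_def matrix_mul_assoc)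
      finally show ?thesis by (simp add: matrix_mul_assoc)
    qed
    show "(\<Sum>p\<in>UNIV. \<Sum>q\<in>UNIV. \<phi> g $ fst p $ fst q * \<psi> g $ snd p $ snd q * D p q) =
        trace ((trace (\<phi> g) *\<^sub>R \<psi> g + \<psi> g ** \<psi> g) ** B)"
      unfolding D_def distrib_left sum.distrib 1 2
      by (simp add: trace_mult_eq distrib_right sum.distrib)
  qed
  also have "\<dots> = trace (J_G G lam \<phi> \<psi> ** B)" by (rule trace_J_G[symmetric])
  finally have "(\<Sum>p\<in>UNIV. \<Sum>q\<in>UNIV. avg_coeff p q * D p q) = trace (J_G G lam \<phi> \<psi> ** B)" .
  then show ?thesis
    using diag by (simp add: perp_coeff_def left_diff_distrib sum_subtractf
        if_distrib[of "\<lambda>x. x * _"] cong: if_cong)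
qed

text \<open>The squared norm is quadratic in the entries of P, so the moment tensor can be inserted.
  Its \<alpha> part contracts to the squared norm of \<open>perp \<Theta>\<close>, which is 0; the
  two \<beta> parts give the coefficients \<open>D\<close> of
  \<open>sum_perp_coeff_D\<close>.\<close>

lemma integral_norm_perp_row_proj:
  fixes \<Theta> :: "real^'k^'d"
  assumes \<sigma>: "\<sigma> > 0" and card: "CARD('n) < CARD('d)" and equiv: "lin_equivariant G \<phi> \<psi> \<Theta>"
  defines "n \<equiv> real CARD('n)" and "d \<equiv> real CARD('d)"
  shows "integrable (gauss \<sigma> :: (real^'d^'n) measure) (\<lambda>A. (norm (perp (row_proj A ** \<Theta>)))\<^sup>2)"
    and "(\<integral>A. (norm (perp (row_proj A ** \<Theta>)))\<^sup>2 \<partial>(gauss \<sigma> :: (real^'d^'n) measure)) =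
      n * (d - n) / (d * (d - 1) * (d + 2)) *
      ((d + 1) * (norm \<Theta>)\<^sup>2 - trace (J_G G lam \<phi> \<psi> ** (transpose \<Theta> ** \<Theta>)))"
proof -
  let ?G = "gauss \<sigma> :: (real^'d^'n) measure"
  define \<beta> where "\<beta> = n * (d - n) / (d * (d - 1) * (d + 2))"
  define \<alpha> where "\<alpha> = n / d - (d + 1) * \<beta>"
  note moments = integral_row_proj_mult[OF \<sigma> card, folded n_def d_def, folded \<beta>_def, folded \<alpha>_def]
  have expand: "(norm (perp (row_proj A ** \<Theta>)))\<^sup>2 = (\<Sum>p\<in>UNIV. \<Sum>q\<in>UNIV. \<Sum>a\<in>UNIV. \<Sum>b\<in>UNIV.
      perp_coeff p q * \<Theta> $ a $ snd p * \<Theta> $ b $ snd q * (row_proj A $ fst p $ a * row_proj A $ fst q $ b))"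
    for A :: "real^'d^'n"
    unfolding norm_perp_power2
    by (intro sum.cong refl) (simp add: matrix_matrix_mult_def sum_product sum_distrib_left mult_ac)
  show "integrable ?G (\<lambda>A. (norm (perp (row_proj A ** \<Theta>)))\<^sup>2)"
    unfolding expand by (intro Bochner_Integration.integrable_sum integrable_mult_right moments(1))
  have delta1: "(\<Sum>a\<in>UNIV. \<Sum>b\<in>UNIV. f a b * (if x = a \<and> y = b then 1 else 0)) = f x y"
    for f :: "'d \<Rightarrow> 'd \<Rightarrow> real" and x y
  proof -
    have "(\<Sum>a\<in>UNIV. \<Sum>b\<in>UNIV. f a b * (if x = a \<and> y = b then 1 else 0)) =
       (\<Sum>a\<in>UNIV. if x = a then (\<Sum>b\<in>UNIV. if y = b then f a b else 0) else 0)"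
      by (intro sum.cong refl) (auto simp: if_distrib[of "\<lambda>z. _ * z"] cong: if_cong)
    also have "\<dots> = f x y" by simp
    finally show ?thesis .
  qed
  have delta2: "(\<Sum>a\<in>UNIV. \<Sum>b\<in>UNIV. f a b * (if x = y \<and> a = b then 1 else 0)) = (if x = y then (\<Sum>a\<in>UNIV. f a a) else 0)"
    for f :: "'d \<Rightarrow> 'd \<Rightarrow> real" and x y :: 'd
    by (simp add: if_distrib[of "\<lambda>z. _ * z"] cong: if_cong)
  have delta3: "(\<Sum>a\<in>UNIV. \<Sum>b\<in>UNIV. f a b * (if x = b \<and> a = y then 1 else 0)) = f y x"
    for f :: "'d \<Rightarrow> 'd \<Rightarrow> real" and x y
  proof -
    have "(\<Sum>a\<in>UNIV. \<Sum>b\<in>UNIV. f a b * (if x = b \<and> a = y then 1 else 0)) =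
       (\<Sum>a\<in>UNIV. \<Sum>b\<in>UNIV. f a b * (if y = a \<and> x = b then 1 else 0))"
      by (intro sum.cong refl) auto
    then show ?thesis by (simp only: delta1)
  qed
  have "(\<integral>A. (norm (perp (row_proj A ** \<Theta>)))\<^sup>2 \<partial>?G) = (\<Sum>p\<in>UNIV. \<Sum>q\<in>UNIV. \<Sum>a\<in>UNIV. \<Sum>b\<in>UNIV.
      perp_coeff p q * \<Theta> $ a $ snd p * \<Theta> $ b $ snd q *
      (\<integral>A. row_proj A $ fst p $ a * row_proj A $ fst q $ b \<partial>?G))"
    unfolding expand
    by (simp only: Bochner_Integration.integral_sum Bochner_Integration.integrable_sum integrable_mult_right
        moments(1) integral_mult_right_zero)
  also have "\<dots> = (\<Sum>p\<in>UNIV. \<Sum>q\<in>UNIV. \<alpha> * (perp_coeff p q * \<Theta> $ fst p $ snd p * \<Theta> $ fst q $ snd q) +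
      \<beta> * (perp_coeff p q * ((if fst p = fst q then (transpose \<Theta> ** \<Theta>) $ snd p $ snd q else 0) +
        \<Theta> $ fst q $ snd p * \<Theta> $ fst p $ snd q)))"
  proof (intro sum.cong refl)
    fix p q :: "'d \<times> 'k"
    let ?f = "\<lambda>a b. perp_coeff p q * \<Theta> $ a $ snd p * \<Theta> $ b $ snd q"
    have "(\<Sum>a\<in>UNIV. \<Sum>b\<in>UNIV. ?f a b * (\<integral>A. row_proj A $ fst p $ a * row_proj A $ fst q $ b \<partial>?G)) =
      \<alpha> * (\<Sum>a\<in>UNIV. \<Sum>b\<in>UNIV. ?f a b * (if fst p = a \<and> fst q = b then 1 else 0)) +
      \<beta> * ((\<Sum>a\<in>UNIV. \<Sum>b\<in>UNIV. ?f a b * (if fst p = fst q \<and> a = b then 1 else 0)) +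
        (\<Sum>a\<in>UNIV. \<Sum>b\<in>UNIV. ?f a b * (if fst p = b \<and> a = fst q then 1 else 0)))"
      unfolding moments(2) sum_distrib_left distrib_left sum.distrib
      by (simp only: mult_ac)
    also have "\<dots> = \<alpha> * (perp_coeff p q * \<Theta> $ fst p $ snd p * \<Theta> $ fst q $ snd q) +
      \<beta> * (perp_coeff p q * ((if fst p = fst q then (transpose \<Theta> ** \<Theta>) $ snd p $ snd q else 0) +
        \<Theta> $ fst q $ snd p * \<Theta> $ fst p $ snd q))"
      unfolding delta1 delta2 delta3
      by (auto simp: matrix_matrix_mult_def transpose_def sum_distrib_left distrib_left mult.assoc)
    finally show "(\<Sum>a\<in>UNIV. \<Sum>b\<in>UNIV. ?f a b * (\<integral>A. row_proj A $ fst p $ a * row_proj A $ fst q $ b \<partial>?G)) =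
      \<alpha> * (perp_coeff p q * \<Theta> $ fst p $ snd p * \<Theta> $ fst q $ snd q) +
      \<beta> * (perp_coeff p q * ((if fst p = fst q then (transpose \<Theta> ** \<Theta>) $ snd p $ snd q else 0) +
        \<Theta> $ fst q $ snd p * \<Theta> $ fst p $ snd q))" .
  qed
  also have "\<dots> = \<alpha> * (norm (perp \<Theta>))\<^sup>2 +
     \<beta> * ((d + 1) * (norm \<Theta>)\<^sup>2 - trace (J_G G lam \<phi> \<psi> ** (transpose \<Theta> ** \<Theta>)))"
    unfolding norm_perp_power2 sum_perp_coeff_D[OF equiv, symmetric] d_def
    by (simp only: sum.distrib sum_distrib_left)
  also have "perp \<Theta> = 0" using orbit_avg_fixed[OF equiv] by (simp add: perp_eq)
  finally show "(\<integral>A. (norm (perp (row_proj A ** \<Theta>)))\<^sup>2 \<partial>?G) = n * (d - n) / (d * (d - 1) * (d + 2)) *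
      ((d + 1) * (norm \<Theta>)\<^sup>2 - trace (J_G G lam \<phi> \<psi> ** (transpose \<Theta> ** \<Theta>)))"
    by (simp add: \<beta>_def)
qed

end

subsection \<open>The Gaussian regression model\<close>

lemma measure_eqI_box:
  fixes M N :: "'a::euclidean_space measure"
  assumes "finite_measure M" "sets M = sets borel" "sets N = sets borel"
    and eq: "\<And>a b. emeasure M (box a b) = emeasure N (box a b)"
  shows "M = N"
proof (rule measure_eqI_generator_eq)
  interpret finite_measure M by fact
  let ?E = "range (\<lambda>(a, b). box a b::'a set)"
  show "Int_stable ?E"
    by (auto simp: Int_stable_def box_Int_box)
  show "?E \<subseteq> Pow UNIV" "sets M = sigma_sets UNIV ?E" "sets N = sigma_sets UNIV ?E"
    by (simp_all add: borel_eq_box assms(2,3))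
  let ?A = "\<lambda>n::nat. box (- (real n *\<^sub>R One)) (real n *\<^sub>R One) :: 'a set"
  show "range ?A \<subseteq> ?E" "(\<Union>i. ?A i) = UNIV"
    unfolding UN_box_eq_UNIV by auto
  show "emeasure M (?A i) \<noteq> \<infinity>" for i by simp
  show "emeasure M X = emeasure N X" if "X \<in> ?E" for X
    using that eq by auto
qed

lemma prod_Basis_vec:
  fixes f :: "('a::euclidean_space)^'n \<Rightarrow> 'c::comm_monoid_mult"
  shows "(\<Prod>b\<in>Basis. f b) = (\<Prod>i\<in>UNIV. \<Prod>u\<in>Basis. f (axis i u))"
proof -
  have B: "Basis = (\<lambda>(i, u). axis i u :: 'a^'n) ` (UNIV \<times> Basis)"
    by (auto simp: Basis_vec_def)
  have "inj_on (\<lambda>(i, u). axis i u :: 'a^'n) (UNIV \<times> Basis)"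
    by (auto simp: inj_on_def axis_eq_axis)
  then show ?thesis
    unfolding B by (simp add: prod.reindex prod.cartesian_product split_beta')
qed

lemma mem_box_vec:
  fixes A :: "('a::euclidean_space)^'n"
  shows "A \<in> box a b \<longleftrightarrow> (\<forall>i. A $ i \<in> box (a $ i) (b $ i))"
  by (auto simp: mem_box Basis_vec_def inner_axis)

lemma box_Pair: "box (a, c) (b, d) = box a b \<times> box c d"
  by (auto simp: mem_box Basis_prod_def ball_Un)

lemma emeasure_gauss_box:
  fixes a b :: "'a::euclidean_space"
  shows "emeasure (gauss \<sigma>) (box a b) =
    (\<Prod>u\<in>Basis. \<integral>\<^sup>+t. ennreal (normal_density 0 \<sigma> t) * indicator {a \<bullet> u<..<b \<bullet> u} t \<partial>lborel)"
proof -
  have "indicator (box a b) x = (\<Prod>u\<in>Basis. indicator {a \<bullet> u<..<b \<bullet> u} (x \<bullet> u) :: ennreal)" for x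
  proof (cases "x \<in> box a b")
    case False
    then obtain u where "u \<in> Basis" "x \<bullet> u \<notin> {a \<bullet> u<..<b \<bullet> u}" by (auto simp: mem_box)
    then have "(\<Prod>u\<in>Basis. indicator {a \<bullet> u<..<b \<bullet> u} (x \<bullet> u) :: ennreal) = 0"
      by (intro prod_zero bexI[of _ u]) auto
    with False show ?thesis by simp
  qed (auto simp: mem_box intro!: prod.neutral[symmetric])
  then have ind: "indicator (box a b) = (\<lambda>x. \<Prod>u\<in>Basis. indicator {a \<bullet> u<..<b \<bullet> u} (x \<bullet> u) :: ennreal)" by auto
  have "emeasure (gauss \<sigma>) (box a b) = (\<integral>\<^sup>+x. indicator (box a b) x \<partial>gauss \<sigma>)" by simp
  also have "\<dots> = (\<integral>\<^sup>+x. (\<Prod>u\<in>Basis. indicator {a \<bullet> u<..<b \<bullet> u} (x \<bullet> u)) \<partial>gauss \<sigma>)"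
    unfolding ind ..
  also have "\<dots> = (\<Prod>u\<in>Basis. \<integral>\<^sup>+t. ennreal (normal_density 0 \<sigma> t) * indicator {a \<bullet> u<..<b \<bullet> u} t \<partial>lborel)"
    by (rule nn_integral_gauss_prod) measurable
  finally show ?thesis .
qed

lemma emeasure_gauss_box_vec:
  fixes a b :: "('a::euclidean_space)^'n"
  shows "emeasure (gauss \<sigma>) (box a b) = (\<Prod>i\<in>UNIV. emeasure (gauss \<sigma>) (box (a $ i) (b $ i)))"
  unfolding emeasure_gauss_box prod_Basis_vec by (simp add: inner_axis)

lemma iso_gauss_density_eq: "density lborel (iso_gauss_density \<sigma>) = (gauss \<sigma> :: (real^'d) measure)"
  unfolding gauss_def iso_gauss_density_def prod_Basis_vec by (simp add: inner_axis)

text \<open>Turning the direction of \<open>c\<close> into a basis vector leaves a one-dimensional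
  second moment.\<close>

lemma nn_integral_gauss_inner_power2:
  fixes c :: "'a::euclidean_space"
  assumes \<sigma>: "\<sigma> > 0"
  shows "(\<integral>\<^sup>+x. ennreal ((x \<bullet> c)\<^sup>2) \<partial>gauss \<sigma>) = ennreal (\<sigma>\<^sup>2 * (norm c)\<^sup>2)"
proof (cases "c = 0")
  case False
  define u where "u = c /\<^sub>R norm c"
  have u: "norm u = 1" "c = norm c *\<^sub>R u" using False by (auto simp: u_def)
  obtain T :: "'a \<Rightarrow> 'a" and B where T: "linear T" "\<And>x. norm (T x) = norm x" "surj T"
    and B: "B \<subseteq> Basis" "card B = card {u}" "\<And>x. (\<Sum>v\<in>{u}. (x \<bullet> v)\<^sup>2) = (\<Sum>b\<in>B. (T x \<bullet> b)\<^sup>2)"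
    by (rule orthonormal_set_isometry_Basis[of "{u}"]) (use u(1) in \<open>auto simp: pairwise_def\<close>)
  from B(2) obtain b where b: "B = {b}" by (auto simp: card_1_singleton_iff)
  have "(\<integral>\<^sup>+x. ennreal ((x \<bullet> u)\<^sup>2) \<partial>gauss \<sigma>) = (\<integral>\<^sup>+x. ennreal ((T x \<bullet> b)\<^sup>2) \<partial>gauss \<sigma>)"
    using B(3) by (simp add: b)
  also have "\<dots> = (\<integral>\<^sup>+x. ennreal ((x \<bullet> b)\<^sup>2) \<partial>gauss \<sigma>)"
    by (rule nn_integral_gauss_isometry[OF T]) measurable
  also have "\<dots> = (\<integral>\<^sup>+x. (\<Prod>b'\<in>Basis. (if b' = b then ennreal ((x \<bullet> b')\<^sup>2) else 1)) \<partial>gauss \<sigma>)"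
    using B(1) b by (simp add: prod.delta)
  also have "\<dots> = (\<Prod>b'\<in>(Basis :: 'a set). \<integral>\<^sup>+t. ennreal (normal_density 0 \<sigma> t) * (if b' = b then ennreal (t\<^sup>2) else 1) \<partial>lborel)"
    by (rule nn_integral_gauss_prod[where f="\<lambda>b' t. if b' = b then ennreal (t\<^sup>2) else 1"]) simp
  also have "\<dots> = (\<Prod>b'\<in>(Basis :: 'a set). if b' = b then ennreal (\<sigma>\<^sup>2) else 1)"
  proof (rule prod.cong[OF refl])
    fix b' :: 'a
    have "(\<integral>\<^sup>+t. ennreal (normal_density 0 \<sigma> t) * ennreal (t\<^sup>2) \<partial>lborel) =
       (\<integral>\<^sup>+t. ennreal (normal_density 0 \<sigma> t * (t - 0)^(2 * 1)) \<partial>lborel)"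
      by (simp add: ennreal_mult)
    also have "\<dots> = ennreal (\<integral>t. normal_density 0 \<sigma> t * (t - 0)^(2 * 1) \<partial>lborel)"
      using \<sigma> by (intro nn_integral_eq_integral integrable_normal_moment) auto
    also have "\<dots> = ennreal (\<sigma>\<^sup>2)"
      unfolding integral_normal_moment_even[OF \<sigma>] by simp
    finally show "(\<integral>\<^sup>+t. ennreal (normal_density 0 \<sigma> t) * (if b' = b then ennreal (t\<^sup>2) else 1) \<partial>lborel) =
       (if b' = b then ennreal (\<sigma>\<^sup>2) else 1)"
      using nn_integral_normal_density[OF \<sigma>] by auto
  qed
  also have "\<dots> = ennreal (\<sigma>\<^sup>2)" using B(1) b by (simp add: prod.delta)
  finally have 1: "(\<integral>\<^sup>+x. ennreal ((x \<bullet> u)\<^sup>2) \<partial>gauss \<sigma>) = ennreal (\<sigma>\<^sup>2)" .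
  have "(\<integral>\<^sup>+x. ennreal ((x \<bullet> c)\<^sup>2) \<partial>gauss \<sigma>) = (\<integral>\<^sup>+x. ennreal ((norm c)\<^sup>2) * ennreal ((x \<bullet> u)\<^sup>2) \<partial>gauss \<sigma>)"
    by (subst u(2)) (simp add: power_mult_distrib ennreal_mult)
  also have "\<dots> = ennreal (\<sigma>\<^sup>2 * (norm c)\<^sup>2)"
    by (subst nn_integral_cmult) (auto simp: 1 ennreal_mult mult.commute)
  finally show ?thesis .
qed simp

text \<open>The index \<open>None\<close> denotes the test pair at which risks are taken,
  \<open>Some i\<close> the training pairs; one family over an option type expresses that all of
  them are independent and identically distributed.\<close>

locale gauss_regression = prob_space M
  for M :: "'m measure" +
  fixes X :: "'n::finite option \<Rightarrow> 'm \<Rightarrow> real^'d" and \<xi> :: "'n option \<Rightarrow> 'm \<Rightarrow> real^'k"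
    and \<sigma>X \<sigma>\<xi> :: real
  assumes sX: "\<sigma>X > 0"
    and X_gauss: "\<And>i. distributed M lborel (X i) (iso_gauss_density \<sigma>X)"
    and xi_meas: "\<And>i. \<xi> i \<in> borel_measurable M"
    and xi_ident: "\<And>i. distr M borel (\<xi> i) = distr M borel (\<xi> None)"
    and xi_mean: "\<And>a. integrable M (\<lambda>\<omega>. \<xi> None \<omega> $ a) \<and> (\<integral>\<omega>. \<xi> None \<omega> $ a \<partial>M) = 0"
    and xi_cov: "\<And>a b. integrable M (\<lambda>\<omega>. \<xi> None \<omega> $ a * \<xi> None \<omega> $ b) \<and>
                   (\<integral>\<omega>. \<xi> None \<omega> $ a * \<xi> None \<omega> $ b \<partial>M) = (if a = b then \<sigma>\<xi>^2 else 0)"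
    and indep_pairs: "indep_vars (\<lambda>_. borel) (\<lambda>i \<omega>. (X i \<omega>, \<xi> i \<omega>)) UNIV"
    and indep_X_xi: "\<And>i. distr M (borel \<Otimes>\<^sub>M borel) (\<lambda>\<omega>. (X i \<omega>, \<xi> i \<omega>)) =
                         distr M borel (X i) \<Otimes>\<^sub>M distr M borel (\<xi> i)"
begin

lemma X_meas [measurable]: "X i \<in> borel_measurable M"
  using distributed_measurable[OF X_gauss[of i]] by simp

lemmas [measurable] = xi_meas

lemma distr_X: "distr M borel (X i) = gauss \<sigma>X"
proof -
  have "distr M borel (X i) = distr M lborel (X i)" by (rule distr_cong) auto
  also have "\<dots> = gauss \<sigma>X"
    using distributed_distr_eq_density[OF X_gauss[of i]] by (simp add: iso_gauss_density_eq)
  finally show ?thesis .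
qed

lemma xi_moments:
  "integrable M (\<lambda>\<omega>. \<xi> i \<omega> $ a)" "(\<integral>\<omega>. \<xi> i \<omega> $ a \<partial>M) = 0"
  "integrable M (\<lambda>\<omega>. \<xi> i \<omega> $ a * \<xi> i \<omega> $ b)"
  "(\<integral>\<omega>. \<xi> i \<omega> $ a * \<xi> i \<omega> $ b \<partial>M) = (if a = b then \<sigma>\<xi>\<^sup>2 else 0)"
proof -
  have int: "integrable M (\<lambda>\<omega>. f (\<xi> i \<omega>)) \<longleftrightarrow> integrable M (\<lambda>\<omega>. f (\<xi> None \<omega>))"
    and eq: "(\<integral>\<omega>. f (\<xi> i \<omega>) \<partial>M) = (\<integral>\<omega>. f (\<xi> None \<omega>) \<partial>M)"
    if [measurable]: "f \<in> borel_measurable borel" for f :: "real^'k \<Rightarrow> real"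
  proof -
    show "integrable M (\<lambda>\<omega>. f (\<xi> i \<omega>)) \<longleftrightarrow> integrable M (\<lambda>\<omega>. f (\<xi> None \<omega>))"
      using integrable_distr_eq[OF xi_meas that, of i] integrable_distr_eq[OF xi_meas that, of None]
      by (simp add: xi_ident[of i])
    show "(\<integral>\<omega>. f (\<xi> i \<omega>) \<partial>M) = (\<integral>\<omega>. f (\<xi> None \<omega>) \<partial>M)"
      using integral_distr[OF xi_meas that, of i] integral_distr[OF xi_meas that, of None]
      by (simp add: xi_ident[of i])
  qed
  show "integrable M (\<lambda>\<omega>. \<xi> i \<omega> $ a)" "(\<integral>\<omega>. \<xi> i \<omega> $ a \<partial>M) = 0"
    using int[of "\<lambda>x. x $ a"] eq[of "\<lambda>x. x $ a"] xi_mean[of a] by auto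
  show "integrable M (\<lambda>\<omega>. \<xi> i \<omega> $ a * \<xi> i \<omega> $ b)"
    "(\<integral>\<omega>. \<xi> i \<omega> $ a * \<xi> i \<omega> $ b \<partial>M) = (if a = b then \<sigma>\<xi>\<^sup>2 else 0)"
    using int[of "\<lambda>x. x $ a * x $ b"] eq[of "\<lambda>x. x $ a * x $ b"] xi_cov[of a b] by auto
qed

text \<open>For distinct indices the pairs are independent, hence so are their noise components, and
  the mean of the product is a product of zero means.\<close>

lemma xi_cross_moments:
  "integrable M (\<lambda>\<omega>. \<xi> i \<omega> $ a * \<xi> j \<omega> $ b)"
  "(\<integral>\<omega>. \<xi> i \<omega> $ a * \<xi> j \<omega> $ b \<partial>M) = (if i = j \<and> a = b then \<sigma>\<xi>\<^sup>2 else 0)"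
proof -
  have "integrable M (\<lambda>\<omega>. \<xi> i \<omega> $ a * \<xi> j \<omega> $ b) \<and>
    (\<integral>\<omega>. \<xi> i \<omega> $ a * \<xi> j \<omega> $ b \<partial>M) = (if i = j \<and> a = b then \<sigma>\<xi>\<^sup>2 else 0)"
  proof (cases "i = j")
    case False
    define f where "f l \<omega> = \<xi> l \<omega> $ (if l = i then a else b)" for l \<omega>
    have "indep_vars (\<lambda>_. borel) (\<lambda>l \<omega>. (\<lambda>z. snd z $ (if l = i then a else b)) (X l \<omega>, \<xi> l \<omega>)) UNIV"
      by (rule indep_vars_compose2[OF indep_pairs])
         (intro borel_measurable_continuous_onI continuous_intros)
    then have "indep_vars (\<lambda>_. borel) f {i, j}"
      unfolding f_def snd_conv by (rule indep_vars_subset) simp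
    moreover have "integrable M (f l)" for l
      unfolding f_def by (rule xi_moments)
    ultimately have "integrable M (\<lambda>\<omega>. \<Prod>l\<in>{i, j}. f l \<omega>)"
      "(\<integral>\<omega>. (\<Prod>l\<in>{i, j}. f l \<omega>) \<partial>M) = (\<Prod>l\<in>{i, j}. \<integral>\<omega>. f l \<omega> \<partial>M)"
      by (auto intro!: indep_vars_integrable indep_vars_lebesgue_integral)
    then show ?thesis using False by (simp add: f_def xi_moments)
  qed (simp add: xi_moments)
  then show "integrable M (\<lambda>\<omega>. \<xi> i \<omega> $ a * \<xi> j \<omega> $ b)"
    "(\<integral>\<omega>. \<xi> i \<omega> $ a * \<xi> j \<omega> $ b \<partial>M) = (if i = j \<and> a = b then \<sigma>\<xi>\<^sup>2 else 0)" by auto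
qed

text \<open>\<^const>\<open>indep_var\<close> forces both variables to have the same type, hence the coordinates.\<close>
lemma indep_var_X_xi: "indep_var borel (\<lambda>\<omega>. X i \<omega> \<bullet> c) borel (\<lambda>\<omega>. \<xi> i \<omega> $ a)"
proof -
  interpret D: prob_space "distr (distr M borel (\<xi> i)) borel (\<lambda>y. y $ a)"
    by (intro prob_space.prob_space_distr[OF prob_space_distr]) auto
  have "distr M borel (\<lambda>\<omega>. X i \<omega> \<bullet> c) \<Otimes>\<^sub>M distr M borel (\<lambda>\<omega>. \<xi> i \<omega> $ a) =
    distr (distr M borel (X i)) borel (\<lambda>x. x \<bullet> c) \<Otimes>\<^sub>M distr (distr M borel (\<xi> i)) borel (\<lambda>y. y $ a)"
    by (simp add: distr_distr comp_def)
  also have "\<dots> = distr (distr M borel (X i) \<Otimes>\<^sub>M distr M borel (\<xi> i)) (borel \<Otimes>\<^sub>M borel) (\<lambda>(x, y). (x \<bullet> c, y $ a))"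
    by (rule pair_measure_distr) (auto intro: D.sigma_finite_measure_axioms)
  also have "\<dots> = distr M (borel \<Otimes>\<^sub>M borel) (\<lambda>\<omega>. (X i \<omega> \<bullet> c, \<xi> i \<omega> $ a))"
    unfolding indep_X_xi[symmetric] by (simp add: distr_distr comp_def)
  finally show ?thesis
    unfolding indep_var_distribution_eq by simp
qed

text \<open>The error is (W - \<Theta>)^T X - \<xi>. Isotropy of X turns its first part into a
  Frobenius norm, the cross terms vanish by independence and zero mean, and the last summand is the
  irreducible noise. \<open>W\<close> is a constant here; the theorem inserts the estimate outcome
  by outcome.\<close>

lemma risk_linpred:
  fixes W \<Theta> :: "real^'k^'d"
  shows "risk M (X i) (\<lambda>\<omega>. linpred \<Theta> (X i \<omega>) + \<xi> i \<omega>) (linpred W) =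
    \<sigma>X\<^sup>2 * (norm (W - \<Theta>))\<^sup>2 + real CARD('k) * \<sigma>\<xi>\<^sup>2"
proof -
  define c where "c a = (\<chi> r. (W - \<Theta>) $ r $ a)" for a
  have nn: "(\<integral>\<^sup>+\<omega>. ennreal ((X i \<omega> \<bullet> c a)\<^sup>2) \<partial>M) = ennreal (\<sigma>X\<^sup>2 * (norm (c a))\<^sup>2)" for a
    using nn_integral_gauss_inner_power2[OF sX, of "c a"]
    unfolding distr_X[of i, symmetric] by (subst (asm) nn_integral_distr) auto
  have int_sq: "integrable M (\<lambda>\<omega>. (X i \<omega> \<bullet> c a)\<^sup>2)" for a
    by (rule integrableI_nonneg) (auto simp: nn)
  have sq: "(\<integral>\<omega>. (X i \<omega> \<bullet> c a)\<^sup>2 \<partial>M) = \<sigma>X\<^sup>2 * (norm (c a))\<^sup>2" for a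
    using nn[of a] by (subst integral_eq_nn_integral) auto
  have int_X: "integrable M (\<lambda>\<omega>. X i \<omega> \<bullet> c a)" for a
    by (rule square_integrable_imp_integrable[OF _ int_sq]) simp
  have indep: "indep_var borel (\<lambda>\<omega>. X i \<omega> \<bullet> c a) borel (\<lambda>\<omega>. \<xi> i \<omega> $ a)" for a
    by (rule indep_var_X_xi)
  have int_cross: "integrable M (\<lambda>\<omega>. (X i \<omega> \<bullet> c a) * \<xi> i \<omega> $ a)"
    and cross: "(\<integral>\<omega>. (X i \<omega> \<bullet> c a) * \<xi> i \<omega> $ a \<partial>M) = 0" for a
    using indep_var_integrable[OF indep int_X xi_moments(1)]
      indep_var_lebesgue_integral[OF indep int_X xi_moments(1)] by (auto simp: xi_moments)
  have comp: "(linpred W (X i \<omega>) - (linpred \<Theta> (X i \<omega>) + \<xi> i \<omega>)) $ a = X i \<omega> \<bullet> c a - \<xi> i \<omega> $ a" for \<omega> a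
    by (simp add: linpred_def c_def matrix_vector_mult_def transpose_def inner_vec_def
        vector_matrix_mult_def algebra_simps sum_subtractf)
  have norm2: "(norm x)\<^sup>2 = (\<Sum>a\<in>UNIV. (x $ a)\<^sup>2)" for x :: "real^'k"
    by (simp add: norm_vec_def L2_set_def sum_nonneg)
  have "risk M (X i) (\<lambda>\<omega>. linpred \<Theta> (X i \<omega>) + \<xi> i \<omega>) (linpred W) =
    (\<integral>\<omega>. (\<Sum>a\<in>UNIV. (X i \<omega> \<bullet> c a)\<^sup>2 - 2 * ((X i \<omega> \<bullet> c a) * \<xi> i \<omega> $ a) + \<xi> i \<omega> $ a * \<xi> i \<omega> $ a) \<partial>M)"
    unfolding risk_def norm2 comp
    by (intro Bochner_Integration.integral_cong sum.cong refl) (simp add: power2_eq_square algebra_simps)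
  also have "\<dots> = (\<Sum>a\<in>UNIV. \<sigma>X\<^sup>2 * (norm (c a))\<^sup>2 + \<sigma>\<xi>\<^sup>2)"
    by (subst Bochner_Integration.integral_sum)
       (auto intro!: Bochner_Integration.integrable_add Bochner_Integration.integrable_diff
          integrable_mult_right int_sq int_cross xi_moments
        simp: int_sq int_cross xi_moments sq cross)
  also have "\<dots> = \<sigma>X\<^sup>2 * (\<Sum>a\<in>UNIV. (norm (c a))\<^sup>2) + real CARD('k) * \<sigma>\<xi>\<^sup>2"
    by (simp add: sum.distrib sum_distrib_left)
  also have "(\<Sum>a\<in>UNIV. (norm (c a))\<^sup>2) = (norm (W - \<Theta>))\<^sup>2"
    unfolding norm_matrix_power2
    by (simp add: c_def norm_vec_def L2_set_def sum_nonneg sum.swap[of _ "UNIV :: 'k set"])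
  finally show ?thesis .
qed

section \<open>The joint law of design and noise\<close>

definition design :: "'m \<Rightarrow> real^'d^'n" where
  "design \<omega> = data_matrix (\<lambda>i. X (Some i) \<omega>)"

definition noise :: "'m \<Rightarrow> real^'k^'n" where
  "noise \<omega> = data_matrix (\<lambda>i. \<xi> (Some i) \<omega>)"

lemma design_nth [simp]: "design \<omega> $ i = X (Some i) \<omega>"
  and noise_nth [simp]: "noise \<omega> $ i = \<xi> (Some i) \<omega>"
  by (simp_all add: design_def noise_def data_matrix_def)

lemma design_meas [measurable]: "design \<in> borel_measurable M"
  and noise_meas [measurable]: "noise \<in> borel_measurable M"
  by (rule borel_measurable_vecI, simp)+

text \<open>Both kinds of independence are combined: across the training indices, and between input
  and noise inside each pair. Regrouping the factors separates all inputs from all noise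
  vectors.\<close>

lemma prob_rectangle:
  assumes [measurable]: "\<And>i. E i \<in> sets borel" "\<And>i. F i \<in> sets borel"
  shows "prob {\<omega>\<in>space M. \<forall>i. X (Some i) \<omega> \<in> E i \<and> \<xi> (Some i) \<omega> \<in> F i} =
    (\<Prod>i\<in>UNIV. measure (gauss \<sigma>X) (E i)) * (\<Prod>i\<in>UNIV. prob {\<omega>\<in>space M. \<xi> (Some i) \<omega> \<in> F i})"
proof -
  define Z where "Z i \<omega> = (X i \<omega>, \<xi> i \<omega>)" for i \<omega>
  define S where "S i = E (the i) \<times> F (the i)" for i
  have S: "S i \<in> sets borel" for i
    unfolding S_def borel_prod[symmetric] by (intro pair_measureI) auto
  have marg: "prob (Z (Some i) -` S (Some i) \<inter> space M) =
     measure (gauss \<sigma>X) (E i) * prob {\<omega>\<in>space M. \<xi> (Some i) \<omega> \<in> F i}" for i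
  proof -
    interpret D: prob_space "distr M borel (\<xi> (Some i))" by (rule prob_space_distr) simp
    have "prob (Z (Some i) -` S (Some i) \<inter> space M) =
      measure (distr M (borel \<Otimes>\<^sub>M borel) (\<lambda>\<omega>. (X (Some i) \<omega>, \<xi> (Some i) \<omega>))) (E i \<times> F i)"
      by (subst measure_distr) (auto simp: Z_def[abs_def] S_def)
    also have "\<dots> = measure (gauss \<sigma>X) (E i) * measure (distr M borel (\<xi> (Some i))) (F i)"
      unfolding indep_X_xi distr_X by (simp add: measure_def D.emeasure_pair_measure_Times enn2real_mult)
    also have "measure (distr M borel (\<xi> (Some i))) (F i) = prob {\<omega>\<in>space M. \<xi> (Some i) \<omega> \<in> F i}"
      by (subst measure_distr) (auto intro!: arg_cong[where f=prob])
    finally show ?thesis .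
  qed
  have "{\<omega>\<in>space M. \<forall>i. X (Some i) \<omega> \<in> E i \<and> \<xi> (Some i) \<omega> \<in> F i} =
     (\<Inter>i\<in>range Some. Z i -` S i \<inter> space M)"
    by (auto simp: Z_def S_def)
  also have "prob \<dots> = (\<Prod>i\<in>range Some. prob (Z i -` S i \<inter> space M))"
    using S by (intro indep_varsD[OF indep_pairs[folded Z_def]]) auto
  also have "\<dots> = (\<Prod>i\<in>UNIV. prob (Z (Some i) -` S (Some i) \<inter> space M))"
    by (simp add: prod.reindex)
  also have "\<dots> = (\<Prod>i\<in>UNIV. measure (gauss \<sigma>X) (E i)) * (\<Prod>i\<in>UNIV. prob {\<omega>\<in>space M. \<xi> (Some i) \<omega> \<in> F i})"
    by (simp add: marg prod.distrib)
  finally show ?thesis .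
qed

text \<open>It suffices to compare both laws on boxes, which are rectangles in the rows of the two
  matrices. The design is thereby Gaussian as a whole, while the law of the noise stays
  unspecified.\<close>

lemma distr_design_noise:
  "distr M borel (\<lambda>\<omega>. (design \<omega>, noise \<omega>)) = gauss \<sigma>X \<Otimes>\<^sub>M distr M borel noise"
proof (rule measure_eqI_box)
  interpret GX: prob_space "gauss \<sigma>X :: (real^'d) measure" by (rule prob_space_gauss[OF sX])
  interpret GA: prob_space "gauss \<sigma>X :: (real^'d^'n) measure" by (rule prob_space_gauss[OF sX])
  interpret D: prob_space "distr M borel noise" by (rule prob_space_distr) simp
  interpret P: prob_space "distr M borel (\<lambda>\<omega>. (design \<omega>, noise \<omega>))"
    by (rule prob_space_distr) (simp add: borel_prod[symmetric])
  show "finite_measure (distr M borel (\<lambda>\<omega>. (design \<omega>, noise \<omega>)))" by (rule P.finite_measure_axioms)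
  show "sets (gauss \<sigma>X \<Otimes>\<^sub>M distr M borel noise) = sets (borel :: ((real^'d^'n) \<times> (real^'k^'n)) measure)"
    unfolding borel_prod[symmetric] by (intro sets_pair_measure_cong) auto
  fix a b :: "(real^'d^'n) \<times> (real^'k^'n)"
  obtain a1 a2 b1 b2 where ab: "a = (a1, a2)" "b = (b1, b2)" by fastforce
  let ?E = "\<lambda>i. box (a1 $ i) (b1 $ i)" and ?F = "\<lambda>i. box (a2 $ i) (b2 $ i)"
  have "emeasure (distr M borel (\<lambda>\<omega>. (design \<omega>, noise \<omega>))) (box a b) =
    emeasure M {\<omega>\<in>space M. \<forall>i. X (Some i) \<omega> \<in> ?E i \<and> \<xi> (Some i) \<omega> \<in> ?F i}"
    unfolding ab box_Pair
    by (subst emeasure_distr)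
       (auto simp: borel_prod[symmetric] mem_box_vec intro!: arg_cong[where f="emeasure M"] pair_measureI)
  also have "\<dots> = ennreal ((\<Prod>i\<in>UNIV. measure (gauss \<sigma>X) (?E i)) * (\<Prod>i\<in>UNIV. prob {\<omega>\<in>space M. \<xi> (Some i) \<omega> \<in> ?F i}))"
    unfolding emeasure_eq_measure by (subst prob_rectangle) auto
  also have "\<dots> = emeasure (gauss \<sigma>X) (box a1 b1) * emeasure (distr M borel noise) (box a2 b2)"
  proof -
    \<comment> \<open>The noise marginal is the special case in which every input may lie
      anywhere.\<close>
    have "emeasure (distr M borel noise) (box a2 b2) =
      emeasure M {\<omega>\<in>space M. \<forall>i. X (Some i) \<omega> \<in> UNIV \<and> \<xi> (Some i) \<omega> \<in> ?F i}"
      by (subst emeasure_distr) (auto simp: mem_box_vec intro!: arg_cong[where f="emeasure M"])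
    also have "\<dots> = ennreal (\<Prod>i\<in>UNIV. prob {\<omega>\<in>space M. \<xi> (Some i) \<omega> \<in> ?F i})"
      unfolding emeasure_eq_measure using GX.prob_space by (subst prob_rectangle) auto
    finally show ?thesis
      unfolding emeasure_gauss_box_vec[of _ a1]
      by (simp add: GX.emeasure_eq_measure prod_ennreal ennreal_mult prod_nonneg)
  qed
  also have "\<dots> = emeasure (gauss \<sigma>X \<Otimes>\<^sub>M distr M borel noise) (box a b)"
    unfolding ab box_Pair by (subst D.emeasure_pair_measure_Times) auto
  finally show "emeasure (distr M borel (\<lambda>\<omega>. (design \<omega>, noise \<omega>))) (box a b) =
    emeasure (gauss \<sigma>X \<Otimes>\<^sub>M distr M borel noise) (box a b)" .
qed simp

lemma nn_integral_design_noise: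
  assumes "f \<in> borel_measurable (borel \<Otimes>\<^sub>M borel)"
  shows "(\<integral>\<^sup>+\<omega>. f (design \<omega>, noise \<omega>) \<partial>M) =
    (\<integral>\<^sup>+A. \<integral>\<^sup>+\<omega>. f (A, noise \<omega>) \<partial>M \<partial>gauss \<sigma>X)"
proof -
  interpret D: prob_space "distr M borel noise" by (rule prob_space_distr) simp
  have f [measurable]: "f \<in> borel_measurable (gauss \<sigma>X \<Otimes>\<^sub>M distr M borel noise)"
    using assms by simp
  have "(\<integral>\<^sup>+\<omega>. f (design \<omega>, noise \<omega>) \<partial>M) = (\<integral>\<^sup>+z. f z \<partial>distr M borel (\<lambda>\<omega>. (design \<omega>, noise \<omega>)))"
    using assms by (subst nn_integral_distr) (auto simp: borel_prod[symmetric])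
  also have "\<dots> = (\<integral>\<^sup>+A. \<integral>\<^sup>+N. f (A, N) \<partial>distr M borel noise \<partial>gauss \<sigma>X)"
    unfolding distr_design_noise by (rule D.nn_integral_fst[symmetric]) (rule f)
  also have "\<dots> = (\<integral>\<^sup>+A. \<integral>\<^sup>+\<omega>. f (A, noise \<omega>) \<partial>M \<partial>gauss \<sigma>X)"
    using assms by (intro nn_integral_cong nn_integral_distr) auto
  finally show ?thesis .
qed

lemma distr_design: "distr M borel design = gauss \<sigma>X"
proof (rule measure_eqI)
  fix S :: "(real^'d^'n) set" assume "S \<in> sets (distr M borel design)"
  then have [measurable]: "S \<in> sets borel" by simp
  have "emeasure (distr M borel design) S = (\<integral>\<^sup>+\<omega>. indicator S (fst (design \<omega>, noise \<omega>)) \<partial>M)"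
    by (subst nn_integral_indicator[symmetric], simp, subst nn_integral_distr) auto
  also have "\<dots> = (\<integral>\<^sup>+A. \<integral>\<^sup>+\<omega>. indicator S (fst (A, noise \<omega>)) \<partial>M \<partial>gauss \<sigma>X)"
    by (rule nn_integral_design_noise) measurable
  also have "\<dots> = emeasure (gauss \<sigma>X) S" by (simp add: emeasure_space_1)
  finally show "emeasure (distr M borel design) S = emeasure (gauss \<sigma>X) S" .
qed simp

lemma AE_design_full_rank: "AE \<omega> in M. full_rank (design \<omega>)"
proof -
  have "AE A in distr M borel design. full_rank A"
    unfolding distr_design by (rule AE_gauss_full_rank)
  moreover have "Measurable.pred borel (full_rank :: real^'d^'n \<Rightarrow> bool)"
    unfolding full_rank_def by (cases "CARD('d) \<le> CARD('n)") simp_all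
  ultimately show ?thesis by (subst (asm) AE_distr_iff) auto
qed

text \<open>The entries of the noise matrix are centred and uncorrelated with common variance, so
  nothing but the constant and the squared coefficients survives. Two moments of the noise are
  enough for this.\<close>

lemma affine_noise_second_moment:
  fixes l :: "'n \<Rightarrow> 'k \<Rightarrow> real"
  shows "integrable M (\<lambda>\<omega>. (c + (\<Sum>i\<in>UNIV. \<Sum>a\<in>UNIV. l i a * noise \<omega> $ i $ a))\<^sup>2)"
    and "(\<integral>\<omega>. (c + (\<Sum>i\<in>UNIV. \<Sum>a\<in>UNIV. l i a * noise \<omega> $ i $ a))\<^sup>2 \<partial>M) =
      c\<^sup>2 + \<sigma>\<xi>\<^sup>2 * (\<Sum>i\<in>UNIV. \<Sum>a\<in>UNIV. (l i a)\<^sup>2)"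
proof -
  have expand: "(c + (\<Sum>i\<in>UNIV. \<Sum>a\<in>UNIV. l i a * noise \<omega> $ i $ a))\<^sup>2 =
     c\<^sup>2 + (\<Sum>i\<in>UNIV. \<Sum>a\<in>UNIV. 2 * c * l i a * \<xi> (Some i) \<omega> $ a) +
     (\<Sum>p\<in>UNIV. \<Sum>q\<in>UNIV. l (fst p) (snd p) * l (fst q) (snd q) *
       (\<xi> (Some (fst p)) \<omega> $ snd p * \<xi> (Some (fst q)) \<omega> $ snd q))" for \<omega>
  proof -
    have "(c + (\<Sum>p\<in>UNIV. f p))\<^sup>2 = c\<^sup>2 + (\<Sum>p\<in>UNIV. 2 * c * f p) + (\<Sum>p\<in>UNIV. \<Sum>q\<in>UNIV. f p * f q)"
      for f :: "'n \<times> 'k \<Rightarrow> real"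
    proof -
      have "(c + (\<Sum>p\<in>UNIV. f p))\<^sup>2 = c\<^sup>2 + 2 * c * (\<Sum>p\<in>UNIV. f p) + (\<Sum>p\<in>UNIV. f p) * (\<Sum>p\<in>UNIV. f p)"
        by (simp add: power2_eq_square algebra_simps)
      also have "2 * c * (\<Sum>p\<in>UNIV. f p) = (\<Sum>p\<in>UNIV. 2 * c * f p)" by (rule sum_distrib_left)
      also have "(\<Sum>p\<in>UNIV. f p) * (\<Sum>p\<in>UNIV. f p) = (\<Sum>p\<in>UNIV. \<Sum>q\<in>UNIV. f p * f q)" by (rule sum_product)
      finally show ?thesis .
    qed
    from this[of "\<lambda>p. l (fst p) (snd p) * \<xi> (Some (fst p)) \<omega> $ snd p"]
    show ?thesis by (simp add: sum_pair_UNIV[of "\<lambda>p. _ p * _ p"] sum_pair_UNIV[of "\<lambda>p. 2 * _ p"] mult_ac)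
  qed
  show "integrable M (\<lambda>\<omega>. (c + (\<Sum>i\<in>UNIV. \<Sum>a\<in>UNIV. l i a * noise \<omega> $ i $ a))\<^sup>2)"
    unfolding expand
    by (intro Bochner_Integration.integrable_add Bochner_Integration.integrable_sum integrable_mult_right
        xi_moments xi_cross_moments) simp
  have "(\<integral>\<omega>. (c + (\<Sum>i\<in>UNIV. \<Sum>a\<in>UNIV. l i a * noise \<omega> $ i $ a))\<^sup>2 \<partial>M) =
     c\<^sup>2 + (\<Sum>p\<in>UNIV. \<Sum>q\<in>UNIV. l (fst p) (snd p) * l (fst q) (snd q) *
       (if Some (fst p) = Some (fst q) \<and> snd p = snd q then \<sigma>\<xi>\<^sup>2 else 0))"
    unfolding expand
    by (simp add: xi_moments xi_cross_moments Bochner_Integration.integral_sum prob_space)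
  also have "(\<Sum>p\<in>UNIV. \<Sum>q\<in>UNIV. l (fst p) (snd p) * l (fst q) (snd q) *
       (if Some (fst p) = Some (fst q) \<and> snd p = snd q then \<sigma>\<xi>\<^sup>2 else 0)) =
     (\<Sum>p\<in>UNIV. \<Sum>q\<in>UNIV. if p = q then \<sigma>\<xi>\<^sup>2 * (l (fst p) (snd p))\<^sup>2 else 0)"
    by (intro sum.cong refl) (auto simp: prod_eq_iff power2_eq_square)
  also have "\<dots> = \<sigma>\<xi>\<^sup>2 * (\<Sum>i\<in>UNIV. \<Sum>a\<in>UNIV. (l i a)\<^sup>2)"
    by (simp add: sum_pair_UNIV[of "\<lambda>p. _ * _ p"] sum_distrib_left)
  finally show "(\<integral>\<omega>. (c + (\<Sum>i\<in>UNIV. \<Sum>a\<in>UNIV. l i a * noise \<omega> $ i $ a))\<^sup>2 \<partial>M) =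
      c\<^sup>2 + \<sigma>\<xi>\<^sup>2 * (\<Sum>i\<in>UNIV. \<Sum>a\<in>UNIV. (l i a)\<^sup>2)" .
qed

end

subsection \<open>The generalisation gap\<close>

lemma frob_norm_power2: "(frob_norm A)\<^sup>2 = (norm A)\<^sup>2"
  unfolding norm_matrix_power2 frob_norm_def by (simp add: sum_nonneg)

lemma (in rep_pair) borel_measurable_perp [measurable (raw)]:
  assumes [measurable]: "f \<in> borel_measurable N"
  shows "(\<lambda>x. perp (f x)) \<in> borel_measurable N"
  unfolding perp_def
  by (intro borel_measurable_vec_lambda borel_measurable_sum borel_measurable_times borel_measurable_const
      borel_measurable_vec_nth assms)

text \<open>Each entry is brought into the affine form of \<open>affine_noise_second_moment\<close>.
  The coefficients are K^T applied to fixed slices of the complementary projection, and the mean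
  squared norm of such vectors is known.\<close>

lemma (in rep_pair) perp_add_mult_nth:
  fixes K :: "real^'n^'d" and N :: "real^'k^'n"
  shows "perp (Z + K ** N) $ r $ s = perp Z $ r $ s +
    (\<Sum>i\<in>UNIV. \<Sum>a\<in>UNIV. (transpose K *v (\<chi> u. perp_coeff (r, s) (u, a))) $ i * N $ i $ a)"
proof -
  have "perp (Z + K ** N) $ r $ s = perp Z $ r $ s + (\<Sum>q\<in>UNIV. perp_coeff (r, s) q * (K ** N) $ fst q $ snd q)"
    by (simp add: perp_def distrib_left sum.distrib)
  also have "(\<Sum>q\<in>UNIV. perp_coeff (r, s) q * (K ** N) $ fst q $ snd q) =
     (\<Sum>u\<in>UNIV. \<Sum>a\<in>UNIV. \<Sum>i\<in>UNIV. perp_coeff (r, s) (u, a) * (K $ u $ i * N $ i $ a))"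
    by (simp add: sum_pair_UNIV matrix_matrix_mult_def sum_distrib_left)
  also have "\<dots> = (\<Sum>a\<in>UNIV. \<Sum>u\<in>UNIV. \<Sum>i\<in>UNIV. perp_coeff (r, s) (u, a) * (K $ u $ i * N $ i $ a))"
    by (rule sum.swap)
  also have "\<dots> = (\<Sum>a\<in>UNIV. \<Sum>i\<in>UNIV. \<Sum>u\<in>UNIV. perp_coeff (r, s) (u, a) * (K $ u $ i * N $ i $ a))"
    by (intro sum.cong refl sum.swap)
  also have "\<dots> = (\<Sum>i\<in>UNIV. \<Sum>a\<in>UNIV. \<Sum>u\<in>UNIV. perp_coeff (r, s) (u, a) * (K $ u $ i * N $ i $ a))"
    by (rule sum.swap)
  also have "\<dots> = (\<Sum>i\<in>UNIV. \<Sum>a\<in>UNIV. (transpose K *v (\<chi> u. perp_coeff (r, s) (u, a))) $ i * N $ i $ a)"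
    by (intro sum.cong refl)
       (simp add: vector_matrix_mult_def sum_distrib_right, simp add: sum_distrib_left mult_ac)
  finally show ?thesis .
qed

locale equivariant_regression =
  rep: rep_pair G lam \<phi> \<psi> + reg: gauss_regression M X \<xi> \<sigma>X \<sigma>\<xi>
  for G :: "('g, 'b) monoid_scheme" and lam :: "'g measure"
    and \<phi> :: "'g \<Rightarrow> real^'d^'d" and \<psi> :: "'g \<Rightarrow> real^'k^'k"
    and M :: "'m measure"
    and X :: "'n::finite option \<Rightarrow> 'm \<Rightarrow> real^'d" and \<xi> :: "'n option \<Rightarrow> 'm \<Rightarrow> real^'k"
    and \<sigma>X \<sigma>\<xi> :: real +
  fixes \<Theta> :: "real^'k^'d"
  assumes equiv: "lin_equivariant G \<phi> \<psi> \<Theta>"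
begin

definition estimate :: "'m \<Rightarrow> real^'k^'d" where
  "estimate \<omega> = lsq (data_matrix (\<lambda>i. X (Some i) \<omega>))
    (data_matrix (\<lambda>i. linpred \<Theta> (X (Some i) \<omega>) + \<xi> (Some i) \<omega>))"

lemma AE_estimate:
  "AE \<omega> in M. estimate \<omega> = lsq_map (reg.design \<omega>) ** reg.design \<omega> ** \<Theta> + lsq_map (reg.design \<omega>) ** reg.noise \<omega>"
  using reg.AE_design_full_rank
proof eventually_elim
  case (elim \<omega>)
  have "data_matrix (\<lambda>i. linpred \<Theta> (X (Some i) \<omega>) + \<xi> (Some i) \<omega>) = reg.design \<omega> ** \<Theta> + reg.noise \<omega>"
    by (simp add: vec_eq_iff data_matrix_def linpred_def matrix_matrix_mult_def vector_matrix_mult_def mult.commute)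
  then show ?case
    unfolding estimate_def reg.design_def[symmetric] lsq_eq_lsq_map[OF elim]
    by (simp add: matrix_add_ldistrib matrix_mul_assoc)
qed

text \<open>The design is frozen: \<open>K\<close> becomes \<open>lsq_map A\<close> and
  \<open>Z\<close> the signal part. The value is split as a sum of nonnegative terms because the
  integral over \<open>A\<close> that follows may diverge.\<close>

lemma nn_integral_noise:
  fixes K :: "real^'n^'d"
  shows "(\<integral>\<^sup>+\<omega>. ennreal ((norm (rep.perp (Z + K ** reg.noise \<omega>)))\<^sup>2) \<partial>M) =
    ennreal ((norm (rep.perp Z))\<^sup>2) + ennreal (\<sigma>\<xi>\<^sup>2) *
      (\<Sum>p\<in>UNIV. \<Sum>a\<in>UNIV. ennreal ((norm (transpose K *v (\<chi> u. rep.perp_coeff p (u, a))))\<^sup>2))"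
proof -
  define l where "l p i a = (transpose K *v (\<chi> u. rep.perp_coeff p (u, a))) $ i" for p i a
  have norm_l: "(norm (transpose K *v (\<chi> u. rep.perp_coeff p (u, a))))\<^sup>2 = (\<Sum>i\<in>UNIV. (l p i a)\<^sup>2)" for p a
    by (simp add: norm_vec_def L2_set_def sum_nonneg l_def)
  have eq: "(norm (rep.perp (Z + K ** reg.noise \<omega>)))\<^sup>2 = (\<Sum>p\<in>UNIV. (rep.perp Z $ fst p $ snd p +
      (\<Sum>i\<in>UNIV. \<Sum>a\<in>UNIV. l p i a * reg.noise \<omega> $ i $ a))\<^sup>2)" for \<omega>
    unfolding rep.norm_matrix_power2_pair rep.perp_add_mult_nth l_def by simp
  have "integrable M (\<lambda>\<omega>. (norm (rep.perp (Z + K ** reg.noise \<omega>)))\<^sup>2)"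
    unfolding eq by (intro Bochner_Integration.integrable_sum reg.affine_noise_second_moment)
  then have "(\<integral>\<^sup>+\<omega>. ennreal ((norm (rep.perp (Z + K ** reg.noise \<omega>)))\<^sup>2) \<partial>M) =
     ennreal (\<integral>\<omega>. (norm (rep.perp (Z + K ** reg.noise \<omega>)))\<^sup>2 \<partial>M)"
    by (intro nn_integral_eq_integral) auto
  also have "(\<integral>\<omega>. (norm (rep.perp (Z + K ** reg.noise \<omega>)))\<^sup>2 \<partial>M) =
     (\<Sum>p\<in>UNIV. (rep.perp Z $ fst p $ snd p)\<^sup>2 + \<sigma>\<xi>\<^sup>2 * (\<Sum>i\<in>UNIV. \<Sum>a\<in>UNIV. (l p i a)\<^sup>2))"
    unfolding eq
    by (subst Bochner_Integration.integral_sum)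
       (rule reg.affine_noise_second_moment, simp only: reg.affine_noise_second_moment(2))
  also have "\<dots> = (norm (rep.perp Z))\<^sup>2 + \<sigma>\<xi>\<^sup>2 *
      (\<Sum>p\<in>UNIV. \<Sum>a\<in>UNIV. (norm (transpose K *v (\<chi> u. rep.perp_coeff p (u, a))))\<^sup>2)"
    unfolding norm_l rep.norm_matrix_power2_pair sum.distrib sum_distrib_left[symmetric]
    by (simp add: sum.swap[of _ "UNIV :: 'n set"])
  finally show ?thesis
    by (simp add: ennreal_mult sum_nonneg sum_ennreal del: transpose_matrix_vector)
qed

text \<open>By rotation invariance every slice of the complementary projection contributes its
  squared norm times one common factor, and these squared norms add up to the trace of that
  projection.\<close>

lemma nn_integral_norm_perp_estimate:
  "(\<integral>\<^sup>+\<omega>. ennreal (\<sigma>X\<^sup>2 * (norm (rep.perp (estimate \<omega>)))\<^sup>2) \<partial>M) = ennreal (\<sigma>X\<^sup>2) *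
    ((\<integral>\<^sup>+A. ennreal ((norm (rep.perp (lsq_map A ** A ** \<Theta>)))\<^sup>2) \<partial>(gauss \<sigma>X :: (real^'d^'n) measure)) +
     ennreal (\<sigma>\<xi>\<^sup>2 * (real (CARD('d) * CARD('k)) - char_prod lam \<phi> \<psi>)) *
     (if CARD('n) > CARD('d) + 1 then ennreal (1 / (\<sigma>X\<^sup>2 * (real CARD('n) - real CARD('d) - 1)))
      else if CARD('d) > CARD('n) + 1 then
        ennreal (real CARD('n) / (real CARD('d) * (\<sigma>X\<^sup>2 * (real CARD('d) - real CARD('n) - 1))))
      else \<infinity>))"
proof -
  let ?G = "gauss \<sigma>X :: (real^'d^'n) measure"
  define S where "S = (if CARD('n) > CARD('d) + 1 then ennreal (1 / (\<sigma>X\<^sup>2 * (real CARD('n) - real CARD('d) - 1)))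
      else if CARD('d) > CARD('n) + 1 then
        ennreal (real CARD('n) / (real CARD('d) * (\<sigma>X\<^sup>2 * (real CARD('d) - real CARD('n) - 1))))
      else \<infinity>)"
  define f where "f z = ennreal ((norm (rep.perp (lsq_map (fst z) ** fst z ** \<Theta> + lsq_map (fst z) ** snd z)))\<^sup>2)"
    for z :: "(real^'d^'n) \<times> (real^'k^'n)"
  have f [measurable]: "f \<in> borel_measurable (borel \<Otimes>\<^sub>M borel)"
    unfolding f_def by measurable
  have "(\<integral>\<^sup>+\<omega>. ennreal (\<sigma>X\<^sup>2 * (norm (rep.perp (estimate \<omega>)))\<^sup>2) \<partial>M) =
     (\<integral>\<^sup>+\<omega>. ennreal (\<sigma>X\<^sup>2) * f (reg.design \<omega>, reg.noise \<omega>) \<partial>M)"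
  proof (rule nn_integral_cong_AE)
    show "AE \<omega> in M. ennreal (\<sigma>X\<^sup>2 * (norm (rep.perp (estimate \<omega>)))\<^sup>2) =
        ennreal (\<sigma>X\<^sup>2) * f (reg.design \<omega>, reg.noise \<omega>)"
      using AE_estimate by eventually_elim (simp add: f_def ennreal_mult)
  qed
  also have "\<dots> = ennreal (\<sigma>X\<^sup>2) * (\<integral>\<^sup>+\<omega>. f (reg.design \<omega>, reg.noise \<omega>) \<partial>M)"
    by (rule nn_integral_cmult) measurable
  also have "(\<integral>\<^sup>+\<omega>. f (reg.design \<omega>, reg.noise \<omega>) \<partial>M) = (\<integral>\<^sup>+A. \<integral>\<^sup>+\<omega>. f (A, reg.noise \<omega>) \<partial>M \<partial>?G)"
    by (rule reg.nn_integral_design_noise[OF f])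
  also have "\<dots> = (\<integral>\<^sup>+A. ennreal ((norm (rep.perp (lsq_map A ** A ** \<Theta>)))\<^sup>2) + ennreal (\<sigma>\<xi>\<^sup>2) *
      (\<Sum>p\<in>UNIV. \<Sum>a\<in>UNIV. ennreal ((norm (transpose (lsq_map A) *v (\<chi> u. rep.perp_coeff p (u, a))))\<^sup>2)) \<partial>?G)"
    unfolding f_def fst_conv snd_conv nn_integral_noise ..
  also have "\<dots> = (\<integral>\<^sup>+A. ennreal ((norm (rep.perp (lsq_map A ** A ** \<Theta>)))\<^sup>2) \<partial>?G) + ennreal (\<sigma>\<xi>\<^sup>2) *
      (\<Sum>p\<in>UNIV. \<Sum>a\<in>UNIV. \<integral>\<^sup>+A. ennreal ((norm (transpose (lsq_map A) *v (\<chi> u. rep.perp_coeff p (u, a))))\<^sup>2) \<partial>?G)"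
    by (subst nn_integral_add, measurable, subst nn_integral_cmult, measurable,
        subst nn_integral_sum, measurable, subst nn_integral_sum, measurable)
  also have "(\<Sum>p\<in>UNIV. \<Sum>a\<in>UNIV. \<integral>\<^sup>+A. ennreal ((norm (transpose (lsq_map A) *v (\<chi> u. rep.perp_coeff p (u, a))))\<^sup>2) \<partial>?G) =
     (\<Sum>p\<in>UNIV. \<Sum>a\<in>UNIV. ennreal ((norm (\<chi> u. rep.perp_coeff p (u, a)))\<^sup>2) * S)"
    unfolding nn_integral_gauss_lsq_map[OF reg.sX] S_def ..
  also have "\<dots> = ennreal (\<Sum>p\<in>UNIV. \<Sum>a\<in>UNIV. (norm (\<chi> u. rep.perp_coeff p (u, a)))\<^sup>2) * S"
    by (simp add: sum_nonneg sum_ennreal flip: sum_distrib_right)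
  also have "(\<Sum>p\<in>UNIV. \<Sum>a\<in>UNIV. (norm (\<chi> u. rep.perp_coeff p (u, a)))\<^sup>2) =
     (\<Sum>p\<in>UNIV. \<Sum>q\<in>UNIV. (rep.perp_coeff p q)\<^sup>2)"
    unfolding sum_pair_UNIV[of "\<lambda>q. (rep.perp_coeff _ q)\<^sup>2"]
    by (intro sum.cong refl) (simp add: norm_vec_def L2_set_def sum_nonneg sum.swap[of _ "UNIV :: 'k set"])
  also have "\<dots> = real (CARD('d) * CARD('k)) - char_prod lam \<phi> \<psi>"
    by (rule rep.sum_perp_coeff_sq)
  also have "ennreal (\<sigma>\<xi>\<^sup>2) * (ennreal (real (CARD('d) * CARD('k)) - char_prod lam \<phi> \<psi>) * S) =
     ennreal (\<sigma>\<xi>\<^sup>2 * (real (CARD('d) * CARD('k)) - char_prod lam \<phi> \<psi>)) * S"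
    using rep.char_prod_le by (simp add: ennreal_mult mult.assoc)
  finally show ?thesis unfolding S_def .
qed

end

theorem theorem4p7:
  fixes G :: "('g, 'b) monoid_scheme" and lam :: "'g measure"
    and \<phi> :: "'g \<Rightarrow> real^'d^'d" and \<psi> :: "'g \<Rightarrow> real^'k^'k"
    and \<Theta> :: "real^'k^'d"
    and M :: "'m measure"
    and X :: "'n::finite option \<Rightarrow> 'm \<Rightarrow> real^'d"
    and \<xi> :: "'n option \<Rightarrow> 'm \<Rightarrow> real^'k"
    and \<sigma>X \<sigma>\<xi> :: real
  defines "d \<equiv> CARD('d)" and "k \<equiv> CARD('k)" and "n \<equiv> CARD('n)"
  defines "Y \<equiv> (\<lambda>i \<omega>. linpred \<Theta> (X i \<omega>) + \<xi> i \<omega>)"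
  defines "W \<equiv> (\<lambda>\<omega>. lsq (data_matrix (\<lambda>i. X (Some i) \<omega>)) (data_matrix (\<lambda>i. Y (Some i) \<omega>)))"
  defines "Wbar \<equiv> (\<lambda>\<omega>. orbit_avg G lam \<phi> \<psi> (W \<omega>))"
  defines "R \<equiv> risk M (X None) (Y None)"
  defines "gapE \<equiv> (\<lambda>f'. \<integral>\<^sup>+ \<omega>. ennreal (R (linpred (W \<omega>)) - R (f' \<omega>)) \<partial>M)"
  defines "chi \<equiv> char_prod lam \<phi> \<psi>"
  assumes haar: "haar_prob G lam"
    and rep_phi: "orth_rep G lam \<phi>" and rep_psi: "orth_rep G lam \<psi>"
    and equiv_Theta: "lin_equivariant G \<phi> \<psi> \<Theta>"
    and M: "prob_space M"
    and sX: "\<sigma>X > 0"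
    and X_gauss: "\<And>i. distributed M lborel (X i) (iso_gauss_density \<sigma>X)"
    and xi_meas: "\<And>i. \<xi> i \<in> borel_measurable M"
    and xi_ident: "\<And>i. distr M borel (\<xi> i) = distr M borel (\<xi> None)"
    and xi_mean: "\<And>a. integrable M (\<lambda>\<omega>. \<xi> None \<omega> $ a) \<and> (\<integral>\<omega>. \<xi> None \<omega> $ a \<partial>M) = 0"
    and xi_cov: "\<And>a b. integrable M (\<lambda>\<omega>. \<xi> None \<omega> $ a * \<xi> None \<omega> $ b) \<and>
                   (\<integral>\<omega>. \<xi> None \<omega> $ a * \<xi> None \<omega> $ b \<partial>M) = (if a = b then \<sigma>\<xi>^2 else 0)"
    and indep_pairs: "prob_space.indep_vars M (\<lambda>_. borel) (\<lambda>i \<omega>. (X i \<omega>, \<xi> i \<omega>)) UNIV"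
    and indep_X_xi: "\<And>i. distr M (borel \<Otimes>\<^sub>M borel) (\<lambda>\<omega>. (X i \<omega>, \<xi> i \<omega>)) =
                         distr M borel (X i) \<Otimes>\<^sub>M distr M borel (\<xi> i)"
  shows
    "(n > d + 1 \<longrightarrow>
        gapE (\<lambda>\<omega>. linpred (Wbar \<omega>)) = ennreal (\<sigma>\<xi>^2 * (real (d * k) - chi) / (real n - real d - 1)) \<and>
        (\<forall>f' :: 'm \<Rightarrow> real^'d \<Rightarrow> real^'k.
           (\<forall>\<omega>\<in>space M. R (f' \<omega>) \<le> R (linpred (Wbar \<omega>))) \<longrightarrow>
           gapE f' \<ge> ennreal (\<sigma>\<xi>^2 * (real (d * k) - chi) / (real n - real d - 1))))
     \<and>
     (real d - 1 \<le> real n \<and> real n \<le> real d + 1 \<and> \<sigma>\<xi> \<noteq> 0 \<and>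
      \<not> (AE \<omega> in M. lin_equivariant G \<phi> \<psi> (W \<omega>)) \<longrightarrow>
        gapE (\<lambda>\<omega>. linpred (Wbar \<omega>)) = \<infinity> \<and>
        (\<forall>f' :: 'm \<Rightarrow> real^'d \<Rightarrow> real^'k.
           (\<forall>\<omega>\<in>space M. R (f' \<omega>) \<le> R (linpred (Wbar \<omega>))) \<longrightarrow> gapE f' = \<infinity>))
     \<and>
     (n + 1 < d \<longrightarrow>
        (let T1 = \<sigma>X^2 * (real n * (real d - real n)) / (real d * (real d - 1) * (real d + 2)) *
                    ((real d + 1) * (frob_norm \<Theta>)^2 - trace (J_G G lam \<phi> \<psi> ** (transpose \<Theta> ** \<Theta>)));
             T2 = \<sigma>\<xi>^2 * (real n * (real (d * k) - chi)) / (real d * (real d - real n - 1))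
         in gapE (\<lambda>\<omega>. linpred (Wbar \<omega>)) = ennreal (T1 + T2) \<and> T1 \<ge> 0 \<and> T2 \<ge> 0 \<and>
            (\<forall>f' :: 'm \<Rightarrow> real^'d \<Rightarrow> real^'k.
               (\<forall>\<omega>\<in>space M. R (f' \<omega>) \<le> R (linpred (Wbar \<omega>))) \<longrightarrow> gapE f' \<ge> ennreal (T1 + T2))))"
proof -
  interpret equivariant_regression G lam \<phi> \<psi> M X \<xi> \<sigma>X \<sigma>\<xi> \<Theta>
    using haar rep_phi rep_psi equiv_Theta M sX X_gauss xi_meas xi_ident xi_mean xi_cov indep_pairs indep_X_xi
    by (intro equivariant_regression.intro rep_pair.intro gauss_regression.intro
        gauss_regression_axioms.intro equivariant_regression_axioms.intro)
  have W_eq: "W = estimate" by (simp add: W_def Y_def estimate_def fun_eq_iff)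
  \<comment> \<open>Risks refer to the test pair with the matrix held fixed, so
    \<open>risk_linpred\<close> applies at each outcome and the irreducible noise cancels.\<close>
  have gap: "R (linpred (W \<omega>)) - R (linpred (Wbar \<omega>)) = \<sigma>X\<^sup>2 * (norm (rep.perp (estimate \<omega>)))\<^sup>2" for \<omega>
    unfolding R_def Y_def reg.risk_linpred Wbar_def W_eq rep.norm_diff_orbit_avg[OF equiv, symmetric]
    by (simp add: algebra_simps)
  \<comment> \<open>A predictor with smaller risk only enlarges the integrand, so each statement for
    a general \<open>f'\<close> follows from the one for the averaged predictor.\<close>
  have mono: "gapE (\<lambda>\<omega>. linpred (Wbar \<omega>)) \<le> gapE f'"
    if "\<forall>\<omega>\<in>space M. R (f' \<omega>) \<le> R (linpred (Wbar \<omega>))" for f'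
    unfolding gapE_def using that by (intro nn_integral_mono ennreal_leI) auto
  have gapE_eq: "gapE (\<lambda>\<omega>. linpred (Wbar \<omega>)) = ennreal (\<sigma>X\<^sup>2) *
    ((\<integral>\<^sup>+A. ennreal ((norm (rep.perp (lsq_map A ** A ** \<Theta>)))\<^sup>2) \<partial>(gauss \<sigma>X :: (real^'d^'n) measure)) +
     ennreal (\<sigma>\<xi>\<^sup>2 * (real (d * k) - chi)) *
     (if n > d + 1 then ennreal (1 / (\<sigma>X\<^sup>2 * (real n - real d - 1)))
      else if d > n + 1 then ennreal (real n / (real d * (\<sigma>X\<^sup>2 * (real d - real n - 1))))
      else \<infinity>))"
    unfolding gapE_def gap nn_integral_norm_perp_estimate d_def k_def n_def chi_def ..
  have chi_le: "chi \<le> real (d * k)"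
    unfolding chi_def d_def k_def by (rule rep.char_prod_le)
  have sX2: "\<sigma>X\<^sup>2 > 0" using sX by simp
  define q where "q = \<sigma>\<xi>\<^sup>2 * (real (d * k) - chi)"
  have q0: "q \<ge> 0" unfolding q_def using chi_le by (intro mult_nonneg_nonneg) auto
  have tall: "gapE (\<lambda>\<omega>. linpred (Wbar \<omega>)) = ennreal (\<sigma>\<xi>^2 * (real (d * k) - chi) / (real n - real d - 1))"
    if nd: "n > d + 1"
  proof -
    have "(\<integral>\<^sup>+A. ennreal ((norm (rep.perp (lsq_map A ** A ** \<Theta>)))\<^sup>2) \<partial>(gauss \<sigma>X :: (real^'d^'n) measure)) = 0"
    proof -
      have perp0: "rep.perp \<Theta> = 0" using rep.orbit_avg_fixed[OF equiv] by (simp add: rep.perp_eq)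
      have le: "CARD('d) \<le> CARD('n)" using nd by (simp add: d_def n_def)
      have "AE A in (gauss \<sigma>X :: (real^'d^'n) measure). ennreal ((norm (rep.perp (lsq_map A ** A ** \<Theta>)))\<^sup>2) = 0"
        using AE_gauss_full_rank
      proof eventually_elim
        case (elim A)
        show ?case by (simp add: lsq_map_tall(1)[OF elim le] perp0)
      qed
      then show ?thesis by (subst nn_integral_0_iff_AE) auto
    qed
    moreover define b where "b = 1 / (\<sigma>X\<^sup>2 * (real n - real d - 1))"
    ultimately have "gapE (\<lambda>\<omega>. linpred (Wbar \<omega>)) = ennreal (\<sigma>X\<^sup>2) * (ennreal q * ennreal b)"
      using nd unfolding gapE_eq q_def[symmetric] b_def[symmetric] by simp
    also have "\<dots> = ennreal (\<sigma>X\<^sup>2 * (q * b))"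
    proof -
      have "b \<ge> 0" unfolding b_def using nd by simp
      then show ?thesis using q0 by (simp add: ennreal_mult)
    qed
    \<comment> \<open>The input scale cancels: excess risk grows like \<sigma>X^2, the inverse Gram
      matrix shrinks like its reciprocal.\<close>
    also have "\<sigma>X\<^sup>2 * (q * b) = \<sigma>\<xi>^2 * (real (d * k) - chi) / (real n - real d - 1)"
      using sX2 by (simp add: q_def b_def)
    finally show ?thesis .
  qed
  have threshold: "gapE (\<lambda>\<omega>. linpred (Wbar \<omega>)) = \<infinity>"
    if h: "real d - 1 \<le> real n" "real n \<le> real d + 1" "\<sigma>\<xi> \<noteq> 0" "\<not> (AE \<omega> in M. lin_equivariant G \<phi> \<psi> (W \<omega>))"
  proof -
    \<comment> \<open>A character product equal to d k would make every matrix equivariant. With chi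
      strictly smaller, a positive coefficient multiplies an infinite mean, and the signal term,
      being nonnegative, cannot offset it.\<close>
    have "chi \<noteq> real (d * k)"
      using h(4) rep.all_equivariant_if_char_prod unfolding chi_def d_def k_def by auto
    then have "q > 0" unfolding q_def using h(3) chi_le by (intro mult_pos_pos) auto
    moreover have "\<not> n > d + 1" "\<not> d > n + 1" using h(1,2) by linarith+
    ultimately show ?thesis
      using sX2 unfolding gapE_eq q_def[symmetric]
      by (simp add: ennreal_mult_eq_top_iff ennreal_mult_top ennreal_top_mult)
  qed
  define T1 where "T1 = \<sigma>X^2 * (real n * (real d - real n)) / (real d * (real d - 1) * (real d + 2)) *
      ((real d + 1) * (frob_norm \<Theta>)^2 - trace (J_G G lam \<phi> \<psi> ** (transpose \<Theta> ** \<Theta>)))"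
  define T2 where "T2 = \<sigma>\<xi>^2 * (real n * (real (d * k) - chi)) / (real d * (real d - real n - 1))"
  have wide: "gapE (\<lambda>\<omega>. linpred (Wbar \<omega>)) = ennreal (T1 + T2) \<and> T1 \<ge> 0 \<and> T2 \<ge> 0" if nd: "n + 1 < d"
  proof -
    have lt: "CARD('n) < CARD('d)" using nd by (simp add: n_def d_def)
    define I where "I = (\<integral>A. (norm (rep.perp (row_proj A ** \<Theta>)))\<^sup>2 \<partial>(gauss \<sigma>X :: (real^'d^'n) measure))"
    have I0: "I \<ge> 0" unfolding I_def by (rule integral_nonneg_AE) simp
    \<comment> \<open>The sign of \<open>T1\<close> is read off from its origin as a mean of squared
      norms, where it is evident, and not from the closed form with \<open>J_G\<close>.\<close>
    have T1: "T1 = \<sigma>X\<^sup>2 * I"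
      unfolding T1_def I_def rep.integral_norm_perp_row_proj(2)[OF sX lt equiv] frob_norm_power2 d_def n_def
      by simp
    define b where "b = real n / (real d * (\<sigma>X\<^sup>2 * (real d - real n - 1)))"
    have b0: "b \<ge> 0" unfolding b_def using nd by simp
    have T2: "T2 = \<sigma>X\<^sup>2 * (q * b)"
      unfolding T2_def q_def b_def using sX2 by simp
    have "T2 \<ge> 0" unfolding T2 using q0 b0 by simp
    moreover have "gapE (\<lambda>\<omega>. linpred (Wbar \<omega>)) = ennreal (T1 + T2)"
    proof -
      have "(\<integral>\<^sup>+A. ennreal ((norm (rep.perp (lsq_map A ** A ** \<Theta>)))\<^sup>2) \<partial>(gauss \<sigma>X :: (real^'d^'n) measure)) = ennreal I"
        unfolding row_proj_eq_lsq_map[OF lt] I_def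
        by (rule nn_integral_eq_integral[OF rep.integral_norm_perp_row_proj(1)[OF sX lt equiv]]) simp
      then have "gapE (\<lambda>\<omega>. linpred (Wbar \<omega>)) = ennreal (\<sigma>X\<^sup>2) * (ennreal I + ennreal q * ennreal b)"
        using nd unfolding gapE_eq q_def[symmetric] b_def[symmetric] by simp
      also have "\<dots> = ennreal (T1 + T2)"
        unfolding T1 T2 using q0 b0 I0 by (simp add: ennreal_mult ennreal_plus distrib_left)
      finally show ?thesis .
    qed
    ultimately show ?thesis using T1 I0 by simp
  qed
  show ?thesis
    unfolding Let_def T1_def[symmetric] T2_def[symmetric]
    using tall threshold wide mono by (auto simp: top_unique)
qed

end
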